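(* Let $M\ge1$ be an integer. Consider the set $$\mathcal{L}_M=\left\{\frac{D_f^{(m)}(k/2)}{D_f(k/2)} \;\middle|\; g\ge1,\ f\in E(g,k,k/2),\ 1\le m\le M\right\},$$ where $k$ ranges over even integers with $k>2(g+1)$. Then $$\mathrm{tr}_{\mathbb{Q}}(\mathcal{L}_M)\ \ge\ \mathrm{tr}_{\mathbb{Q}}\left(\left\{\psi^{(2m)}(1)\;\Big|\;1\le m\le\left[\frac{M-1}{2}\right]\right\}\right).$$
   Context: $[x]$ is the greatest integer $\le x$. For a set $B$ of complex numbers, $\mathrm{tr}_{\mathbb{Q}}(B)$ is the transcendence degree over $\mathbb{Q}$ of the field $\mathbb{Q}(B)$. $\psi=\Gamma'/\Gamma$ is the digamma function and $\psi^{(m)}$ its $m$-th derivative. For an integer $g\ge1$, $\mathrm{Sp}_g(\mathbb{Z})$ is the full Siegel modular group of genus $g$ and $\Lambda_g^+$ the set of positive definite (symmetric) half-integral matrices of size $g$. For an even integer $k$, let $f$ be a Siegel cusp form of weight $k$ for $\mathrm{Sp}_g(\mathbb{Z})$ with Fourier coefficients $a(T)$, $T\in\Lambda_g^+$. The Koecher-Maass series of $f$ is $$D_f(s)=\sum_{T\in\Lambda_g^+/\mathrm{GL}_g(\mathbb{Z})}\frac{a(T)}{\epsilon(T)}(\det T)^{-s}\qquad(\Re(s)\gg1),$$ where $\mathrm{GL}_g(\mathbb{Z})$ acts by $T\mapsto U^tTU$ and $\epsilon(T)=\#\{U\in\mathrm{GL}_g(\mathbb{Z}): U^tTU=T\}$.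 The completed series $D_f^*(s)=(2\pi)^{-gs}\prod_{\nu=0}^{g-1}\Gamma(s-\nu/2)D_f(s)$ has a holomorphic continuation to $\mathbb{C}$ and satisfies $D_f^*(k-s)=(-1)^{gk/2}D_f^*(s)$; $D_f(s)$ is continued accordingly, and $D_f^{(m)}$ is its $m$-th derivative. $E(g,k,s_0)$ is the set of all Siegel Hecke eigen cusp forms $f$ of weight $k$ for $\mathrm{Sp}_g(\mathbb{Z})$ such that $D_f(s_0)\neq0$. *)

theory Defs
  imports
    "HOL-Complex_Analysis.Complex_Analysis"
    "HOL-Library.Poly_Mapping"
    "HOL-Library.Extended_Nat"
    "Jordan_Normal_Form.Determinant"
    "Jordan_Normal_Form.Gauss_Jordan_Elimination"
begin

text \<open>
  The genus varies inside the statements below, so matrices are the dimension-carrying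
  matrices of \<^theory>\<open>Jordan_Normal_Form.Matrix\<close>, not those of HOL-Analysis.
\<close>

hide_const (open) Determinants.det Finite_Cartesian_Product.mat Finite_Cartesian_Product.vec

section \<open>Transcendence degree over the rationals\<close>

definition is_subfield :: "complex set \<Rightarrow> bool" where
  "is_subfield K \<longleftrightarrow> 0 \<in> K \<and> 1 \<in> K \<and>
     (\<forall>x\<in>K. \<forall>y\<in>K. x - y \<in> K \<and> x * y \<in> K) \<and> (\<forall>x\<in>K. x \<noteq> 0 \<longrightarrow> inverse x \<in> K)"

definition rat_adjoin :: "complex set \<Rightarrow> complex set" where
  "rat_adjoin B = is_subfield hull B"

text \<open>
  A polynomial over the rationals with one indeterminate for every complex number;
  \<open>eval_self\<close> substitutes for each indeterminate the number that indexes it.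
\<close>

definition eval_self :: "((complex \<Rightarrow>\<^sub>0 nat) \<Rightarrow>\<^sub>0 rat) \<Rightarrow> complex" where
  "eval_self p = (\<Sum>m\<in>Poly_Mapping.keys p. of_rat (Poly_Mapping.lookup p m) *
     (\<Prod>x\<in>Poly_Mapping.keys m. x ^ Poly_Mapping.lookup m x))"

definition alg_independent :: "complex set \<Rightarrow> bool" where
  "alg_independent S \<longleftrightarrow>
     (\<forall>p. (\<forall>m\<in>Poly_Mapping.keys p. Poly_Mapping.keys m \<subseteq> S) \<longrightarrow> eval_self p = 0 \<longrightarrow> p = 0)"

definition trdeg :: "complex set \<Rightarrow> enat" where
  "trdeg B = (SUP S \<in> {S. S \<subseteq> rat_adjoin B \<and> alg_independent S}.
     if finite S then enat (card S) else \<infinity>)"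

section \<open>The Siegel upper half space and the symplectic group\<close>

definition mat_tr :: "'a::comm_monoid_add mat \<Rightarrow> 'a" where
  "mat_tr A = (\<Sum>i<dim_row A. A $$ (i, i))"

definition entry_norm :: "complex mat \<Rightarrow> real" where
  "entry_norm A = (\<Sum>i<dim_row A. \<Sum>j<dim_col A. cmod (A $$ (i, j)))"

definition pos_def_mat :: "nat \<Rightarrow> real mat \<Rightarrow> bool" where
  "pos_def_mat g A \<longleftrightarrow> A \<in> carrier_mat g g \<and> transpose_mat A = A \<and>
     (\<forall>x\<in>carrier_vec g. x \<noteq> 0\<^sub>v g \<longrightarrow> 0 < scalar_prod x (A *\<^sub>v x))"

definition siegel_space :: "nat \<Rightarrow> complex mat set" where
  "siegel_space g =
     {Z \<in> carrier_mat g g. transpose_mat Z = Z \<and> pos_def_mat g (map_mat Im Z)}"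

definition symp_form :: "nat \<Rightarrow> int mat" where
  "symp_form g = four_block_mat (0\<^sub>m g g) (1\<^sub>m g) (- 1\<^sub>m g) (0\<^sub>m g g)"

definition Sp :: "nat \<Rightarrow> int mat set" where
  "Sp g = {M \<in> carrier_mat (2 * g) (2 * g).
     transpose_mat M * symp_form g * M = symp_form g}"

definition GSp_pos :: "nat \<Rightarrow> int mat set" where
  "GSp_pos g = {M \<in> carrier_mat (2 * g) (2 * g).
     \<exists>n>0. transpose_mat M * symp_form g * M = n \<cdot>\<^sub>m symp_form g}"

definition moebius_denom :: "nat \<Rightarrow> int mat \<Rightarrow> complex mat \<Rightarrow> complex mat" where
  "moebius_denom g M Z =
     (case split_block M g g of (A, B, C, D) \<Rightarrow> map_mat of_int C * Z + map_mat of_int D)"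

definition moebius :: "nat \<Rightarrow> int mat \<Rightarrow> complex mat \<Rightarrow> complex mat" where
  "moebius g M Z =
     (case split_block M g g of (A, B, C, D) \<Rightarrow>
        (map_mat of_int A * Z + map_mat of_int B) * the (mat_inverse (moebius_denom g M Z)))"

section \<open>Siegel cusp forms\<close>

text \<open>
  Complex Frechet differentiability on the open subset \<open>siegel_space g\<close> of the space of
  symmetric matrices: every complex-linear functional on symmetric matrices has the form
  \<open>W \<mapsto> tr (L W)\<close>.
\<close>

definition siegel_holomorphic :: "nat \<Rightarrow> (complex mat \<Rightarrow> complex) \<Rightarrow> bool" where
  "siegel_holomorphic g f \<longleftrightarrow>
     (\<forall>Z\<in>siegel_space g. \<exists>L\<in>carrier_mat g g. \<forall>\<epsilon>>0. \<exists>\<delta>>0. \<forall>Z'\<in>siegel_space g.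
        entry_norm (Z' - Z) < \<delta> \<longrightarrow>
        cmod (f Z' - f Z - mat_tr (L * (Z' - Z))) \<le> \<epsilon> * entry_norm (Z' - Z))"

definition half_integral_pos :: "nat \<Rightarrow> real mat set" where
  "half_integral_pos g = {T. pos_def_mat g T \<and>
     (\<forall>i<g. T $$ (i, i) \<in> \<int>) \<and> (\<forall>i<g. \<forall>j<g. 2 * T $$ (i, j) \<in> \<int>)}"

definition has_fourier_coeffs ::
  "nat \<Rightarrow> (complex mat \<Rightarrow> complex) \<Rightarrow> (real mat \<Rightarrow> complex) \<Rightarrow> bool" where
  "has_fourier_coeffs g f a \<longleftrightarrow> (\<forall>T. T \<notin> half_integral_pos g \<longrightarrow> a T = 0) \<and>
     (\<forall>Z\<in>siegel_space g.
        ((\<lambda>T. a T * exp (2 * of_real pi * \<i> * mat_tr (map_mat of_real T * Z))) has_sum f Z)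
          (half_integral_pos g))"

text \<open>
  Cuspidality at full level: only positive definite matrices occur in the Fourier expansion.
  In genus 1 this also contains holomorphy at the cusp.
\<close>

definition siegel_cusp_form :: "nat \<Rightarrow> int \<Rightarrow> (complex mat \<Rightarrow> complex) \<Rightarrow> bool" where
  "siegel_cusp_form g k f \<longleftrightarrow> siegel_holomorphic g f \<and>
     (\<forall>M\<in>Sp g. \<forall>Z\<in>siegel_space g.
        f (moebius g M Z) = det (moebius_denom g M Z) powi k * f Z) \<and>
     (\<exists>a. has_fourier_coeffs g f a)"

definition fourier_coeff :: "nat \<Rightarrow> (complex mat \<Rightarrow> complex) \<Rightarrow> real mat \<Rightarrow> complex" where
  "fourier_coeff g f = (THE a. has_fourier_coeffs g f a)"

section \<open>Hecke operators\<close>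

text \<open>The exponent \<open>k div 2\<close> is exact: the weight is always even.\<close>

definition slash ::
  "nat \<Rightarrow> int \<Rightarrow> int mat \<Rightarrow> (complex mat \<Rightarrow> complex) \<Rightarrow> complex mat \<Rightarrow> complex" where
  "slash g k M f Z =
     of_int (det M) powi (k div 2) * det (moebius_denom g M Z) powi (- k) * f (moebius g M Z)"

definition double_coset :: "nat \<Rightarrow> int mat \<Rightarrow> int mat set" where
  "double_coset g M = {P * M * Q | P Q. P \<in> Sp g \<and> Q \<in> Sp g}"

definition right_cosets :: "nat \<Rightarrow> int mat \<Rightarrow> int mat set set" where
  "right_cosets g M = (\<lambda>N. {P * N | P. P \<in> Sp g}) ` double_coset g M"

text \<open>
  The number of cosets is finite, and on \<open>siegel_space g\<close> the summand does not depend on the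
  chosen representative when \<open>f\<close> is modular of weight \<open>k\<close>.
\<close>

definition hecke_op ::
  "nat \<Rightarrow> int \<Rightarrow> int mat \<Rightarrow> (complex mat \<Rightarrow> complex) \<Rightarrow> complex mat \<Rightarrow> complex" where
  "hecke_op g k M f Z = (\<Sum>c\<in>right_cosets g M. slash g k (SOME N. N \<in> c) f Z)"

definition hecke_eigen_cusp_form :: "nat \<Rightarrow> int \<Rightarrow> (complex mat \<Rightarrow> complex) \<Rightarrow> bool" where
  "hecke_eigen_cusp_form g k f \<longleftrightarrow> siegel_cusp_form g k f \<and>
     (\<exists>Z\<in>siegel_space g. f Z \<noteq> 0) \<and>
     (\<forall>M\<in>GSp_pos g. \<exists>c. \<forall>Z\<in>siegel_space g. hecke_op g k M f Z = c * f Z)"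

section \<open>The Koecher-Maass series\<close>

definition GL_int :: "nat \<Rightarrow> int mat set" where
  "GL_int g = {U \<in> carrier_mat g g. invertible_mat U}"

definition gl_act :: "int mat \<Rightarrow> real mat \<Rightarrow> real mat" where
  "gl_act U T = transpose_mat (map_mat of_int U) * T * map_mat of_int U"

definition gl_orbits :: "nat \<Rightarrow> real mat set set" where
  "gl_orbits g =
     half_integral_pos g // {(T, T'). T \<in> half_integral_pos g \<and> (\<exists>U\<in>GL_int g. T' = gl_act U T)}"

definition aut_number :: "nat \<Rightarrow> real mat \<Rightarrow> nat" where
  "aut_number g T = card {U \<in> GL_int g. gl_act U T = T}"

definition koecher_maass_term ::
  "nat \<Rightarrow> (complex mat \<Rightarrow> complex) \<Rightarrow> complex \<Rightarrow> real mat \<Rightarrow> complex" where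
  "koecher_maass_term g f s T =
     fourier_coeff g f T / of_nat (aut_number g T) * of_real (det T) powr (- s)"

text \<open>
  The series itself only converges on a right half-plane.  Since the completed series is entire
  and the reciprocal Gamma function is entire, the continuation of the series is entire as
  well; by the identity theorem it is unique.  For even weight the terms are constant on orbits.
\<close>

definition koecher_maass :: "nat \<Rightarrow> (complex mat \<Rightarrow> complex) \<Rightarrow> complex \<Rightarrow> complex" where
  "koecher_maass g f = (THE D. D holomorphic_on UNIV \<and>
     (\<exists>\<sigma>. \<forall>s. Re s > \<sigma> \<longrightarrow>
        ((\<lambda>c. koecher_maass_term g f s (SOME T. T \<in> c)) has_sum D s) (gl_orbits g)))"

definition E_set :: "nat \<Rightarrow> int \<Rightarrow> complex \<Rightarrow> (complex mat \<Rightarrow> complex) set" where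
  "E_set g k s0 = {f. hecke_eigen_cusp_form g k f \<and> koecher_maass g f s0 \<noteq> 0}"

definition L_set :: "nat \<Rightarrow> complex set" where
  "L_set M = {(deriv ^^ m) (koecher_maass g f) (of_int k / 2) / koecher_maass g f (of_int k / 2)
     | g k f m. 1 \<le> g \<and> even k \<and> k > 2 * (int g + 1) \<and> f \<in> E_set g k (of_int k / 2)
         \<and> 1 \<le> m \<and> m \<le> M}"

end

(* One form suffices: genus 1, weight 12 and the discriminant form. Its completed Koecher-Maass
   series is a bilateral Laplace transform of an even positive function centred at s = 6, so the
   logarithmic derivative of the transform is odd about 6. Hence the derivatives of even order
   2m >= 2 of D'/D at 6 are those of -psi, and psi^(2m)(6) differs from psi^(2m)(1) by a rational;
   by the Leibniz rule they lie in the field generated by the quotients D^(j)(6)/D(6).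

   The discriminant is E_4^3 - E_6^2, positive on the imaginary axis since E_4 > 1 and
   0 <= E_6 < 1 there for Im z >= 1 (E_6(i) = 0 and E_6 increases). It is a Hecke eigenform because
   a maximum principle for the Petersson norm shows that the space of weight 12 is a line. *)

theory Submission
  imports Defs
begin

section \<open>Eisenstein series and the discriminant\<close>

text \<open>The quotients to be studied live at the centre 6, outside the half-plane
  \<open>Re s > 7\<close> in which the Dirichlet series is summed. So the nonvanishing at the centre
  is not read off from Fourier coefficients; it comes from values on the whole imaginary axis, and
  these must be positive. The inversion \<open>z \<mapsto> - 1 / z\<close> supplies the evenness
  that removes the unknown moments of the kernel from the derivatives of even order of
  \<open>D'/D\<close>; the odd orders still contain them. Order 0 is excluded because log(2 pi)
  appears there. Order n of \<open>D'/D\<close> involves derivatives of \<open>D\<close> up to order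
  n + 1, whence \<open>2 * m \<le> M - 1\<close>.

  Eisenstein series enter as lattice sums, which make modularity immediate, while positivity is
  visible only in the expansion in q. The bridge between the two is the reflection formula of the
  polygamma functions. The eigenform condition ranges over all integral similitudes;
  one-dimensionality settles every operator at once, without computing any eigenvalue.\<close>

definition qexp :: "complex \<Rightarrow> complex" where
  "qexp z = exp (2 * of_real pi * \<i> * z)"

lemma qexp_nonzero [simp]: "qexp z \<noteq> 0"
  by (simp add: qexp_def)

lemma norm_qexp: "norm (qexp z) = exp (- 2 * pi * Im z)"
  by (simp add: qexp_def)

lemma norm_qexp_less_1: "Im z > 0 \<Longrightarrow> norm (qexp z) < 1"
  by (simp add: norm_qexp)

lemma qexp_of_nat_mult: "qexp (of_nat n * z) = qexp z ^ n"
  by (simp add: qexp_def exp_of_nat_mult [symmetric] algebra_simps)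

lemma DERIV_qexp: "(qexp has_field_derivative 2 * of_real pi * \<i> * qexp z) (at z)"
  unfolding qexp_def[abs_def] by (auto intro!: derivative_eq_intros)

lemma holomorphic_on_qexp [holomorphic_intros]:
  "f holomorphic_on A \<Longrightarrow> (\<lambda>z. qexp (f z)) holomorphic_on A"
  unfolding qexp_def by (intro holomorphic_intros)

text \<open>The polylogarithm of order \<open>- k\<close>, except that the series for \<open>k = 0\<close> includes the constant term 1.\<close>

definition power_series_pow :: "nat \<Rightarrow> 'a::{real_normed_field,banach} \<Rightarrow> 'a" where
  "power_series_pow k q = suminf (\<lambda>n. of_nat n ^ k * q ^ n)"

lemma summable_power_series_pow:
  fixes q :: "'a::{real_normed_field,banach}"
  assumes "norm q < 1"
  shows "summable (\<lambda>n. of_nat n ^ k * q ^ n)"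
  using assms
proof (induction k arbitrary: q)
  case 0
  then show ?case by (simp add: summable_geometric)
next
  case (Suc k)
  have "summable (\<lambda>n. diffs (\<lambda>n. of_nat n ^ k) n * q ^ n)"
    using Suc by (intro termdiff_converges[where K = 1]) auto
  then have "summable (\<lambda>n. q * (diffs (\<lambda>n. of_nat n ^ k) n * q ^ n))"
    by (rule summable_mult)
  then have "summable (\<lambda>n. of_nat (Suc n) ^ Suc k * q ^ Suc n)"
    by (simp add: diffs_def mult_ac)
  then show ?case by (subst (asm) summable_Suc_iff)
qed

text \<open>The Euler operator q d/dq multiplies the n-th coefficient by n. Fixing only
  \<open>q * D\<close> avoids a division at \<open>q = 0\<close>.\<close>

lemma DERIV_power_series_pow:
  fixes q :: complex
  assumes "norm q < 1"
  obtains D where "(power_series_pow k has_field_derivative D) (at q)"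
    "q * D = power_series_pow (Suc k) q"
proof
  have sm: "summable (\<lambda>n. diffs (\<lambda>n. of_nat n ^ k) n * q ^ n)"
    using assms by (intro termdiff_converges[where K = 1] summable_power_series_pow) auto
  show "(power_series_pow k has_field_derivative suminf (\<lambda>n. diffs (\<lambda>n. of_nat n ^ k) n * q ^ n)) (at q)"
    unfolding power_series_pow_def[abs_def] using assms
    by (intro termdiffs_strong'[where K = 1] summable_power_series_pow) auto
  have "q * suminf (\<lambda>n. diffs (\<lambda>n. of_nat n ^ k) n * q ^ n)
      = suminf (\<lambda>n. q * (diffs (\<lambda>n. of_nat n ^ k) n * q ^ n))"
    by (rule suminf_mult[OF sm, symmetric])
  also have "\<dots> = suminf (\<lambda>n. of_nat (Suc n) ^ Suc k * q ^ Suc n)"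
    by (simp add: diffs_def mult_ac)
  also have "\<dots> = power_series_pow (Suc k) q"
    using suminf_split_head[OF summable_power_series_pow[OF assms, of "Suc k"]]
    by (simp add: power_series_pow_def)
  finally show "q * suminf (\<lambda>n. diffs (\<lambda>n. of_nat n ^ k) n * q ^ n) = power_series_pow (Suc k) q" .
qed

lemma DERIV_power_series_pow_qexp:
  assumes "Im z > 0"
  shows "((\<lambda>z. power_series_pow k (qexp z)) has_field_derivative
    2 * of_real pi * \<i> * power_series_pow (Suc k) (qexp z)) (at z)"
proof -
  obtain D where D: "(power_series_pow k has_field_derivative D) (at (qexp z))"
    "qexp z * D = power_series_pow (Suc k) (qexp z)"
    using DERIV_power_series_pow norm_qexp_less_1[OF assms] by metis
  from DERIV_chain2[OF D(1) DERIV_qexp]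
  show ?thesis by (simp add: D(2)[symmetric] mult_ac)
qed

section \<open>Reflection formulas for the polygamma functions\<close>

lemma Digamma_reflection:
  assumes "Im z > 0"
  shows "Digamma (1 - z) - Digamma z
    = - (of_real pi * \<i>) * (2 * power_series_pow 0 (qexp z) - 1)"
proof -
  have nz: "z \<notin> \<int>\<^sub>\<le>\<^sub>0" "1 - z \<notin> \<int>\<^sub>\<le>\<^sub>0"
    using assms by (auto elim!: nonpos_Ints_cases simp: complex_eq_iff)
  let ?s = "sin (of_real pi * z)" and ?c = "cos (of_real pi * z)"
  have R: "Gamma w * Gamma (1 - w) * sin (of_real pi * w) = of_real pi" if "Im w > 0" for w :: complex
  proof -
    have "w \<notin> \<int>" using that by (auto elim!: Ints_cases)
    then have "sin (of_real pi * w) \<noteq> 0"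
      by (auto simp: sin_eq_0 mult.commute)
    with Gamma_reflection_complex[of w] show ?thesis by simp
  qed
  have s0: "?s \<noteq> 0" using R[OF assms] by auto
  \<comment> \<open>The product is the constant pi on the upper half-plane. Its derivative, computed
    by the product rule, therefore vanishes, which is psi(1 - z) - psi(z) = pi cot(pi z) cleared of
    denominators.\<close>
  have "((\<lambda>w. Gamma w * Gamma (1 - w) * sin (of_real pi * w)) has_field_derivative
     Gamma z * Gamma (1 - z) * (?s * (Digamma z - Digamma (1 - z)) + of_real pi * ?c)) (at z)"
    using nz by (auto intro!: derivative_eq_intros simp: algebra_simps)
  moreover have "((\<lambda>w. Gamma w * Gamma (1 - w) * sin (of_real pi * w)) has_field_derivative 0) (at z)"
    by (rule has_field_derivative_transform_within_open[where S = "{w. Im w > 0}" and f = "\<lambda>_. of_real pi"])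
       (use R assms in \<open>auto intro: open_halfspace_Im_gt\<close>)
  ultimately have "?s * (Digamma z - Digamma (1 - z)) + of_real pi * ?c = 0"
    using DERIV_unique R[OF assms] by fastforce
  then have eq: "?s * (Digamma (1 - z) - Digamma z) = of_real pi * ?c"
    by (simp add: algebra_simps)
  \<comment> \<open>With q = E^2 the cotangent is -i (2 / (1 - q) - 1), and 1 / (1 - q) is the
    geometric series \<open>power_series_pow 0\<close>.\<close>
  define E where "E = exp (\<i> * (of_real pi * z))"
  have E0: "E \<noteq> 0" by (simp add: E_def)
  have s: "?s = (E - inverse E) / (2 * \<i>)" and c: "?c = (E + inverse E) / 2"
    by (simp_all add: sin_exp_eq cos_exp_eq E_def exp_minus)
  have q: "qexp z = E ^ 2"
    by (simp add: qexp_def E_def exp_double[symmetric] mult_ac)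
  have n1: "E ^ 2 \<noteq> 1" using norm_qexp_less_1[OF assms] by (auto simp: q)
  have L: "power_series_pow 0 (qexp z) = 1 / (1 - E ^ 2)"
    using suminf_geometric[of "qexp z"] norm_qexp_less_1[OF assms]
    by (simp add: power_series_pow_def q)
  have "(1 - E ^ 2) \<noteq> 0" using n1 by simp
  with E0 have "?s * (- (of_real pi * \<i>) * (2 * power_series_pow 0 (qexp z) - 1)) = of_real pi * ?c"
    unfolding s c L by (simp add: divide_simps) (simp add: algebra_simps power2_eq_square)
  then have "?s * (- (of_real pi * \<i>) * (2 * power_series_pow 0 (qexp z) - 1))
     = ?s * (Digamma (1 - z) - Digamma z)" using eq by simp
  then show ?thesis using s0 by (metis mult_cancel_left)
qed

text \<open>Differentiation in z acts on functions of q as 2 pi i times q d/dq, which raises the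
  order of the power series by one. The constant 1 survives only for \<open>n = 0\<close>.\<close>

lemma Polygamma_reflection:
  assumes "Im z > 0"
  shows "(-1) ^ n * Polygamma n (1 - z) - Polygamma n z
    = - (of_real pi * \<i>) * (2 * of_real pi * \<i>) ^ n *
        (2 * power_series_pow n (qexp z) - (if n = 0 then 1 else 0))"
  using assms
proof (induction n arbitrary: z)
  case 0
  then show ?case using Digamma_reflection by simp
next
  case (Suc n)
  have nz: "z \<notin> \<int>\<^sub>\<le>\<^sub>0" "1 - z \<notin> \<int>\<^sub>\<le>\<^sub>0"
    using Suc.prems by (auto elim!: nonpos_Ints_cases simp: complex_eq_iff)
  have "((\<lambda>z. (-1) ^ n * Polygamma n (1 - z) - Polygamma n z) has_field_derivative
     (-1) ^ Suc n * Polygamma (Suc n) (1 - z) - Polygamma (Suc n) z) (at z)"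
    using nz by (auto intro!: derivative_eq_intros)
  moreover have "((\<lambda>z. - (of_real pi * \<i>) * (2 * of_real pi * \<i>) ^ n *
      (2 * power_series_pow n (qexp z) - (if n = 0 then 1 else 0))) has_field_derivative
      - (of_real pi * \<i>) * (2 * of_real pi * \<i>) ^ n *
      (2 * (2 * of_real pi * \<i> * power_series_pow (Suc n) (qexp z)))) (at z)"
    by (auto intro!: derivative_eq_intros DERIV_power_series_pow_qexp Suc.prems)
  then have "((\<lambda>z. (-1) ^ n * Polygamma n (1 - z) - Polygamma n z) has_field_derivative
      - (of_real pi * \<i>) * (2 * of_real pi * \<i>) ^ n *
      (2 * (2 * of_real pi * \<i> * power_series_pow (Suc n) (qexp z)))) (at z)"
    by (rule has_field_derivative_transform_within_open[where S = "{w. Im w > 0}"])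
       (use Suc in \<open>auto intro: open_halfspace_Im_gt\<close>)
  ultimately show ?case using DERIV_unique by fastforce
qed

section \<open>Sums over the integers and over lattices\<close>

lemma has_sum_int_split:
  fixes f :: "int \<Rightarrow> 'a::topological_comm_monoid_add"
  assumes "((\<lambda>n. f (int n)) has_sum a) UNIV" "((\<lambda>n. f (- 1 - int n)) has_sum b) UNIV"
  shows "(f has_sum (a + b)) UNIV"
proof -
  have "(f has_sum a) (range int)"
    using assms(1) by (subst has_sum_reindex) (auto simp: o_def inj_on_def)
  moreover have "(f has_sum b) (range (\<lambda>n. - 1 - int n))"
    using assms(2) by (subst has_sum_reindex) (auto simp: o_def inj_on_def)
  moreover have "range int \<inter> range (\<lambda>n. - 1 - int n) = {}"
    by auto
  moreover have "range int \<union> range (\<lambda>n. - 1 - int n) = UNIV"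
  proof -
    have "x \<in> range int \<union> range (\<lambda>n. - 1 - int n)" for x
    proof (cases "x \<ge> 0")
      case True
      then show ?thesis by (auto intro: rev_image_eqI[of "nat x"])
    next
      case False
      then show ?thesis by (auto intro: rev_image_eqI[of "nat (- 1 - x)"])
    qed
    then show ?thesis by blast
  qed
  ultimately show ?thesis
    using has_sum_Un_disjoint by metis
qed

lemma summable_on_int_split:
  fixes f :: "int \<Rightarrow> 'a::{complete_uniform_space, uniform_topological_group_add, ab_group_add, topological_comm_monoid_add}"
  assumes "f summable_on UNIV"
  shows "(\<lambda>n. f (int n)) summable_on UNIV" "(\<lambda>n. f (- 1 - int n)) summable_on UNIV"
proof -
  have "f summable_on range int" "f summable_on range (\<lambda>n. - 1 - int n)"
    using summable_on_subset[OF assms] by blast+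
  then show "(\<lambda>n. f (int n)) summable_on UNIV" "(\<lambda>n. f (- 1 - int n)) summable_on UNIV"
    using summable_on_reindex[of int UNIV f] summable_on_reindex[of "\<lambda>n. - 1 - int n" UNIV f]
    by (simp_all add: o_def inj_on_def)
qed

lemma summable_on_int_inverse_square:
  "(\<lambda>n::int. 1 / (1 + \<bar>real_of_int n\<bar>) ^ 2) summable_on UNIV"
proof -
  have s: "(\<lambda>n::nat. 1 / real (Suc n) ^ 2) summable_on UNIV"
    by (rule norm_summable_imp_summable_on)
       (use inverse_power_summable[of 2, where 'a = real] in
         \<open>simp add: summable_Suc_iff[of "\<lambda>n. 1 / (real n ^ 2)"] inverse_eq_divide del: of_nat_Suc\<close>)
  have "(\<lambda>n::nat. 1 / (2 + real n) ^ 2) summable_on UNIV"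
    by (rule summable_on_comparison_test[OF s]) (auto intro!: divide_left_mono power_mono)
  then obtain b where "((\<lambda>n. 1 / (1 + \<bar>real_of_int (- 1 - int n)\<bar>) ^ 2) has_sum b) UNIV"
    by (auto simp: summable_on_def)
  moreover from s obtain a where "((\<lambda>n. 1 / (1 + \<bar>real_of_int (int n)\<bar>) ^ 2) has_sum a) UNIV"
    by (auto simp: summable_on_def)
  ultimately show ?thesis
    using has_sum_int_split[of "\<lambda>n::int. 1 / (1 + \<bar>real_of_int n\<bar>) ^ 2"] by (blast intro: has_sum_imp_summable)
qed

text \<open>The imaginary part of w = mz + n gives |m| y \<le> |w|. Inserting this into |n| \<le>
  |w| + |m| |z| gives |n| y \<le> |w| (y + |z|). The smaller of the two resulting constants is
  \<delta>.\<close>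

lemma lattice_norm_ge:
  assumes "Im z > 0"
  obtains \<delta> where "\<delta> > 0" "\<And>m n :: int. norm (of_int m * z + of_int n) \<ge> \<delta> * max \<bar>of_int m\<bar> \<bar>of_int n\<bar>"
proof -
  let ?y = "Im z"
  have bd: "norm (of_int m * z + of_int n) \<ge> min ?y (?y / (?y + norm z)) * max \<bar>of_int m\<bar> \<bar>of_int n\<bar>" for m n :: int
  proof -
    let ?w = "of_int m * z + of_int n"
    have m: "\<bar>of_int m\<bar> * ?y \<le> norm ?w"
      using abs_Im_le_cmod[of ?w] assms by (simp add: abs_mult)
    have "\<bar>of_int n\<bar> = norm (?w - of_int m * z)" by simp
    also have "\<dots> \<le> norm ?w + \<bar>of_int m\<bar> * norm z"
      by (rule order_trans[OF norm_triangle_ineq4]) (simp add: norm_mult)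
    finally have "?y * \<bar>of_int n\<bar> \<le> ?y * norm ?w + (\<bar>of_int m\<bar> * ?y) * norm z"
      using assms by (simp add: distrib_left[symmetric] mult_ac)
    also have "\<dots> \<le> ?y * norm ?w + norm ?w * norm z"
      using m by (intro add_left_mono mult_right_mono) auto
    finally have n: "?y / (?y + norm z) * \<bar>of_int n\<bar> \<le> norm ?w"
      using assms by (simp add: divide_simps add_pos_nonneg algebra_simps)
    have "min ?y (?y / (?y + norm z)) * \<bar>of_int m\<bar> \<le> ?y * \<bar>of_int m\<bar>"
      by (intro mult_right_mono) auto
    moreover have "min ?y (?y / (?y + norm z)) * \<bar>of_int n\<bar> \<le> ?y / (?y + norm z) * \<bar>of_int n\<bar>"
      by (intro mult_right_mono) auto
    ultimately show ?thesis using m n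
      by (auto simp: max_def mult.commute)
  qed
  have "min ?y (?y / (?y + norm z)) > 0"
    using assms by (auto intro!: divide_pos_pos add_pos_nonneg)
  with bd that show thesis by blast
qed

text \<open>Away from the origin M = max(|m|, |n|) is at least 1, so 1 + |m| and 1 + |n| are at most
  2M and (1 + |m|)^2 (1 + |n|)^2 \<le> 16 M^4. For k \<ge> 4 the lattice sum is thus dominated by a
  product of two convergent series.\<close>

lemma eisenstein_summable:
  assumes "Im z > 0" "k \<ge> 4"
  shows "(\<lambda>(m, n). inverse ((of_int m * z + of_int n) ^ k)) summable_on (UNIV :: (int \<times> int) set)"
proof -
  obtain \<delta> where \<delta>: "\<delta> > 0"
    "\<And>m n :: int. norm (of_int m * z + of_int n) \<ge> \<delta> * max \<bar>of_int m\<bar> \<bar>of_int n\<bar>"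
    using lattice_norm_ge[OF assms(1)] by blast
  let ?s = "\<lambda>n::int. 1 / (1 + \<bar>real_of_int n\<bar>) ^ 2"
  have prod: "(\<lambda>(m, n). s m * s n) summable_on (UNIV \<times> UNIV :: (int \<times> int) set)"
    if "s summable_on UNIV" "\<And>n. s n \<ge> 0" for s :: "int \<Rightarrow> real"
    by (rule summable_on_SigmaI[where g = "\<lambda>m. s m * infsum s UNIV"])
       (use that in \<open>auto intro!: has_sum_cmult_right has_sum_infsum summable_on_cmult_left\<close>)
  have "(\<lambda>(m, n). ?s m * ?s n) summable_on (UNIV \<times> UNIV :: (int \<times> int) set)"
    by (rule prod[OF summable_on_int_inverse_square]) simp
  then have S: "(\<lambda>p. case p of (m, n) \<Rightarrow> 16 / \<delta> ^ k * (?s m * ?s n)) summable_on (UNIV :: (int \<times> int) set)"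
    using summable_on_cmult_right[of "\<lambda>(m, n). ?s m * ?s n" UNIV "16 / \<delta> ^ k"]
    by (simp add: case_prod_unfold)
  have le: "norm (inverse ((of_int m * z + of_int n) ^ k)) \<le> 16 / \<delta> ^ k * (?s m * ?s n)" for m n :: int
  proof (cases "m = 0 \<and> n = 0")
    case True
    then show ?thesis using assms \<delta>(1) by (simp add: power_0_left)
  next
    case False
    let ?x = "norm (of_int m * z + of_int n)"
    define M where "M = max \<bar>real_of_int m\<bar> \<bar>real_of_int n\<bar>"
    have M1: "M \<ge> 1" using False unfolding M_def by (cases "m = 0") auto
    have x: "?x \<ge> \<delta> * M" using \<delta>(2) unfolding M_def .
    have "(1 + \<bar>real_of_int m\<bar>) \<le> 2 * M" "(1 + \<bar>real_of_int n\<bar>) \<le> 2 * M"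
      using M1 by (auto simp: M_def)
    then have "(1 + \<bar>real_of_int m\<bar>) ^ 2 * (1 + \<bar>real_of_int n\<bar>) ^ 2 \<le> (2 * M) ^ 2 * (2 * M) ^ 2"
      by (intro mult_mono power_mono) auto
    also have "\<dots> = 16 * M ^ 4" by (simp add: power_mult_distrib)
    also have "\<dots> \<le> 16 * M ^ k" using M1 assms by (intro mult_left_mono power_increasing) auto
    finally have "\<delta> ^ k * ((1 + \<bar>real_of_int m\<bar>) ^ 2 * (1 + \<bar>real_of_int n\<bar>) ^ 2) \<le> \<delta> ^ k * (16 * M ^ k)"
      using \<delta>(1) by (intro mult_left_mono) auto
    also have "\<dots> = 16 * (\<delta> * M) ^ k" by (simp add: power_mult_distrib)
    also have "\<dots> \<le> 16 * ?x ^ k" using x \<delta>(1) M1 by (intro mult_left_mono power_mono) auto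
    finally have "\<delta> ^ k * ((1 + \<bar>real_of_int m\<bar>) ^ 2 * (1 + \<bar>real_of_int n\<bar>) ^ 2) \<le> 16 * ?x ^ k" .
    moreover have "?x > 0" using x \<delta>(1) M1 by (smt (verit) mult_pos_pos)
    ultimately have "1 / ?x ^ k \<le> 16 / \<delta> ^ k * (?s m * ?s n)" using \<delta>(1)
      by (simp add: divide_simps mult_ac)
    then show ?thesis
      by (simp add: norm_inverse norm_power norm_divide inverse_eq_divide)
  qed
  have "(\<lambda>p. norm (case p of (m, n) \<Rightarrow> inverse ((of_int m * z + of_int n) ^ k))) summable_on (UNIV :: (int \<times> int) set)"
    by (rule summable_on_comparison_test[OF S]) (use le in auto)
  then show ?thesis by (rule abs_summable_summable)
qed

text \<open>The unnormalised series G_k over all pairs; for k > 0 the origin contributes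
  \<open>inverse 0 = 0\<close>.\<close>

definition eisenstein :: "nat \<Rightarrow> complex \<Rightarrow> complex" where
  "eisenstein k z = infsum (\<lambda>(m, n). inverse ((of_int m * z + of_int n) ^ k)) (UNIV :: (int \<times> int) set)"

lemma mobius_denom_nonzero:
  fixes a b c d :: int
  assumes "Im z > 0" "a * d - b * c \<noteq> 0"
  shows "of_int c * z + of_int d \<noteq> 0"
proof
  assume *: "of_int c * z + of_int d = 0"
  then have "of_int c * Im z = 0" by (auto simp: complex_eq_iff)
  with assms have "c = 0" by simp
  with * assms show False by simp
qed

text \<open>Right multiplication by the matrix permutes the row vectors (m, n), and every term
  acquires the factor (cz + d)^k.\<close>

lemma eisenstein_modular:
  fixes a b c d :: int
  assumes "Im z > 0" "a * d - b * c = 1"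
  shows "eisenstein k ((of_int a * z + of_int b) / (of_int c * z + of_int d))
    = (of_int c * z + of_int d) ^ k * eisenstein k z"
proof -
  let ?j = "of_int c * z + of_int d"
  have j: "?j \<noteq> 0" using mobius_denom_nonzero[of z a d b c] assms by simp
  define h where "h = (\<lambda>(m::int, n::int). (m * a + n * c, m * b + n * d))"
  have bij: "bij_betw h UNIV UNIV"
  \<comment> \<open>The witness is right multiplication by the inverse matrix, with rows (d, -b) and
    (-c, a).\<close>
  proof (rule bij_betw_byWitness[where f' = "\<lambda>(m, n). (m * d - n * c, n * a - m * b)"])
    have ad: "a * d = 1 + b * c" using assms by simp
    have ad': "a * (d * x) = x + b * (c * x)" for x
      by (metis ad distrib_right mult.assoc mult_1)
    have 1: "(m * a + n * c) * d - (m * b + n * d) * c = m"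
      "(m * b + n * d) * a - (m * a + n * c) * b = n"
      "(m * d - n * c) * a + (n * a - m * b) * c = m"
      "(m * d - n * c) * b + (n * a - m * b) * d = n" for m n :: int
      by (simp_all add: ad' algebra_simps)
    show "\<forall>p\<in>UNIV. (case h p of (m, n) \<Rightarrow> (m * d - n * c, n * a - m * b)) = p"
      unfolding h_def by (simp add: 1)
    show "\<forall>p\<in>UNIV. h (case p of (m, n) \<Rightarrow> (m * d - n * c, n * a - m * b)) = p"
      unfolding h_def by (simp add: 1)
  qed auto
  have term_eq: "inverse ((of_int m * ((of_int a * z + of_int b) / ?j) + of_int n) ^ k)
      = ?j ^ k * inverse ((of_int (m * a + n * c) * z + of_int (m * b + n * d)) ^ k)" for m n :: int
  proof -
    have "of_int m * ((of_int a * z + of_int b) / ?j) + of_int n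
        = (of_int (m * a + n * c) * z + of_int (m * b + n * d)) / ?j"
      using j by (simp add: divide_simps) (simp add: algebra_simps)
    then show ?thesis by (simp only: power_divide inverse_divide) (simp only: divide_inverse)
  qed
  have "eisenstein k ((of_int a * z + of_int b) / ?j)
      = infsum (\<lambda>p. ?j ^ k * (case h p of (m, n) \<Rightarrow> inverse ((of_int m * z + of_int n) ^ k))) UNIV"
    unfolding eisenstein_def by (rule infsum_cong) (simp only: case_prod_unfold h_def term_eq fst_conv snd_conv)
  also have "\<dots> = ?j ^ k * infsum (\<lambda>p. case h p of (m, n) \<Rightarrow> inverse ((of_int m * z + of_int n) ^ k)) UNIV"
    by (rule infsum_cmult_right')
  also have "infsum (\<lambda>p. case h p of (m, n) \<Rightarrow> inverse ((of_int m * z + of_int n) ^ k)) UNIV = eisenstein k z"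
    unfolding eisenstein_def by (rule infsum_reindex_bij_betw[OF bij])
  finally show ?thesis .
qed

text \<open>Splitting the integers into n and -1 - n produces, since k is even, the series of
  psi^(k-1) at w and at 1 - w, each divided by (k-1)!. As k - 1 is odd, the reflection formula
  evaluates precisely their sum.\<close>

lemma lipschitz_formula:
  assumes "Im w > 0" "k \<ge> 4" "even k"
  shows "((\<lambda>n::int. inverse ((w + of_int n) ^ k)) has_sum
    (2 * of_real pi * \<i>) ^ k / fact (k - 1) * power_series_pow (k - 1) (qexp w)) UNIV"
proof -
  define l where "l = k - 1"
  have k: "k = Suc l" and l: "l > 0" "odd l" using assms by (auto simp: l_def)
  have "(\<lambda>(m, n). inverse ((of_int m * w + of_int n) ^ k)) summable_on (Sigma UNIV (\<lambda>_. UNIV) :: (int \<times> int) set)"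
    using eisenstein_summable[OF assms(1,2)] by simp
  \<comment> \<open>The row m = 1 of the lattice sum is the series in question.\<close>
  from summable_on_SigmaD1[OF this, of 1]
  have S: "(\<lambda>n::int. inverse ((w + of_int n) ^ k)) summable_on UNIV" by simp
  have w0: "w \<noteq> 0" "1 - w \<noteq> 0" using assms by (auto simp: complex_eq_iff)
  have "(\<lambda>n. inverse ((w + of_int (int n)) ^ k)) sums (Polygamma l w / fact l)"
    using Polygamma_LIMSEQ[OF w0(1) l(1)] l by (simp add: k)
  then have 1: "((\<lambda>n. inverse ((w + of_int (int n)) ^ k)) has_sum (Polygamma l w / fact l)) UNIV"
    using has_sum_imp_sums[OF has_sum_infsum[OF summable_on_int_split(1)[OF S]]]
      has_sum_infsum[OF summable_on_int_split(1)[OF S]] sums_unique2 by metis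
  have "(w + of_int (- 1 - int n)) ^ k = (1 - w + of_nat n) ^ k" for n
    using assms(3) power_minus_even[of k "w + of_int (- 1 - int n)"] by (simp add: algebra_simps)
  then have "(\<lambda>n. inverse ((w + of_int (- 1 - int n)) ^ k)) sums (Polygamma l (1 - w) / fact l)"
    using Polygamma_LIMSEQ[OF w0(2) l(1)] l by (simp add: k)
  then have 2: "((\<lambda>n. inverse ((w + of_int (- 1 - int n)) ^ k)) has_sum (Polygamma l (1 - w) / fact l)) UNIV"
    using has_sum_imp_sums[OF has_sum_infsum[OF summable_on_int_split(2)[OF S]]]
      has_sum_infsum[OF summable_on_int_split(2)[OF S]] sums_unique2 by metis
  have "Polygamma l w + Polygamma l (1 - w)
      = 2 * of_real pi * \<i> * (2 * of_real pi * \<i>) ^ l * power_series_pow l (qexp w)"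
    using Polygamma_reflection[OF assms(1), of l] l by (simp add: algebra_simps)
  then have "Polygamma l w / fact l + Polygamma l (1 - w) / fact l
    = (2 * of_real pi * \<i>) ^ k / fact (k - 1) * power_series_pow (k - 1) (qexp w)"
    by (simp add: k add_divide_distrib[symmetric])
  with has_sum_int_split[OF 1 2] show ?thesis by simp
qed

text \<open>For k > 0 and |q| < 1, rearrangement gives the generating function of the divisor sums
  sigma_k. The double form is the one in which the rows of the lattice sum arrive, and it shows
  monotonicity for real q.\<close>

definition lambert_series :: "nat \<Rightarrow> 'a::{real_normed_field,banach} \<Rightarrow> 'a" where
  "lambert_series k q = suminf (\<lambda>m. power_series_pow k (q ^ Suc m))"

text \<open>For even k \<ge> 4 this is 2 zeta(k), the term at 0 being \<open>inverse 0 = 0\<close>.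
  It serves as a positive normalising factor and is never evaluated.\<close>

definition eisenstein_const :: "nat \<Rightarrow> real" where
  "eisenstein_const k = infsum (\<lambda>n::int. inverse (of_int n ^ k)) UNIV"

lemma eisenstein_const_summable:
  assumes "k \<ge> 4"
  shows "(\<lambda>n::int. inverse (of_int n ^ k :: real)) summable_on UNIV"
proof -
  have "(\<lambda>(m, n). inverse ((of_int m * \<i> + of_int n) ^ k)) summable_on (Sigma UNIV (\<lambda>_. UNIV) :: (int \<times> int) set)"
    using eisenstein_summable[of "\<i>" k] assms by simp
  from summable_on_SigmaD1[OF this, of 0]
  have "(\<lambda>n::int. inverse (of_int n ^ k) :: complex) summable_on UNIV" by simp
  then have "(\<lambda>n::int. Re (inverse (of_int n ^ k))) summable_on UNIV" by (rule summable_on_Re)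
  moreover have "Re (inverse (of_int n ^ k)) = inverse (of_int n ^ k)" for n :: int
  proof -
    have "inverse (of_int n ^ k) = complex_of_real (inverse (of_int n ^ k))" by simp
    then show ?thesis by (metis Re_complex_of_real)
  qed
  ultimately show ?thesis by simp
qed

lemma eisenstein_const_pos:
  assumes "k \<ge> 4" "even k"
  shows "eisenstein_const k > 0"
proof -
  have "(\<Sum>n\<in>{1::int}. inverse (of_int n ^ k)) \<le> eisenstein_const k"
    unfolding eisenstein_const_def
    by (rule finite_sum_le_infsum) (use assms eisenstein_const_summable in \<open>auto simp: zero_le_even_power\<close>)
  then show ?thesis by simp
qed

text \<open>The lattice sum is taken row by row. The row m = 0 is the constant; rows m and -m agree
  because k is even, hence the factor 2; and the row m > 0 is the Lipschitz formula at mz, that is,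
  at q^m.\<close>

lemma eisenstein_qexp:
  assumes "Im z > 0" "k \<ge> 4" "even k"
  shows "eisenstein k z = of_real (eisenstein_const k)
     + 2 * (2 * of_real pi * \<i>) ^ k / fact (k - 1) * lambert_series (k - 1) (qexp z)"
proof -
  let ?C = "(2 * of_real pi * \<i>) ^ k / fact (k - 1) :: complex"
  define R where "R m = infsum (\<lambda>n. inverse ((of_int m * z + of_int n) ^ k)) (UNIV :: int set)" for m :: int
  have S: "(\<lambda>(m, n). inverse ((of_int m * z + of_int n) ^ k)) summable_on (Sigma UNIV (\<lambda>_. UNIV) :: (int \<times> int) set)"
    using eisenstein_summable[OF assms(1,2)] by simp
  have R0: "R 0 = of_real (eisenstein_const k)"
  proof -
    have "R 0 = infsum (\<lambda>n::int. of_real (inverse (of_int n ^ k))) UNIV"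
      unfolding R_def by (intro infsum_cong) simp
    also have "\<dots> = of_real (eisenstein_const k)"
      unfolding eisenstein_const_def
      by (rule infsumI[OF has_sum_of_real[OF has_sum_infsum[OF eisenstein_const_summable[OF assms(2)]]]])
    finally show ?thesis .
  qed
  have R1: "R (int (Suc m)) = ?C * power_series_pow (k - 1) (qexp z ^ Suc m)" for m
  proof -
    have "Im (of_nat (Suc m) * z) > 0" using assms by (simp del: of_nat_Suc)
    from infsumI[OF lipschitz_formula[OF this assms(2,3)]] show ?thesis
      by (simp only: R_def of_int_of_nat_eq qexp_of_nat_mult)
  qed
  have R2: "R (- m) = R m" for m
  proof -
    have "inverse ((of_int (- m) * z + of_int n) ^ k) = inverse ((of_int m * z + of_int (- n)) ^ k)" for n
      using power_minus_even[OF assms(3), of "of_int m * z + of_int (- n)"] by simp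
    then have "R (- m) = infsum (\<lambda>n. inverse ((of_int m * z + of_int (- n)) ^ k)) (UNIV :: int set)"
      unfolding R_def by (intro infsum_cong) simp
    also have "\<dots> = R m"
      unfolding R_def
      by (rule infsum_reindex_bij_betw[of uminus]) (auto intro!: bij_betw_byWitness[of _ uminus])
    finally show ?thesis .
  qed
  have Rsum: "R summable_on UNIV"
    unfolding R_def[abs_def] using summable_on_Sigma_banach[OF S] by simp
  have E: "eisenstein k z = infsum R UNIV"
    using infsum_Sigma'_banach[OF S] by (simp add: R_def[abs_def] eisenstein_def)
  have s2: "(\<lambda>n. R (- 1 - int n)) sums infsum (\<lambda>n. R (- 1 - int n)) UNIV"
    using summable_on_int_split(2)[OF Rsum] by (intro has_sum_imp_sums has_sum_infsum)
  have "R (- 1 - int n) = ?C * power_series_pow (k - 1) (qexp z ^ Suc n)" for n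
    using R2[of "int (Suc n)"] R1[of n] by (simp add: algebra_simps)
  then have s2': "(\<lambda>n. ?C * power_series_pow (k - 1) (qexp z ^ Suc n)) sums infsum (\<lambda>n. R (- 1 - int n)) UNIV"
    using s2 by (simp only:)
  have C0: "?C \<noteq> 0" by simp
  have sm: "summable (\<lambda>n. power_series_pow (k - 1) (qexp z ^ Suc n))"
    using sums_summable[OF s2'] C0 by (subst (asm) summable_cmult_iff) simp
  have v2: "infsum (\<lambda>n. R (- 1 - int n)) UNIV = ?C * lambert_series (k - 1) (qexp z)"
    using sums_unique[OF s2'] suminf_mult[OF sm, of ?C] by (simp add: lambert_series_def)
  have "(\<lambda>n. R (int n)) sums infsum (\<lambda>n. R (int n)) UNIV"
    using summable_on_int_split(1)[OF Rsum] by (intro has_sum_imp_sums has_sum_infsum)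
  then have "(\<lambda>n. R (int (Suc n))) sums (infsum (\<lambda>n. R (int n)) UNIV - R (int 0))"
    using sums_Suc_iff[of "\<lambda>n. R (int n)"] by simp
  then have "(\<lambda>n. ?C * power_series_pow (k - 1) (qexp z ^ Suc n)) sums (infsum (\<lambda>n. R (int n)) UNIV - R (int 0))"
    by (simp only: R1)
  from sums_unique2[OF this s2'[unfolded v2]]
  have "infsum (\<lambda>n. R (int n)) UNIV - R (int 0) = ?C * lambert_series (k - 1) (qexp z)" .
  then have v1: "infsum (\<lambda>n. R (int n)) UNIV = of_real (eisenstein_const k) + ?C * lambert_series (k - 1) (qexp z)"
    using R0 by (simp add: algebra_simps)
  have "(R has_sum (infsum (\<lambda>n. R (int n)) UNIV + infsum (\<lambda>n. R (- 1 - int n)) UNIV)) UNIV"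
    using summable_on_int_split[OF Rsum] by (intro has_sum_int_split has_sum_infsum)
  from infsumI[OF this] show ?thesis
    by (simp add: E v1 v2)
qed

section \<open>Lambert series in the unit disc\<close>

lemma summable_geometric_Suc: "0 \<le> \<rho> \<Longrightarrow> \<rho> < 1 \<Longrightarrow> summable (\<lambda>m. C * \<rho> ^ Suc m)" for \<rho> :: real
  using summable_Suc_iff[of "\<lambda>m. C * \<rho> ^ m"] by (simp add: summable_geometric summable_mult)

text \<open>For k > 0 the term n = 0 vanishes, so a factor q splits off and the remaining series is
  bounded on |q| \<le> \<rho>. The linear bound in |q| is what makes the values at q^m decay
  geometrically in m.\<close>

lemma power_series_pow_bound:
  assumes "k > 0" "0 \<le> \<rho>" "\<rho> < 1"
  obtains C where "C \<ge> 0" "\<And>q :: 'a::{real_normed_field,banach}. norm q \<le> \<rho> \<Longrightarrow> norm (power_series_pow k q) \<le> C * norm q"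
proof -
  have smr: "summable (\<lambda>n. of_nat (Suc n) ^ k * x ^ n)" if "norm x < 1" for x :: real
  proof (cases "x = 0")
    case False
    have "summable (\<lambda>n. of_nat (Suc n) ^ k * x ^ Suc n)"
      using summable_power_series_pow[OF that, of k] by (subst summable_Suc_iff)
    then have "summable (\<lambda>n. inverse x * (of_nat (Suc n) ^ k * x ^ Suc n))"
      by (rule summable_mult)
    then show ?thesis using False by (simp add: field_simps)
  qed (auto intro!: summable_finite[of "{0}"] simp: power_0_left split: if_splits)
  define C where "C = suminf (\<lambda>n. real (Suc n) ^ k * \<rho> ^ n)"
  have sm: "summable (\<lambda>n. real (Suc n) ^ k * \<rho> ^ n)" using assms smr[of \<rho>] by simp
  have "C \<ge> 0" unfolding C_def using sm assms by (intro suminf_nonneg) auto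
  moreover have "norm (power_series_pow k q) \<le> C * norm q" if q: "norm q \<le> \<rho>" for q :: 'a
  proof -
    have q1: "norm q < 1" using q assms by simp
    have "power_series_pow k q = suminf (\<lambda>n. of_nat (Suc n) ^ k * q ^ Suc n)"
      using suminf_split_head[OF summable_power_series_pow[OF q1, of k]] assms
      by (simp add: power_series_pow_def zero_power)
    moreover have "norm \<dots> \<le> suminf (\<lambda>n. real (Suc n) ^ k * \<rho> ^ n * norm q)"
    proof (rule norm_suminf_le)
      have "norm (of_nat (Suc n) ^ k * q ^ Suc n) \<le> real (Suc n) ^ k * \<rho> ^ n * norm q" for n
      proof -
        have "norm (of_nat (Suc n) ^ k * q ^ Suc n) = real (Suc n) ^ k * norm q ^ n * norm q"
          by (simp add: norm_mult norm_power del: of_nat_Suc)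
        also have "\<dots> \<le> real (Suc n) ^ k * \<rho> ^ n * norm q"
          using q by (intro mult_right_mono mult_left_mono power_mono) auto
        finally show ?thesis .
      qed
      then show "norm (of_nat (Suc n) ^ k * q ^ Suc n) \<le> real (Suc n) ^ k * \<rho> ^ n * norm q" for n .
      show "summable (\<lambda>n. real (Suc n) ^ k * \<rho> ^ n * norm q)" by (intro summable_mult2 sm)
    qed
    moreover have "suminf (\<lambda>n. real (Suc n) ^ k * \<rho> ^ n * norm q) = C * norm q"
      unfolding C_def using suminf_mult2[OF sm, of "norm q"] by simp
    ultimately show ?thesis by simp
  qed
  ultimately show thesis by (rule that)
qed

lemma power_Suc_norm_le:
  fixes q :: "'a::real_normed_field"
  assumes "norm q \<le> \<rho>" "\<rho> < 1"
  shows "norm (q ^ Suc m) \<le> \<rho>" "norm (q ^ Suc m) \<le> \<rho> ^ Suc m"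
proof -
  show *: "norm (q ^ Suc m) \<le> \<rho> ^ Suc m"
    unfolding norm_power using assms by (intro power_mono) auto
  have "0 \<le> \<rho>" using assms(1) norm_ge_zero order_trans by blast
  then have "\<rho> ^ Suc m \<le> \<rho> ^ 1" using assms by (intro power_decreasing) auto
  with * show "norm (q ^ Suc m) \<le> \<rho>" by simp
qed

text \<open>The geometric majorant is uniform in q, so it serves both for summability at a point and
  for the Weierstrass test on a disc.\<close>

lemma lambert_series_dominated:
  assumes "k > 0" "0 \<le> \<rho>" "\<rho> < 1"
  shows "\<exists>C. \<forall>(q :: 'a::{real_normed_field,banach}) m. norm q \<le> \<rho> \<longrightarrow>
    norm (power_series_pow k (q ^ Suc m)) \<le> C * \<rho> ^ Suc m"
proof -
  obtain C where C: "C \<ge> 0" "\<And>q :: 'a. norm q \<le> \<rho> \<Longrightarrow> norm (power_series_pow k q) \<le> C * norm q"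
    using power_series_pow_bound[OF assms, where 'a = 'a] by blast
  have "norm (power_series_pow k (q ^ Suc m)) \<le> C * \<rho> ^ Suc m" if "norm q \<le> \<rho>" for q :: 'a and m
    using C(2)[OF power_Suc_norm_le(1)[OF that assms(3), of m]]
      mult_left_mono[OF power_Suc_norm_le(2)[OF that assms(3), of m] C(1)] by linarith
  then show ?thesis by blast
qed

lemma lambert_series_summable:
  fixes q :: "'a::{real_normed_field,banach}"
  assumes "k > 0" "norm q < 1"
  shows "summable (\<lambda>m. power_series_pow k (q ^ Suc m))"
proof -
  obtain C where C: "\<And>m. norm (power_series_pow k (q ^ Suc m)) \<le> C * norm q ^ Suc m"
    using lambert_series_dominated[OF assms(1) norm_ge_zero assms(2), where 'a = 'a] by (metis order_refl)
  have "summable (\<lambda>m. C * norm q ^ Suc m)"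
    using assms by (intro summable_geometric_Suc) auto
  then show ?thesis by (rule summable_comparison_test') (use C in auto)
qed

lemma power_series_pow_of_real:
  assumes "\<bar>x\<bar> < 1"
  shows "power_series_pow k (complex_of_real x) = of_real (power_series_pow k x)"
  unfolding power_series_pow_def
  using summable_power_series_pow[of x k] assms by (simp add: suminf_of_real)

lemma lambert_series_of_real:
  assumes "k > 0" "\<bar>x\<bar> < 1"
  shows "lambert_series k (complex_of_real x) = of_real (lambert_series k x)"
proof -
  have "power_series_pow k (of_real x ^ Suc m) = complex_of_real (power_series_pow k (x ^ Suc m))" for m
    using power_series_pow_of_real[of "x ^ Suc m" k] power_Suc_norm_le(1)[of x "\<bar>x\<bar>" m] assms by simp
  then show ?thesis
    unfolding lambert_series_def
    using lambert_series_summable[of k x] assms by (simp add: suminf_of_real del: power_Suc)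
qed

lemma power_series_pow_mono:
  fixes x y :: real
  assumes "0 \<le> x" "x \<le> y" "y < 1"
  shows "power_series_pow k x \<le> power_series_pow k y"
  unfolding power_series_pow_def
  using assms by (intro suminf_le summable_power_series_pow mult_left_mono power_mono) auto

lemma lambert_series_mono:
  fixes x y :: real
  assumes "0 \<le> x" "x \<le> y" "y < 1" "k > 0"
  shows "lambert_series k x \<le> lambert_series k y"
  unfolding lambert_series_def
proof (intro suminf_le lambert_series_summable power_series_pow_mono)
  show "y ^ Suc m < 1" for m using power_Suc_norm_le(1)[of y y m] assms by simp
qed (use assms in \<open>auto intro!: power_mono simp del: power_Suc\<close>)

lemma lambert_series_0:
  assumes "k > 0"
  shows "lambert_series k (0 :: 'a::{real_normed_field,banach}) = 0"
proof -
  have "power_series_pow k (0 :: 'a) = suminf (\<lambda>n. 0)"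
    unfolding power_series_pow_def using assms by (intro suminf_cong) (auto simp: power_0_left)
  then show ?thesis by (simp add: lambert_series_def)
qed

lemma lambert_series_pos:
  fixes x :: real
  assumes "0 < x" "x < 1" "k > 0"
  shows "lambert_series k x > 0"
  unfolding lambert_series_def
proof (intro suminf_pos lambert_series_summable)
  fix m
  have x: "0 < x ^ Suc m" "x ^ Suc m < 1"
    using assms power_Suc_less_one[of x m] by (auto simp del: power_Suc)
  show "0 < power_series_pow k (x ^ Suc m)"
    unfolding power_series_pow_def
    by (rule suminf_pos2[where i = 1])
       (use x assms in \<open>auto intro!: summable_power_series_pow simp del: power_Suc\<close>)
qed (use assms in auto)

lemma holomorphic_on_lambert_series:
  assumes "k > 0"
  shows "lambert_series k holomorphic_on ball 0 1"
proof (rule holomorphic_uniform_sequence[OF open_ball])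
  have psp: "power_series_pow k holomorphic_on ball 0 1"
    unfolding holomorphic_on_open[OF open_ball] by (metis DERIV_power_series_pow mem_ball_0)
  show "(\<lambda>q. \<Sum>m<n. power_series_pow k (q ^ Suc m)) holomorphic_on ball 0 1" for n
  proof (intro holomorphic_on_sum)
    fix m
    have "power_series_pow k \<circ> (\<lambda>q. q ^ Suc m) holomorphic_on ball 0 1"
    proof (rule holomorphic_on_compose_gen[OF _ psp])
      show "(\<lambda>q. q ^ Suc m) ` ball 0 1 \<subseteq> ball (0::complex) 1"
      proof safe
        fix q :: complex assume "q \<in> ball 0 1"
        then show "q ^ Suc m \<in> ball 0 1"
          using power_Suc_norm_le(1)[of q "norm q" m] by (simp del: power_Suc)
      qed
    qed (intro holomorphic_intros)
    then show "(\<lambda>q. power_series_pow k (q ^ Suc m)) holomorphic_on ball 0 1"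
      by (simp add: o_def)
  qed
  fix q :: complex assume "q \<in> ball 0 1"
  then have q: "norm q < 1" by simp
  \<comment> \<open>The midpoint between |q| and 1 leaves room for a closed disc about q inside |x|
    \<le> \<rho>.\<close>
  define \<rho> where "\<rho> = (1 + norm q) / 2"
  have \<rho>: "0 \<le> \<rho>" "\<rho> < 1" "norm q < \<rho>" using q by (auto simp: \<rho>_def)
  obtain C where C: "\<And>q :: complex. \<And>m. norm q \<le> \<rho> \<Longrightarrow> norm (power_series_pow k (q ^ Suc m)) \<le> C * \<rho> ^ Suc m"
    using lambert_series_dominated[OF assms \<rho>(1,2), where 'a = complex] by metis
  have sub: "norm x \<le> \<rho>" if "x \<in> cball q (\<rho> - norm q)" for x
    using that norm_triangle_ineq[of q "x - q"] by (simp add: dist_norm norm_minus_commute)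
  have "uniform_limit (cball q (\<rho> - norm q)) (\<lambda>n q. \<Sum>m<n. power_series_pow k (q ^ Suc m)) (lambert_series k) sequentially"
    unfolding lambert_series_def[abs_def]
  proof (rule Weierstrass_m_test)
    show "norm (power_series_pow k (x ^ Suc m)) \<le> C * \<rho> ^ Suc m" if "x \<in> cball q (\<rho> - norm q)" for m x
      by (rule C[OF sub[OF that]])
    show "summable (\<lambda>m. C * \<rho> ^ Suc m)"
      using \<rho> by (intro summable_geometric_Suc) auto
  qed
  moreover have "cball q (\<rho> - norm q) \<subseteq> ball 0 1"
  proof
    fix x assume "x \<in> cball q (\<rho> - norm q)"
    from sub[OF this] \<rho>(2) show "x \<in> ball 0 1" by simp
  qed
  ultimately show "\<exists>d>0. cball q d \<subseteq> ball 0 1 \<and>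
      uniform_limit (cball q d) (\<lambda>n q. \<Sum>m<n. power_series_pow k (q ^ Suc m)) (lambert_series k) sequentially"
    using \<rho>(3) by (intro exI[of _ "\<rho> - norm q"]) auto
qed

section \<open>Normalised Eisenstein series and positivity of the discriminant\<close>

definition eisenstein4_q :: "complex \<Rightarrow> complex" where
  "eisenstein4_q q = 1 + of_real (2 * (2 * pi) ^ 4 / (fact 3 * eisenstein_const 4)) * lambert_series 3 q"

text \<open>With \<open>eisenstein_const k\<close> = 2 zeta(k), the factors of the Lambert series in
  \<open>eisenstein4_q\<close> and here are the classical 240 and 504. The minus sign is
  i^6.\<close>

definition eisenstein6_q :: "complex \<Rightarrow> complex" where
  "eisenstein6_q q = 1 - of_real (2 * (2 * pi) ^ 6 / (fact 5 * eisenstein_const 6)) * lambert_series 5 q"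

definition delta_q :: "complex \<Rightarrow> complex" where
  "delta_q q = eisenstein4_q q ^ 3 - eisenstein6_q q ^ 2"

text \<open>This is 1728 times the discriminant modular form.\<close>

definition delta :: "complex \<Rightarrow> complex" where
  "delta z = delta_q (qexp z)"

lemma delta_q_0: "delta_q 0 = 0"
  by (simp add: delta_q_def eisenstein4_q_def eisenstein6_q_def lambert_series_0)

lemma holomorphic_on_delta_q: "delta_q holomorphic_on ball 0 1"
  unfolding delta_q_def eisenstein4_q_def eisenstein6_q_def
  by (intro holomorphic_intros holomorphic_on_lambert_series) auto

lemma eisenstein4_eq:
  assumes "Im z > 0"
  shows "eisenstein4_q (qexp z) = eisenstein 4 z / of_real (eisenstein_const 4)"
  using eisenstein_qexp[OF assms, of 4] eisenstein_const_pos[of 4]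
  by (simp add: eisenstein4_q_def power_mult_distrib divide_simps)

lemma eisenstein6_eq:
  assumes "Im z > 0"
  shows "eisenstein6_q (qexp z) = eisenstein 6 z / of_real (eisenstein_const 6)"
proof -
  have "\<i> ^ 6 = -1" by (simp add: eval_nat_numeral)
  then show ?thesis
    using eisenstein_qexp[OF assms, of 6] eisenstein_const_pos[of 6]
    by (simp add: eisenstein6_q_def power_mult_distrib divide_simps)
qed

lemma delta_modular:
  fixes a b c d :: int
  assumes "a * d - b * c = 1" "Im z > 0"
  shows "delta ((of_int a * z + of_int b) / (of_int c * z + of_int d))
    = (of_int c * z + of_int d) ^ 12 * delta z"
proof -
  let ?j = "of_int c * z + of_int d" and ?w = "(of_int a * z + of_int b) / (of_int c * z + of_int d)"
  have j: "?j \<noteq> 0" using mobius_denom_nonzero[of z a d b c] assms by simp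
  have "Im ?w > 0"
  proof -
    have "Im ?w = (of_int (a * d - b * c)) * Im z / norm ?j ^ 2"
      by (simp add: Im_divide cmod_power2 algebra_simps)
    then show ?thesis using assms j by simp
  qed
  then show ?thesis using assms(2) eisenstein_modular[OF assms(2,1), of 4] eisenstein_modular[OF assms(2,1), of 6]
    by (simp add: delta_def delta_q_def eisenstein4_eq eisenstein6_eq power_divide power_mult_distrib
      power_mult[symmetric] right_diff_distrib)
qed

lemma qexp_imaginary: "qexp (\<i> * of_real y) = of_real (exp (- 2 * pi * y))"
  by (simp add: qexp_def exp_of_real[symmetric] mult_ac)

lemma delta_pos_ge_1:
  assumes "y \<ge> 1"
  obtains r where "r > 0" "delta (\<i> * of_real y) = of_real r"
proof -
  define A where "A = 2 * (2 * pi) ^ 4 / (fact 3 * eisenstein_const 4)"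
  define B where "B = 2 * (2 * pi) ^ 6 / (fact 5 * eisenstein_const 6)"
  have A: "A > 0" and B: "B > 0"
    unfolding A_def B_def using eisenstein_const_pos by auto
  define x where "x = exp (- 2 * pi * y)"
  define x1 where "x1 = exp (- 2 * pi)"
  have x: "0 < x" "x \<le> x1" "x1 < 1" using assms by (auto simp: x_def x1_def)
  have e4: "eisenstein4_q (of_real t) = of_real (1 + A * lambert_series 3 t)"
    and e6: "eisenstein6_q (of_real t) = of_real (1 - B * lambert_series 5 t)" if "0 < t" "t < 1" for t
    using lambert_series_of_real[of 3 t] lambert_series_of_real[of 5 t] that
    unfolding eisenstein4_q_def eisenstein6_q_def A_def[symmetric] B_def[symmetric] by simp_all
  \<comment> \<open>The inversion fixes i, and its automorphy factor i^6 = -1 makes the value equal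
    to its own negative.\<close>
  have "eisenstein 6 \<i> = 0"
    using eisenstein_modular[of \<i> 0 0 "-1" 1 6] by (simp add: eval_nat_numeral)
  then have "eisenstein6_q (qexp \<i>) = 0" using eisenstein6_eq[of \<i>] by simp
  moreover have "qexp \<i> = of_real x1" using qexp_imaginary[of 1] by (simp add: x1_def)
  ultimately have "complex_of_real (1 - B * lambert_series 5 x1) = 0" using e6[of x1] x by simp
  then have 1: "1 - B * lambert_series 5 x1 = 0" by (simp only: of_real_eq_0_iff)
  have "B * lambert_series 5 x \<le> B * lambert_series 5 x1"
    using x B by (intro mult_left_mono lambert_series_mono) auto
  moreover have "B * lambert_series 5 x > 0" using B lambert_series_pos[of x 5] x by simp
  ultimately have e: "0 \<le> 1 - B * lambert_series 5 x" "1 - B * lambert_series 5 x < 1" using 1 by auto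
  have a: "1 + A * lambert_series 3 x > 1" using A lambert_series_pos[of x 3] x by simp
  have "delta (\<i> * of_real y) = of_real ((1 + A * lambert_series 3 x) ^ 3 - (1 - B * lambert_series 5 x) ^ 2)"
    using e4[of x] e6[of x] x assms by (simp add: delta_def delta_q_def qexp_imaginary x_def)
  moreover have "(1 - B * lambert_series 5 x) ^ 2 < 1"
    using e by (simp add: power_less_one_iff abs_square_less_1)
  moreover have "(1 + A * lambert_series 3 x) ^ 3 > 1"
    using a one_less_power[of _ 3] by simp
  ultimately show thesis
    by (intro that[of "(1 + A * lambert_series 3 x) ^ 3 - (1 - B * lambert_series 5 x) ^ 2"]) simp_all
qed

text \<open>For y < 1 the inversion carries iy to i/y, which lies in the range already treated; the
  automorphy factor (iy)^12 = y^12 is real and positive, so the sign is preserved.\<close>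

lemma delta_pos:
  assumes "y > 0"
  obtains r where "r > 0" "delta (\<i> * of_real y) = of_real r"
proof (cases "y \<ge> 1")
  case True
  then show ?thesis using delta_pos_ge_1 that by blast
next
  case False
  then have "1 / y \<ge> 1" using assms by simp
  then obtain r where r: "r > 0" "delta (\<i> * of_real (1 / y)) = of_real r"
    using delta_pos_ge_1 by blast
  have "(\<i> * of_real y) ^ 12 = complex_of_real (y ^ 12)" by (simp add: power_mult_distrib)
  moreover have "of_int (-1) / (\<i> * of_real y) = \<i> * of_real (1 / y)" by (simp add: divide_simps)
  ultimately have "complex_of_real r = of_real (y ^ 12) * delta (\<i> * of_real y)"
    using delta_modular[of 0 0 "-1" 1 "\<i> * of_real y"] assms r(2) by simp
  then have "delta (\<i> * of_real y) = of_real (r / y ^ 12)" using assms by (simp add: field_simps)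
  with r(1) assms show ?thesis by (intro that[of "r / y ^ 12"]) auto
qed

section \<open>Elliptic cusp forms and uniqueness in weight 12\<close>

lemma Im_mobius:
  fixes a b c d :: int
  shows "Im ((of_int a * z + of_int b) / (of_int c * z + of_int d))
    = of_int (a * d - b * c) * Im z / norm (of_int c * z + of_int d) ^ 2"
  by (simp add: Im_divide cmod_power2 algebra_simps)

text \<open>By the linear lower bound on lattice norms only finitely many coprime pairs have norm at
  most 1. The pair (0, 1) has norm 1, so the minimum over this finite set is the minimum over all
  coprime pairs.\<close>

lemma lattice_minimum:
  assumes "Im z > 0"
  obtains c d :: int where "coprime c d"
    "\<And>c' d' :: int. coprime c' d' \<Longrightarrow> norm (of_int c * z + of_int d) \<le> norm (of_int c' * z + of_int d')"
proof -
  define g where "g = (\<lambda>(c :: int, d :: int). norm (of_int c * z + of_int d))"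
  define T where "T = {(c :: int, d :: int). coprime c d \<and> g (c, d) \<le> 1}"
  obtain \<delta> where \<delta>: "\<delta> > 0"
    "\<And>m n :: int. norm (of_int m * z + of_int n) \<ge> \<delta> * max \<bar>of_int m\<bar> \<bar>of_int n\<bar>"
    using lattice_norm_ge[OF assms] by blast
  define N where "N = \<lfloor>1 / \<delta>\<rfloor>"
  have "T \<subseteq> {-N..N} \<times> {-N..N}"
  proof safe
    fix c d assume "(c, d) \<in> T"
    then have "\<delta> * max \<bar>of_int c\<bar> \<bar>of_int d\<bar> \<le> 1"
      using \<delta>(2)[of c d] by (simp add: T_def g_def)
    then have "max \<bar>of_int c\<bar> \<bar>of_int d\<bar> \<le> 1 / \<delta>" using \<delta>(1) by (simp add: pos_le_divide_eq mult.commute del: max.bounded_iff)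
    then have "\<bar>c\<bar> \<le> N" "\<bar>d\<bar> \<le> N" by (auto simp: N_def le_floor_iff)
    then show "c \<in> {-N..N}" "d \<in> {-N..N}" by auto
  qed
  then have fin: "finite T" by (rule finite_subset) simp
  have ne: "(0, 1) \<in> T" by (simp add: T_def g_def)
  define p where "p = arg_min_on g T"
  have p: "p \<in> T" "\<And>x. x \<in> T \<Longrightarrow> g p \<le> g x"
    using arg_min_if_finite(1)[OF fin] arg_min_least[OF fin] ne unfolding p_def by blast+
  obtain c d where cd: "p = (c, d)" by force
  show thesis
  proof (rule that)
    show "coprime c d" using p(1) by (simp add: T_def cd)
    fix c' d' :: int assume "coprime c' d'"
    moreover have "g p \<le> 1" using p(1) by (auto simp: T_def cd)
    ultimately have "g p \<le> g (c', d')"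
      using p(2)[of "(c', d')"] by (cases "g (c', d') \<le> 1") (auto simp: T_def)
    then show "norm (of_int c * z + of_int d) \<le> norm (of_int c' * z + of_int d')"
      by (simp add: g_def cd)
  qed
qed

text \<open>The bottom row is taken with |cz + d| minimal, completed by Bezout to determinant 1, and
  the real part is then reduced by a translation. The top row (a, b) is again coprime, so minimality
  gives |w| \<ge> 1 for the image w. With |Re w| \<le> 1/2 this yields Im w \<ge> sqrt(3)/2, relaxed
  to the rational bound 4/5.\<close>

lemma fundamental_domain:
  assumes "Im z > 0"
  obtains a b c d :: int where "a * d - b * c = 1"
    "\<bar>Re ((of_int a * z + of_int b) / (of_int c * z + of_int d))\<bar> \<le> 1 / 2"
    "Im ((of_int a * z + of_int b) / (of_int c * z + of_int d)) \<ge> 4 / 5"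
proof -
  obtain c d :: int where cd: "coprime c d"
    "\<And>c' d' :: int. coprime c' d' \<Longrightarrow> norm (of_int c * z + of_int d) \<le> norm (of_int c' * z + of_int d')"
    using lattice_minimum[OF assms] by blast
  obtain u v where "u * c + v * d = 1" using bezout_int[of c d] cd(1) by auto
  define a0 b0 where "a0 = v" and "b0 = - u"
  have det0: "a0 * d - b0 * c = 1" using \<open>u * c + v * d = 1\<close> by (simp add: a0_def b0_def algebra_simps)
  let ?j = "of_int c * z + of_int d"
  have j: "?j \<noteq> 0" using mobius_denom_nonzero[OF assms, of a0 d b0 c] det0 by simp
  define n where "n = round (Re ((of_int a0 * z + of_int b0) / ?j))"
  define a b where "a = a0 - n * c" and "b = b0 - n * d"
  have det: "a * d - b * c = 1" using det0 by (simp add: a_def b_def algebra_simps)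
  define w where "w = (of_int a * z + of_int b) / ?j"
  have "w = (of_int a0 * z + of_int b0) / ?j - of_int n"
    using j by (simp add: w_def a_def b_def divide_simps) (simp add: algebra_simps)
  then have re: "\<bar>Re w\<bar> \<le> 1 / 2"
    using of_int_round_abs_le[of "Re ((of_int a0 * z + of_int b0) / ?j)"]
    by (simp only: n_def minus_complex.simps complex_Re_of_int abs_minus_commute)
  have "coprime a b"
  proof (rule coprimeI)
    fix x assume "x dvd a" "x dvd b"
    then have "x dvd a * d - b * c" by simp
    then show "is_unit x" by (simp add: det)
  qed
  then have "norm w \<ge> 1" using cd(2)[of a b] j by (simp add: w_def norm_divide divide_simps)
  then have "1 \<le> norm w ^ 2" by simp
  also have "\<dots> = Re w ^ 2 + Im w ^ 2" by (rule cmod_power2)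
  also have "Re w ^ 2 \<le> (1 / 2) ^ 2" using re abs_le_square_iff[of "Re w" "1 / 2"] by simp
  finally have "Im w ^ 2 \<ge> 3 / 4" by (simp add: power_divide)
  moreover have "Im w > 0" using Im_mobius[of a z b c d] det assms j by (simp add: w_def)
  ultimately have "Im w \<ge> 4 / 5"
    using power_strict_mono[of "Im w" "4 / 5" 2] by (cases "Im w < 4 / 5") (simp_all add: power_divide)
  with re det show thesis unfolding w_def by (intro that) auto
qed

text \<open>Holomorphic cusp forms of weight \<open>2 * l\<close> for the full modular group; boundedness of
  \<open>norm (F z) * Im z ^ l\<close> encodes cuspidality.\<close>

definition elliptic_cusp_form :: "nat \<Rightarrow> (complex \<Rightarrow> complex) \<Rightarrow> bool" where
  "elliptic_cusp_form l F \<longleftrightarrow> F holomorphic_on {z. Im z > 0} \<and>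
     (\<forall>(a::int) b c d z. a * d - b * c = 1 \<longrightarrow> Im z > 0 \<longrightarrow>
        F ((of_int a * z + of_int b) / (of_int c * z + of_int d)) = (of_int c * z + of_int d) ^ (2 * l) * F z) \<and>
     (\<exists>C. \<forall>z. Im z > 0 \<longrightarrow> norm (F z) * Im z ^ l \<le> C)"

lemma elliptic_cusp_form_transform:
  fixes a b c d :: int
  assumes "elliptic_cusp_form l F" "a * d - b * c = 1" "Im z > 0"
  shows "F ((of_int a * z + of_int b) / (of_int c * z + of_int d)) = (of_int c * z + of_int d) ^ (2 * l) * F z"
  using assms unfolding elliptic_cusp_form_def by blast

text \<open>Im w = Im z / |cz + d|^2 cancels the automorphy factor. Modularity is assumed at the
  single point z only, so that the lemma also applies while \<open>F\<close> is still being shown to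
  be a cusp form.\<close>

lemma petersson_invariant:
  fixes a b c d :: int
  assumes "F ((of_int a * z + of_int b) / (of_int c * z + of_int d)) = (of_int c * z + of_int d) ^ (2 * l) * F z"
    and "a * d - b * c = 1" "Im z > 0"
  defines "w \<equiv> (of_int a * z + of_int b) / (of_int c * z + of_int d)"
  shows "norm (F w) * Im w ^ l = norm (F z) * Im z ^ l"
proof -
  have j: "of_int c * z + of_int d \<noteq> 0" using mobius_denom_nonzero[of z a d b c] assms by simp
  have "Im w = Im z / norm (of_int c * z + of_int d) ^ 2"
    unfolding w_def by (subst Im_mobius) (simp add: assms(2))
  moreover have "F w = (of_int c * z + of_int d) ^ (2 * l) * F z" unfolding w_def by fact
  ultimately show ?thesis using j
    by (simp add: norm_mult norm_power power_divide power_mult)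
qed

lemma power_le_fact_exp: "0 \<le> y \<Longrightarrow> y ^ l \<le> fact l * exp y" for y :: real
proof -
  assume y: "0 \<le> y"
  have "(\<Sum>n\<in>{l}. y ^ n /\<^sub>R fact n) \<le> suminf (\<lambda>n. y ^ n /\<^sub>R fact n)"
    by (rule sum_le_suminf) (use y exp_converges[of y] in \<open>auto simp: sums_iff\<close>)
  then show ?thesis using exp_converges[of y] by (simp add: sums_iff divide_simps mult.commute)
qed

text \<open>The witness is the difference quotient at 0 with its removable singularity filled in. As
  it is defined on the whole plane, the factorisation holds for every q.\<close>

lemma holomorphic_factor_zero:
  assumes "P holomorphic_on ball 0 1" "P 0 = 0"
  obtains V where "V holomorphic_on ball 0 1" "V 0 = deriv P 0" "\<And>q. P q = q * V q"
proof
  show "(\<lambda>z. if z = 0 then deriv P 0 else (P z - P 0) / (z - 0)) holomorphic_on ball 0 1"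
    by (rule pole_lemma_open[OF assms(1) open_ball])
qed (use assms in auto)

text \<open>Dividing \<open>P\<close> by q leaves a function bounded on the closed disc of radius
  exp(-2 pi y0) < 1; the factor q supplies the exponential.\<close>

lemma qexp_decay:
  assumes "P holomorphic_on ball 0 1" "P 0 = 0" "y0 > 0"
  obtains B where "B > 0" "\<And>z. Im z \<ge> y0 \<Longrightarrow> norm (P (qexp z)) \<le> B * exp (- 2 * pi * Im z)"
proof -
  obtain V where V: "V holomorphic_on ball 0 1" "\<And>q. P q = q * V q"
    using holomorphic_factor_zero[OF assms(1,2)] by metis
  define r where "r = exp (- 2 * pi * y0)"
  have "r < 1" using assms(3) by (simp add: r_def)
  then have "continuous_on (cball 0 r) V"
    by (intro holomorphic_on_imp_continuous_on holomorphic_on_subset[OF V(1)]) auto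
  then have "bounded (V ` cball 0 r)" by (intro compact_imp_bounded compact_continuous_image) auto
  then obtain B where B: "B > 0" "\<And>q. norm q \<le> r \<Longrightarrow> norm (V q) \<le> B"
    by (auto simp: bounded_pos)
  have "norm (P (qexp z)) \<le> B * exp (- 2 * pi * Im z)" if "Im z \<ge> y0" for z
  proof -
    have "norm (qexp z) \<le> r" using that by (simp add: norm_qexp r_def)
    from B(2)[OF this] show ?thesis
      by (simp add: V(2) norm_mult norm_qexp mult.commute)
  qed
  with B(1) show thesis by (rule that)
qed

text \<open>The power y^l is absorbed by l! exp(y), and 2 pi - 1 \<ge> 1 leaves exp(-y).\<close>

lemma petersson_decay:
  assumes "P holomorphic_on ball 0 1" "P 0 = 0" "y0 > 0"
  obtains B where "B > 0" "\<And>z. Im z \<ge> y0 \<Longrightarrow> norm (P (qexp z)) * Im z ^ l \<le> B * exp (- Im z)"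
proof -
  obtain B where B: "B > 0" "\<And>z. Im z \<ge> y0 \<Longrightarrow> norm (P (qexp z)) \<le> B * exp (- 2 * pi * Im z)"
    using qexp_decay[OF assms] by blast
  have "norm (P (qexp z)) * Im z ^ l \<le> B * fact l * exp (- Im z)" if z: "Im z \<ge> y0" for z
  proof -
    have "norm (P (qexp z)) * Im z ^ l \<le> (B * exp (- 2 * pi * Im z)) * (fact l * exp (Im z))"
      using B z assms(3) by (intro mult_mono power_le_fact_exp) auto
    also have "\<dots> = B * fact l * exp (- 2 * pi * Im z + Im z)"
      by (simp only: exp_add mult_ac)
    also have "\<dots> \<le> B * fact l * exp (- Im z)"
    proof -
      have "2 * Im z \<le> 2 * pi * Im z" using pi_gt3 z assms(3) by simp
      then show ?thesis using B(1) by simp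
    qed
    finally show ?thesis .
  qed
  with B(1) show thesis by (intro that[of "B * fact l"]) auto
qed

text \<open>Boundedness is the point to prove. By invariance it suffices to bound the Petersson norm
  for Im z \<ge> 4/5, where the decay at the cusp applies.\<close>

lemma elliptic_cusp_formI:
  assumes "P holomorphic_on ball 0 1" "P 0 = 0" "\<And>z. Im z > 0 \<Longrightarrow> F z = P (qexp z)"
    and modular: "\<And>(a::int) b c d z. a * d - b * c = 1 \<Longrightarrow> Im z > 0 \<Longrightarrow>
        F ((of_int a * z + of_int b) / (of_int c * z + of_int d)) = (of_int c * z + of_int d) ^ (2 * l) * F z"
  shows "elliptic_cusp_form l F"
proof -
  have "P \<circ> qexp holomorphic_on {z. Im z > 0}"
    by (rule holomorphic_on_compose_gen[OF _ assms(1)])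
       (auto intro!: holomorphic_on_qexp[of "\<lambda>z. z", simplified] holomorphic_intros simp: norm_qexp_less_1)
  then have 1: "F holomorphic_on {z. Im z > 0}"
    using assms(3) by (subst holomorphic_cong[OF refl, of _ _ "P \<circ> qexp"]) auto
  obtain B where B: "B > 0" "\<And>z. Im z \<ge> 4 / 5 \<Longrightarrow> norm (P (qexp z)) * Im z ^ l \<le> B * exp (- Im z)"
    using petersson_decay[OF assms(1,2), of "4 / 5" l] by auto
  have "norm (F z) * Im z ^ l \<le> B" if z: "Im z > 0" for z
  proof -
    obtain a b c d :: int where det: "a * d - b * c = 1" and
      im: "Im ((of_int a * z + of_int b) / (of_int c * z + of_int d)) \<ge> 4 / 5"
      using fundamental_domain[OF z] by metis
    define w where "w = (of_int a * z + of_int b) / (of_int c * z + of_int d)"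
    have "norm (F z) * Im z ^ l = norm (F w) * Im w ^ l"
      using petersson_invariant[of F, OF modular[OF det z] det z] by (simp add: w_def)
    also have "\<dots> \<le> B * exp (- Im w)"
      using B(2)[of w] im assms(3)[of w] by (simp add: w_def)
    also have "\<dots> \<le> B * 1"
      using B(1) im by (intro mult_left_mono) (auto simp: w_def)
    finally show ?thesis by simp
  qed
  with 1 modular show ?thesis unfolding elliptic_cusp_form_def by blast
qed

lemma elliptic_cusp_form_delta: "elliptic_cusp_form 6 delta"
  by (rule elliptic_cusp_formI[OF holomorphic_on_delta_q delta_q_0])
     (simp_all add: delta_def[symmetric] delta_modular del: One_nat_def)

section \<open>Expansion of a cusp form at the cusp\<close>

lemma qexp_eq_imp:
  assumes "qexp u = qexp z"
  obtains n :: int where "u = z + of_int n"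
proof -
  from assms obtain n :: int where "2 * of_real pi * \<i> * u = 2 * of_real pi * \<i> * z + (2 * of_int n * pi) * \<i>"
    unfolding qexp_def exp_eq by auto
  then have "2 * of_real pi * \<i> * u = 2 * of_real pi * \<i> * (z + of_int n)"
    by (simp add: algebra_simps)
  then have "u = z + of_int n" by simp
  then show thesis by (rule that)
qed

text \<open>Invariance under z + 1 lets \<open>F\<close> descend to the punctured disc. The bound
  |F| \<le> C / y^l with l > 0 forces the limit 0 as y tends to infinity, so the singularity at q =
  0 is removable with value 0.\<close>

lemma elliptic_cusp_form_qexp:
  assumes F: "elliptic_cusp_form l F" and "l > 0"
  obtains P where "P holomorphic_on ball 0 1" "P 0 = 0" "\<And>z. Im z > 0 \<Longrightarrow> F z = P (qexp z)"
proof -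
  have holF: "F holomorphic_on {z. Im z > 0}" using F by (simp add: elliptic_cusp_form_def)
  obtain C where C: "\<And>z. Im z > 0 \<Longrightarrow> norm (F z) * Im z ^ l \<le> C"
    using F unfolding elliptic_cusp_form_def by blast
  have per: "F (z + of_int n) = F z" if "Im z > 0" for z n
    using elliptic_cusp_form_transform[OF F, of 1 1 n 0 z] that by simp
  \<comment> \<open>The principal logarithm selects one preimage of q; by periodicity any other
    preimage in the upper half-plane gives the same value.\<close>
  define P where "P q = (if q = 0 then 0 else F (Ln q / (2 * of_real pi * \<i>)))" for q
  have qexp_Ln: "qexp (Ln q / (2 * of_real pi * \<i>)) = q" if "q \<noteq> 0" for q
    using that by (simp add: qexp_def)
  have eq: "F z = P q" if "Im z > 0" "qexp z = q" for z q
  proof -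
    have q: "q \<noteq> 0" using that by auto
    then have "qexp (Ln q / (2 * of_real pi * \<i>)) = qexp z" using qexp_Ln that by simp
    then obtain n where "Ln q / (2 * of_real pi * \<i>) = z + of_int n" by (rule qexp_eq_imp)
    then show ?thesis using q per[OF that(1)] by (simp add: P_def)
  qed
  have hol0: "P holomorphic_on ball 0 1 - {0}"
  proof (subst holomorphic_on_open, simp add: open_delete, intro ballI)
    fix q0 :: complex assume q0: "q0 \<in> ball 0 1 - {0}"
    define U where "U = ball q0 (norm q0) \<inter> ball 0 1"
    \<comment> \<open>A local inverse of \<open>qexp\<close> that avoids the cut of the principal
      logarithm: on the ball of radius |q0| about q0 the quotient q / q0 never meets the closed
      negative real axis.\<close>
    define f where "f q = (Ln (q / q0) + Ln q0) / (2 * of_real pi * \<i>)" for q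
    have slit: "q / q0 \<notin> \<real>\<^sub>\<le>\<^sub>0" if "q \<in> U" for q
    proof
      assume "q / q0 \<in> \<real>\<^sub>\<le>\<^sub>0"
      then obtain r where r: "r \<ge> 0" "q / q0 = - of_real r"
        by (metis minus_minus nonpos_Reals_cases of_real_minus neg_0_le_iff_le)
      have "norm (q0 - q) = norm q0 * norm (1 - q / q0)"
        using q0 by (simp add: norm_mult[symmetric] right_diff_distrib)
      also have "1 - q / q0 = of_real (1 + r)" using r by simp
      also have "norm q0 * norm (complex_of_real (1 + r)) \<ge> norm q0 * 1"
        using r by (intro mult_left_mono) (auto simp del: of_real_add)
      finally show False using that by (simp add: U_def dist_norm)
    qed
    have nz: "q \<noteq> 0" if "q \<in> U" for q using slit[OF that] by auto
    have qf: "qexp (f q) = q" if "q \<in> U" for q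
      using nz[OF that] q0 by (simp add: qexp_def f_def exp_add)
    have imf: "Im (f q) > 0" if "q \<in> U" for q
    proof -
      have "norm (qexp (f q)) < 1" using qf[OF that] that by (simp add: U_def)
      then show ?thesis by (simp add: norm_qexp zero_less_mult_iff)
    qed
    have "F \<circ> f holomorphic_on U"
    proof (rule holomorphic_on_compose_gen[OF _ holF])
      show "f holomorphic_on U" unfolding f_def using slit q0 by (intro holomorphic_intros) auto
      show "f ` U \<subseteq> {z. Im z > 0}" using imf by auto
    qed
    then have "P holomorphic_on U"
      by (rule holomorphic_transform) (use eq[OF imf qf] in auto)
    moreover have "open U" "q0 \<in> U" using q0 by (auto simp: U_def)
    ultimately show "\<exists>f'. (P has_field_derivative f') (at q0)"
      by (auto simp: holomorphic_on_open)
  qed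
  have P_bound: "norm (P q) \<le> C / (- ln (norm q) / (2 * pi)) ^ l" if "0 < norm q" "norm q < 1" for q
  proof -
    let ?z = "Ln q / (2 * of_real pi * \<i>)"
    have im: "Im ?z = - ln (norm q) / (2 * pi)"
      using that by (simp add: Im_divide power2_eq_square)
    then have "Im ?z > 0" using that by (simp add: divide_neg_pos)
    with C[of ?z] have "norm (F ?z) \<le> C / Im ?z ^ l" by (simp add: field_simps)
    then show ?thesis using that im by (simp add: P_def)
  qed
  have "(P \<longlongrightarrow> 0) (at 0)"
  proof (rule Lim_null_comparison)
    have "\<forall>\<^sub>F q in at (0::complex). q \<in> ball 0 1 \<and> q \<noteq> 0 \<and> q \<in> UNIV"
      by (rule eventually_at_ball') simp
    then show "\<forall>\<^sub>F q in at 0. norm (P q) \<le> C / (- ln (norm q) / (2 * pi)) ^ l"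
      by (rule eventually_mono) (rule P_bound; simp)
    have "filterlim (\<lambda>q::complex. norm q) (at_right 0) (at 0)"
      unfolding filterlim_at by (auto simp: eventually_at_filter intro!: tendsto_eq_intros)
    then have "filterlim (\<lambda>q::complex. ln (norm q)) at_bot (at 0)"
      by (rule filterlim_compose[OF ln_at_0])
    then have "filterlim (\<lambda>q::complex. - ln (norm q)) at_top (at 0)"
      by (simp add: filterlim_uminus_at_top)
    then have "filterlim (\<lambda>q::complex. (1 / (2 * pi)) * (- ln (norm q))) at_top (at 0)"
      by (intro filterlim_tendsto_pos_mult_at_top[OF tendsto_const]) auto
    then have "filterlim (\<lambda>q::complex. ((1 / (2 * pi)) * (- ln (norm q))) ^ l) at_top (at 0)"
      using \<open>l > 0\<close> by (intro filterlim_pow_at_top)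
    then have "((\<lambda>q::complex. C / ((1 / (2 * pi)) * (- ln (norm q))) ^ l) \<longlongrightarrow> 0) (at 0)"
      by (rule real_tendsto_divide_at_top[OF tendsto_const])
    then show "((\<lambda>q::complex. C / (- ln (norm q) / (2 * pi)) ^ l) \<longlongrightarrow> 0) (at 0)" by simp
  qed
  then have "(P \<longlongrightarrow> P 0) (at 0)" by (simp add: P_def[of 0])
  then have "(P \<longlongrightarrow> P 0) (at 0 within ball 0 1)" by (rule tendsto_within_subset) simp
  then have "P holomorphic_on ball 0 1"
    by (intro no_isolated_singularity'[of "{0}", OF _ hol0]) auto
  moreover have "P 0 = 0" by (simp add: P_def)
  ultimately show thesis using eq by (intro that) auto
qed

section \<open>The maximum of the Petersson norm and the vanishing criterion in weight 12\<close>

lemma qexp_surj: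
  assumes "q \<noteq> 0"
  obtains z where "qexp z = q" "Im z = - ln (norm q) / (2 * pi)"
proof (rule that)
  show "qexp (Ln q / (2 * of_real pi * \<i>)) = q" using assms by (simp add: qexp_def)
  show "Im (Ln q / (2 * of_real pi * \<i>)) = - ln (norm q) / (2 * pi)"
    using assms by (simp add: Im_divide power2_eq_square)
qed

text \<open>Reduction moves every point into the strip |Re z| \<le> 1/2, Im z \<ge> 4/5. The decay
  at the cusp then confines the search for a maximum to a compact rectangle.\<close>

lemma petersson_norm_attains_max:
  assumes F: "elliptic_cusp_form l F" and "l > 0" and z1: "Im z1 > 0" "F z1 \<noteq> 0"
  obtains z0 where "Im z0 \<ge> 4 / 5" "F z0 \<noteq> 0"
    "\<And>z. Im z > 0 \<Longrightarrow> norm (F z) * Im z ^ l \<le> norm (F z0) * Im z0 ^ l"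
proof -
  define \<phi> where "\<phi> z = norm (F z) * Im z ^ l" for z
  obtain P where P: "P holomorphic_on ball 0 1" "P 0 = 0" "\<And>z. Im z > 0 \<Longrightarrow> F z = P (qexp z)"
    using elliptic_cusp_form_qexp[OF F \<open>l > 0\<close>] by metis
  obtain B where B: "B > 0" "\<And>z. Im z \<ge> 4 / 5 \<Longrightarrow> norm (P (qexp z)) * Im z ^ l \<le> B * exp (- Im z)"
    using petersson_decay[OF P(1,2), of "4 / 5" l] by auto
  have reduce: "\<exists>w. \<bar>Re w\<bar> \<le> 1 / 2 \<and> Im w \<ge> 4 / 5 \<and> \<phi> w = \<phi> z" if z: "Im z > 0" for z
  proof -
    obtain a b c d :: int where det: "a * d - b * c = 1" and
      w: "\<bar>Re ((of_int a * z + of_int b) / (of_int c * z + of_int d))\<bar> \<le> 1 / 2"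
      "Im ((of_int a * z + of_int b) / (of_int c * z + of_int d)) \<ge> 4 / 5"
      using fundamental_domain[OF z] by metis
    then show ?thesis
      using petersson_invariant[of F, OF elliptic_cusp_form_transform[OF F det z] det z]
      unfolding \<phi>_def by blast
  qed
  obtain z2 where z2: "\<bar>Re z2\<bar> \<le> 1 / 2" "Im z2 \<ge> 4 / 5" "\<phi> z2 = \<phi> z1"
    using reduce[OF z1(1)] by blast
  have pos: "\<phi> z2 > 0" using z1 z2(3) by (simp add: \<phi>_def)
  have "((\<lambda>y::real. B * exp (- y)) \<longlongrightarrow> B * 0) at_top"
    by (intro tendsto_intros filterlim_compose[OF exp_at_bot] filterlim_uminus_at_bot_at_top)
  then have "\<forall>\<^sub>F y in at_top. B * exp (- y) < \<phi> z2"
    using pos by (intro order_tendstoD) auto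
  then obtain Y where Y: "\<And>y. y \<ge> Y \<Longrightarrow> B * exp (- y) < \<phi> z2"
    by (auto simp: eventually_at_top_linorder)
  \<comment> \<open>Above height \<open>Y\<close> the decay bound is smaller than the positive value
    at \<open>z2\<close>. The rectangle reaches at least up to Im z2, so its maximum is no smaller
    than that value.\<close>
  define K where "K = cbox (Complex (- 1 / 2) (4 / 5)) (Complex (1 / 2) (max Y (Im z2)))"
  have K: "z \<in> K \<longleftrightarrow> \<bar>Re z\<bar> \<le> 1 / 2 \<and> 4 / 5 \<le> Im z \<and> Im z \<le> max Y (Im z2)" for z
    by (auto simp: K_def in_cbox_complex_iff)
  have "continuous_on K \<phi>"
    unfolding \<phi>_def using F
    by (intro continuous_intros holomorphic_on_imp_continuous_on)
       (auto simp: elliptic_cusp_form_def K elim!: holomorphic_on_subset)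
  moreover have "compact K" by (simp add: K_def)
  moreover have "z2 \<in> K" using z2 by (simp add: K)
  ultimately obtain z0 where z0: "z0 \<in> K" "\<And>z. z \<in> K \<Longrightarrow> \<phi> z \<le> \<phi> z0"
    using continuous_attains_sup[of K \<phi>] by blast
  have "\<phi> z \<le> \<phi> z0" if "Im z > 0" for z
  proof -
    obtain w where w: "\<bar>Re w\<bar> \<le> 1 / 2" "Im w \<ge> 4 / 5" "\<phi> w = \<phi> z"
      using reduce[OF \<open>Im z > 0\<close>] by blast
    show ?thesis
    proof (cases "Im w \<le> max Y (Im z2)")
      case True
      then show ?thesis using z0(2)[of w] w by (simp add: K)
    next
      case False
      then have "Y \<le> Im w" by simp
      then have "\<phi> w < \<phi> z2" using B(2)[of w] Y[of "Im w"] w P(3)[of w] by (simp add: \<phi>_def)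
      then show ?thesis using z0(2)[OF \<open>z2 \<in> K\<close>] w by simp
    qed
  qed
  moreover have "F z0 \<noteq> 0" using z0(2)[OF \<open>z2 \<in> K\<close>] pos by (auto simp: \<phi>_def)
  ultimately show thesis using z0(1) unfolding \<phi>_def K by (intro that) auto
qed

text \<open>If \<open>F\<close> vanished to order 2 at the cusp, then \<open>F / q\<^sup>2\<close> would violate the maximum principle
  on \<open>Im z \<ge> 1 / 2\<close>, because \<open>exp (4 * pi * y) / y ^ 6\<close> increases there.\<close>

lemma cusp_form_12_vanishing:
  assumes F: "elliptic_cusp_form 6 F"
    and P: "P holomorphic_on ball 0 1" "P 0 = 0" "\<And>z. Im z > 0 \<Longrightarrow> F z = P (qexp z)"
    and "deriv P 0 = 0" "Im z > 0"
  shows "F z = 0"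
proof (rule ccontr)
  assume "F z \<noteq> 0"
  then obtain z0 where z0: "Im z0 \<ge> 4 / 5" "F z0 \<noteq> 0"
    "\<And>z. Im z > 0 \<Longrightarrow> norm (F z) * Im z ^ 6 \<le> norm (F z0) * Im z0 ^ 6"
    using petersson_norm_attains_max[OF F _ \<open>Im z > 0\<close>] by auto
  obtain V1 where V1: "V1 holomorphic_on ball 0 1" "V1 0 = 0" "\<And>q. P q = q * V1 q"
    using holomorphic_factor_zero[OF P(1,2)] assms(5) by metis
  obtain V where V: "V holomorphic_on ball 0 1" "\<And>q. V1 q = q * V q"
    using holomorphic_factor_zero[OF V1(1,2)] by metis
  define \<phi>0 where "\<phi>0 = norm (F z0) * Im z0 ^ 6"
  have \<phi>0: "\<phi>0 > 0" using z0 by (simp add: \<phi>0_def)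
  \<comment> \<open>The circle |q| = exp(-pi) corresponds to Im z = 1/2; since Im z0 \<ge> 4/5, the
    point qexp z0 lies strictly inside.\<close>
  define r where "r = exp (- pi)"
  have r: "0 < r" "r < 1" by (auto simp: r_def)
  have normV: "norm (V (qexp z)) = norm (F z) * exp (4 * pi * Im z)" if "Im z > 0" for z
  proof -
    have "norm (F z) = norm (qexp z) ^ 2 * norm (V (qexp z))"
      using P(3)[OF that] by (simp add: V1(3) V(2) norm_mult power2_eq_square)
    also have "norm (qexp z) ^ 2 = exp (- (4 * pi * Im z))"
      by (simp add: norm_qexp exp_double[symmetric])
    finally show ?thesis by (simp add: exp_minus)
  qed
  \<comment> \<open>On the boundary the maximality of \<phi>0 gives |F| \<le> \<phi>0 2^6, and the
    division by q^2 contributes exp(4 pi / 2).\<close>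
  have "norm (V (qexp z0)) \<le> \<phi>0 * 2 ^ 6 * exp (2 * pi)"
  proof (rule maximum_modulus_frontier[where S = "ball 0 r" and f = V])
    show "V holomorphic_on interior (ball 0 r)"
      by (rule holomorphic_on_subset[OF V(1)]) (use r in auto)
    show "continuous_on (closure (ball 0 r)) V"
      by (rule holomorphic_on_imp_continuous_on, rule holomorphic_on_subset[OF V(1)]) (use r in auto)
    show "qexp z0 \<in> ball 0 r" using z0(1) by (simp add: norm_qexp r_def)
    fix q :: complex assume "q \<in> frontier (ball 0 r)"
    then have q: "norm q = r" using r by (simp add: frontier_ball)
    with r have "q \<noteq> 0" by auto
    then obtain w where w: "qexp w = q" "Im w = - ln (norm q) / (2 * pi)" by (rule qexp_surj)
    have im: "Im w = 1 / 2" using w(2) q by (simp add: r_def)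
    have "norm (F w) \<le> \<phi>0 * 2 ^ 6" using z0(3)[of w] im by (simp add: \<phi>0_def power_divide)
    then have "norm (F w) * exp (2 * pi) \<le> \<phi>0 * 2 ^ 6 * exp (2 * pi)" by (rule mult_right_mono) simp
    then show "norm (V q) \<le> \<phi>0 * 2 ^ 6 * exp (2 * pi)"
      using normV[of w] im w(1) by simp
  qed simp
  moreover have "norm (V (qexp z0)) = norm (F z0) * exp (4 * pi * Im z0)"
    using z0(1) by (intro normV) auto
  ultimately have le: "norm (F z0) * exp (4 * pi * Im z0) \<le> norm (F z0) * ((2 * Im z0) ^ 6 * exp (2 * pi))"
    by (simp add: \<phi>0_def power_mult_distrib mult_ac)
  define t where "t = 2 * Im z0"
  have t: "t > 1" using z0(1) by (simp add: t_def)
  \<comment> \<open>Here the weight matters: the power t^6 costs at most exp(6 (t - 1)), while the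
    two orders of vanishing gain exp(2 pi (t - 1)), and 6 < 2 pi.\<close>
  have "t ^ 6 \<le> exp (t - 1) ^ 6" using exp_ge_add_one_self[of "t - 1"] t by (intro power_mono) auto
  also have "\<dots> = exp (6 * (t - 1))" by (simp add: exp_of_nat_mult[symmetric])
  also have "\<dots> < exp (2 * pi * (t - 1))"
    using mult_strict_right_mono[of 6 "2 * pi" "t - 1"] pi_gt3 t by simp
  finally have "t ^ 6 * exp (2 * pi) < exp (2 * pi * (t - 1)) * exp (2 * pi)" by simp
  also have "\<dots> = exp (4 * pi * Im z0)" by (simp add: exp_add[symmetric] t_def algebra_simps)
  finally have "(2 * Im z0) ^ 6 * exp (2 * pi) < exp (4 * pi * Im z0)" by (simp add: t_def)
  with le z0(2) show False by simp
qed

lemma elliptic_cusp_form_diff_cmult: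
  assumes F: "elliptic_cusp_form l F" and G: "elliptic_cusp_form l G"
  shows "elliptic_cusp_form l (\<lambda>z. F z - c * G z)"
proof -
  obtain C1 where C1: "\<And>z. Im z > 0 \<Longrightarrow> norm (F z) * Im z ^ l \<le> C1"
    using F unfolding elliptic_cusp_form_def by blast
  obtain C2 where C2: "\<And>z. Im z > 0 \<Longrightarrow> norm (G z) * Im z ^ l \<le> C2"
    using G unfolding elliptic_cusp_form_def by blast
  have "norm (F z - c * G z) * Im z ^ l \<le> C1 + norm c * C2" if "Im z > 0" for z
  proof -
    have "norm (F z - c * G z) * Im z ^ l \<le> (norm (F z) + norm c * norm (G z)) * Im z ^ l"
      using that norm_triangle_ineq4[of "F z" "c * G z"] by (intro mult_right_mono) (auto simp: norm_mult)
    also have "\<dots> = norm (F z) * Im z ^ l + norm c * (norm (G z) * Im z ^ l)" by (simp add: algebra_simps)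
    also have "\<dots> \<le> C1 + norm c * C2" using that by (intro add_mono mult_left_mono C1 C2) auto
    finally show ?thesis .
  qed
  moreover have "(\<lambda>z. F z - c * G z) holomorphic_on {z. Im z > 0}"
    using F G by (intro holomorphic_intros) (auto simp: elliptic_cusp_form_def)
  ultimately show ?thesis
    unfolding elliptic_cusp_form_def
    using elliptic_cusp_form_transform[OF F] elliptic_cusp_form_transform[OF G]
    by (auto simp: algebra_simps)
qed

text \<open>A nonzero form has a nonzero coefficient of q by the vanishing criterion. The constant c
  is chosen to cancel this coefficient in \<open>F - c * G\<close>, to which the criterion applies
  again.\<close>

lemma cusp_form_12_unique:
  assumes F: "elliptic_cusp_form 6 F" and G: "elliptic_cusp_form 6 G" and "Im z0 > 0" "G z0 \<noteq> 0"
  obtains c where "\<And>z. Im z > 0 \<Longrightarrow> F z = c * G z"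
proof -
  obtain P where P: "P holomorphic_on ball 0 1" "P 0 = 0" "\<And>z. Im z > 0 \<Longrightarrow> F z = P (qexp z)"
    using elliptic_cusp_form_qexp[OF F] by auto
  obtain Q where Q: "Q holomorphic_on ball 0 1" "Q 0 = 0" "\<And>z. Im z > 0 \<Longrightarrow> G z = Q (qexp z)"
    using elliptic_cusp_form_qexp[OF G] by auto
  have Q': "deriv Q 0 \<noteq> 0" using cusp_form_12_vanishing[OF G Q] assms(3,4) by blast
  define c where "c = deriv P 0 / deriv Q 0"
  have "(P has_field_derivative deriv P 0) (at 0)" "(Q has_field_derivative deriv Q 0) (at 0)"
    using P(1) Q(1) by (auto intro!: holomorphic_derivI[of _ "ball 0 1"])
  then have "((\<lambda>q. P q - c * Q q) has_field_derivative (deriv P 0 - c * deriv Q 0)) (at 0)"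
    by (intro DERIV_diff DERIV_cmult)
  then have "deriv (\<lambda>q. P q - c * Q q) 0 = 0"
    using Q' by (simp add: c_def DERIV_imp_deriv)
  then have "F z - c * G z = 0" if "Im z > 0" for z
    using that P Q
    by (intro cusp_form_12_vanishing[OF elliptic_cusp_form_diff_cmult[OF F G], of "\<lambda>q. P q - c * Q q"])
       (auto intro!: holomorphic_intros)
  then show thesis by (intro that[of c]) auto
qed

text \<open>Hecke's estimate: on the circle Im z = 1/n the Petersson bound reads |P| \<le> C n^l,
  and Cauchy's inequality loses only r^(-n) = exp(2 pi), independently of n.\<close>

lemma hecke_bound:
  assumes F: "elliptic_cusp_form l F"
    and P: "P holomorphic_on ball 0 1" "\<And>z. Im z > 0 \<Longrightarrow> F z = P (qexp z)"
  obtains C where "C \<ge> 0" "\<And>n. n \<ge> 1 \<Longrightarrow> norm ((deriv ^^ n) P 0 / fact n) \<le> C * real n ^ l"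
proof -
  obtain C where C: "\<And>z. Im z > 0 \<Longrightarrow> norm (F z) * Im z ^ l \<le> C"
    using F unfolding elliptic_cusp_form_def by blast
  have "norm (F \<i>) \<le> C" using C[of \<i>] by simp
  then have C0: "C \<ge> 0" by (rule order_trans[OF norm_ge_zero])
  have "norm ((deriv ^^ n) P 0 / fact n) \<le> C * exp (2 * pi) * real n ^ l" if n: "n \<ge> 1" for n
  proof -
    define r where "r = exp (- 2 * pi / real n)"
    have r: "0 < r" "r < 1" using n by (auto simp: r_def divide_neg_pos)
    have "norm ((deriv ^^ n) P 0) \<le> fact n * (C * real n ^ l) / r ^ n"
    proof (rule Cauchy_inequality)
      show "P holomorphic_on ball 0 r" by (rule holomorphic_on_subset[OF P(1)]) (use r in auto)
      show "continuous_on (cball 0 r) P"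
        by (rule holomorphic_on_imp_continuous_on, rule holomorphic_on_subset[OF P(1)]) (use r in auto)
      fix q :: complex assume "norm (0 - q) = r"
      then have q: "norm q = r" by simp
      with r have "q \<noteq> 0" by auto
      then obtain w where w: "qexp w = q" "Im w = - ln (norm q) / (2 * pi)" by (rule qexp_surj)
      have im: "Im w = 1 / real n" using w(2) q by (simp add: r_def)
      show "norm (P q) \<le> C * real n ^ l"
        using C[of w] P(2)[of w] im n w(1) by (simp add: power_divide divide_simps split: if_splits)
    qed (use r in auto)
    moreover have "r ^ n = exp (- 2 * pi)" using n by (simp add: r_def exp_of_nat_mult[symmetric])
    ultimately show ?thesis
      by (simp add: norm_divide divide_simps exp_minus mult_ac)
  qed
  with C0 show thesis by (intro that[of "C * exp (2 * pi)"]) auto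
qed

section \<open>Siegel modular forms of genus 1\<close>

lemma mat_1_1_eqI:
  "A \<in> carrier_mat 1 1 \<Longrightarrow> B \<in> carrier_mat 1 1 \<Longrightarrow> A $$ (0, 0) = B $$ (0, 0) \<Longrightarrow> A = B"
  by (intro eq_matI) auto

lemma mult_mat_1_1:
  fixes A B :: "'a::semiring_0 mat"
  assumes "A \<in> carrier_mat 1 1" "B \<in> carrier_mat 1 1"
  shows "(A * B) $$ (0, 0) = A $$ (0, 0) * B $$ (0, 0)"
  using assms by (simp add: scalar_prod_def)

lemma mult_mat_2_2:
  fixes A B :: "'a::semiring_0 mat"
  assumes "A \<in> carrier_mat 2 2" "B \<in> carrier_mat 2 2" "i < 2" "j < 2"
  shows "(A * B) $$ (i, j) = A $$ (i, 0) * B $$ (0, j) + A $$ (i, 1) * B $$ (1, j)"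
  using assms by (simp add: scalar_prod_def numeral_2_eq_2 add.commute)

lemma det_mat_2_2:
  fixes A :: "'a::comm_ring_1 mat"
  assumes "A \<in> carrier_mat 2 2"
  shows "det A = A $$ (0, 0) * A $$ (1, 1) - A $$ (0, 1) * A $$ (1, 0)"
proof -
  have c: "mat_delete A i j \<in> carrier_mat 1 1" for i j
    using assms mat_delete_carrier[of A 1 1] by (auto simp: numeral_2_eq_2)
  have del: "mat_delete A 0 0 $$ (0, 0) = A $$ (1, 1)" "mat_delete A 1 0 $$ (0, 0) = A $$ (0, 1)"
    using assms by (auto simp: mat_delete_def)
  have "det A = (\<Sum>i<2. A $$ (i, 0) * cofactor A i 0)"
    by (rule laplace_expansion_column[OF assms]) simp
  also have "\<dots> = A $$ (0, 0) * det (mat_delete A 0 0) - A $$ (1, 0) * det (mat_delete A 1 0)"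
    by (simp add: numeral_2_eq_2 cofactor_def)
  also have "\<dots> = A $$ (0, 0) * A $$ (1, 1) - A $$ (1, 0) * A $$ (0, 1)"
    by (simp only: det_single[OF c] del)
  finally show ?thesis by (simp add: mult.commute)
qed

lemma pos_def_mat_1: "pos_def_mat 1 A \<longleftrightarrow> A \<in> carrier_mat 1 1 \<and> A $$ (0, 0) > 0"
proof (cases "A \<in> carrier_mat 1 1")
  case True
  have tr: "transpose_mat A = A" using True by (intro mat_1_1_eqI) auto
  have quad: "scalar_prod x (A *\<^sub>v x) = A $$ (0, 0) * (x $ 0) ^ 2" if "x \<in> carrier_vec 1" for x
    using True that by (simp add: scalar_prod_def power2_eq_square)
  show ?thesis
  proof
    assume p: "pos_def_mat 1 A"
    let ?x = "vec 1 (\<lambda>_. 1 :: real)"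
    have "?x \<noteq> 0\<^sub>v 1" by (auto simp: vec_eq_iff)
    then have "0 < scalar_prod ?x (A *\<^sub>v ?x)" using p unfolding pos_def_mat_def by simp
    then show "A \<in> carrier_mat 1 1 \<and> A $$ (0, 0) > 0" using True quad[of ?x] by simp
  next
    assume "A \<in> carrier_mat 1 1 \<and> A $$ (0, 0) > 0"
    moreover have "x $ 0 \<noteq> 0" if "x \<in> carrier_vec 1" "x \<noteq> 0\<^sub>v 1" for x :: "real vec"
      using that by (auto simp: vec_eq_iff)
    ultimately show "pos_def_mat 1 A"
      unfolding pos_def_mat_def using tr quad by auto
  qed
qed (simp add: pos_def_mat_def)

lemma siegel_space_1: "Z \<in> siegel_space 1 \<longleftrightarrow> Z \<in> carrier_mat 1 1 \<and> Im (Z $$ (0, 0)) > 0"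
proof -
  have "transpose_mat Z = Z" if "Z \<in> carrier_mat 1 1" using that by (intro mat_1_1_eqI) auto
  then show ?thesis unfolding siegel_space_def pos_def_mat_1 by auto
qed

lemma symp_form_1: "symp_form 1 \<in> carrier_mat 2 2" "symp_form 1 $$ (0, 0) = 0" "symp_form 1 $$ (0, 1) = 1"
  "symp_form 1 $$ (1, 0) = - 1" "symp_form 1 $$ (1, 1) = 0"
  by (auto simp: symp_form_def Let_def numeral_2_eq_2)

lemmas symp_form_1_index = symp_form_1(2-)

lemma dim_symp_form_1 [simp]: "dim_row (symp_form 1) = 2" "dim_col (symp_form 1) = 2"
  using symp_form_1(1) by auto

lemma smult_symp_form_1_eq_iff: "m \<cdot>\<^sub>m symp_form 1 = n \<cdot>\<^sub>m symp_form 1 \<longleftrightarrow> m = n"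
proof
  assume "m \<cdot>\<^sub>m symp_form 1 = n \<cdot>\<^sub>m symp_form 1"
  then have "(m \<cdot>\<^sub>m symp_form 1) $$ (0, 1) = (n \<cdot>\<^sub>m symp_form 1) $$ (0, 1)" by simp
  moreover have "(k \<cdot>\<^sub>m symp_form 1) $$ (0, 1) = k" for k
    by (subst index_smult_mat(1)) (simp_all add: symp_form_1_index del: One_nat_def)
  ultimately show "m = n" by simp
qed simp

text \<open>In size 2 every matrix is a similitude of the symplectic form with factor its
  determinant. This identifies \<open>Sp 1\<close> with SL_2(Z) and makes membership in
  \<open>GSp_pos 1\<close> a condition on the sign of the determinant.\<close>

lemma symp_form_conj:
  assumes M: "M \<in> carrier_mat 2 2"
  shows "transpose_mat M * symp_form 1 * M = det M \<cdot>\<^sub>m symp_form 1"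
proof (rule eq_matI)
  have T: "transpose_mat M \<in> carrier_mat 2 2" using M by auto
  define N where "N = transpose_mat M * symp_form 1"
  have N: "N \<in> carrier_mat 2 2" using T symp_form_1(1) by (simp add: N_def)
  have Nij: "N $$ (i, j) = M $$ (0, i) * symp_form 1 $$ (0, j) + M $$ (1, i) * symp_form 1 $$ (1, j)"
    if "i < 2" "j < 2" for i j
    unfolding N_def mult_mat_2_2[OF T symp_form_1(1) that] using M that by simp
  fix i j assume "i < dim_row (det M \<cdot>\<^sub>m symp_form 1)" "j < dim_col (det M \<cdot>\<^sub>m symp_form 1)"
  then have ij: "i < 2" "j < 2" by (simp_all del: One_nat_def)
  then have "(i = 0 \<or> i = 1) \<and> (j = 0 \<or> j = 1)" by auto
  moreover have "(det M \<cdot>\<^sub>m symp_form 1) $$ (i, j) = det M * symp_form 1 $$ (i, j)"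
    using ij by (simp del: One_nat_def)
  ultimately show "(transpose_mat M * symp_form 1 * M) $$ (i, j) = (det M \<cdot>\<^sub>m symp_form 1) $$ (i, j)"
    unfolding N_def[symmetric] mult_mat_2_2[OF N M ij] det_mat_2_2[OF M]
    by (elim conjE disjE) (simp_all add: Nij symp_form_1_index del: One_nat_def)
qed (use M in \<open>simp_all del: One_nat_def\<close>)

lemma Sp_1: "M \<in> Sp 1 \<longleftrightarrow> M \<in> carrier_mat 2 2 \<and> det M = 1"
proof -
  have "transpose_mat M * symp_form 1 * M = symp_form 1 \<longleftrightarrow> det M = 1" if "M \<in> carrier_mat 2 2"
  proof -
    have "1 \<cdot>\<^sub>m symp_form 1 = symp_form 1" by (intro eq_matI) auto
    then show ?thesis
      using smult_symp_form_1_eq_iff[of "det M" 1] unfolding symp_form_conj[OF that] by (simp only:)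
  qed
  then show ?thesis unfolding Sp_def by auto
qed

lemma GSp_pos_1:
  assumes "M \<in> GSp_pos 1"
  shows "M \<in> carrier_mat 2 2" "det M > 0"
proof -
  obtain n where n: "M \<in> carrier_mat 2 2" "n > 0" "transpose_mat M * symp_form 1 * M = n \<cdot>\<^sub>m symp_form 1"
    using assms unfolding GSp_pos_def by auto
  then have "det M = n" unfolding symp_form_conj[OF n(1)] smult_symp_form_1_eq_iff by simp
  with n show "M \<in> carrier_mat 2 2" "det M > 0" by auto
qed

definition moebius_den :: "int mat \<Rightarrow> complex \<Rightarrow> complex" where
  "moebius_den M z = of_int (M $$ (1, 0)) * z + of_int (M $$ (1, 1))"

definition moebius_map :: "int mat \<Rightarrow> complex \<Rightarrow> complex" where
  "moebius_map M z = (of_int (M $$ (0, 0)) * z + of_int (M $$ (0, 1))) / moebius_den M z"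

lemma moebius_denom_1:
  assumes "M \<in> carrier_mat 2 2" "Z \<in> carrier_mat 1 1"
  shows "moebius_denom 1 M Z \<in> carrier_mat 1 1" "moebius_denom 1 M Z $$ (0, 0) = moebius_den M (Z $$ (0, 0))"
  using assms by (auto simp: moebius_denom_def moebius_den_def split_block_def Let_def scalar_prod_def)

lemma mat_inverse_1:
  fixes A :: "complex mat"
  assumes A: "A \<in> carrier_mat 1 1" and "A $$ (0, 0) \<noteq> 0"
  shows "the (mat_inverse A) \<in> carrier_mat 1 1" "the (mat_inverse A) $$ (0, 0) = inverse (A $$ (0, 0))"
proof -
  let ?B = "mat 1 1 (\<lambda>_. inverse (A $$ (0, 0)))"
  have "A * ?B = 1\<^sub>m 1" "?B * A = 1\<^sub>m 1"
    using assms by (auto intro!: mat_1_1_eqI simp: scalar_prod_def)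
  \<comment> \<open>\<open>mat_inverse\<close> fails only on non-units of the matrix ring; the
    explicit inverse excludes this case.\<close>
  then have "A \<in> Units (ring_mat TYPE(complex) 1 undefined)"
    using A unfolding Units_def ring_mat_def by (auto intro!: bexI[of _ ?B])
  then obtain B where B: "mat_inverse A = Some B" using mat_inverse(1)[OF A] by fastforce
  from mat_inverse(2)[OF A B] have *: "A * B = 1\<^sub>m 1" "B \<in> carrier_mat 1 1" by auto
  then show "the (mat_inverse A) \<in> carrier_mat 1 1" using B by simp
  have "A $$ (0, 0) * B $$ (0, 0) = 1"
    using mult_mat_1_1[OF A *(2)] *(1) by simp
  then show "the (mat_inverse A) $$ (0, 0) = inverse (A $$ (0, 0))"
    using B by (simp add: inverse_unique)
qed

lemma moebius_den_nonzero:
  assumes "M \<in> carrier_mat 2 2" "det M \<noteq> 0" "Im z > 0"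
  shows "moebius_den M z \<noteq> 0"
  unfolding moebius_den_def
  using mobius_denom_nonzero[of z "M $$ (0, 0)" "M $$ (1, 1)" "M $$ (0, 1)" "M $$ (1, 0)"] assms by (simp add: det_mat_2_2)

lemma moebius_1:
  assumes "M \<in> carrier_mat 2 2" "det M \<noteq> 0" "Z \<in> siegel_space 1"
  shows "moebius 1 M Z \<in> carrier_mat 1 1" "moebius 1 M Z $$ (0, 0) = moebius_map M (Z $$ (0, 0))"
proof -
  have Z: "Z \<in> carrier_mat 1 1" "Im (Z $$ (0, 0)) > 0" using assms(3) unfolding siegel_space_1 by auto
  note d = moebius_denom_1[OF assms(1) Z(1)]
  have "moebius_denom 1 M Z $$ (0, 0) \<noteq> 0" using moebius_den_nonzero[OF assms(1,2) Z(2)] d by simp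
  note i = mat_inverse_1[OF d(1) this]
  show "moebius 1 M Z \<in> carrier_mat 1 1" "moebius 1 M Z $$ (0, 0) = moebius_map M (Z $$ (0, 0))"
    using assms(1) Z i d
    by (auto simp: moebius_def moebius_map_def split_block_def Let_def scalar_prod_def divide_inverse)
qed

lemma Im_moebius_map:
  assumes "M \<in> carrier_mat 2 2"
  shows "Im (moebius_map M z) = of_int (det M) * Im z / norm (moebius_den M z) ^ 2"
  unfolding moebius_map_def moebius_den_def det_mat_2_2[OF assms] by (rule Im_mobius)

lemma Im_moebius_map_pos:
  assumes "M \<in> carrier_mat 2 2" "det M > 0" "Im z > 0"
  shows "Im (moebius_map M z) > 0"
  using moebius_den_nonzero[OF assms(1) _ assms(3)] assms by (simp add: Im_moebius_map)

text \<open>The cocycle relation of the automorphy factor, which turns composition of slash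
  operators into matrix multiplication.\<close>

lemma moebius_map_mult:
  assumes A: "A \<in> carrier_mat 2 2" and B: "B \<in> carrier_mat 2 2" and "det B \<noteq> 0" "Im z > 0"
  shows "moebius_den (A * B) z = moebius_den A (moebius_map B z) * moebius_den B z"
    and "moebius_map (A * B) z = moebius_map A (moebius_map B z)"
proof -
  have j: "moebius_den B z \<noteq> 0" using moebius_den_nonzero[OF B assms(3,4)] .
  have *: "of_int c * moebius_map B z + of_int d = (of_int (c * B $$ (0, 0) + d * B $$ (1, 0)) * z
      + of_int (c * B $$ (0, 1) + d * B $$ (1, 1))) / moebius_den B z" for c d :: int
    using j by (simp add: moebius_map_def divide_simps) (simp add: moebius_den_def algebra_simps)
  show 1: "moebius_den (A * B) z = moebius_den A (moebius_map B z) * moebius_den B z"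
    using j by (simp add: moebius_den_def[of A] moebius_den_def[of "A * B"] * mult_mat_2_2[OF A B] del: index_mult_mat(1) One_nat_def)
  show "moebius_map (A * B) z = moebius_map A (moebius_map B z)"
    unfolding moebius_map_def[of A] moebius_map_def[of "A * B"] 1
    using j by (simp add: * mult_mat_2_2[OF A B] del: index_mult_mat(1) One_nat_def)
qed

section \<open>Slash and Hecke operators in genus 1 and weight 12\<close>

definition siegel_lift :: "(complex \<Rightarrow> complex) \<Rightarrow> complex mat \<Rightarrow> complex" where
  "siegel_lift F Z = F (Z $$ (0, 0))"

lemma cusp_form_moebius:
  assumes "elliptic_cusp_form l F" "P \<in> carrier_mat 2 2" "det P = 1" "Im z > 0"
  shows "F (moebius_map P z) = moebius_den P z ^ (2 * l) * F z"
  unfolding moebius_map_def moebius_den_def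
  using assms by (intro elliptic_cusp_form_transform) (simp_all add: det_mat_2_2)

definition slash12 :: "int mat \<Rightarrow> (complex \<Rightarrow> complex) \<Rightarrow> complex \<Rightarrow> complex" where
  "slash12 N F z = of_int (det N) ^ 6 * F (moebius_map N z) / moebius_den N z ^ 12"

lemma slash_siegel_lift:
  assumes "N \<in> carrier_mat 2 2" "det N > 0" "Z \<in> siegel_space 1"
  shows "slash 1 12 N (siegel_lift F) Z = slash12 N F (Z $$ (0, 0))"
proof -
  have Z: "Z \<in> carrier_mat 1 1" using assms(3) unfolding siegel_space_1 by auto
  have "det (moebius_denom 1 N Z) = moebius_den N (Z $$ (0, 0))"
    using moebius_denom_1[OF assms(1) Z] det_single by metis
  moreover have "moebius 1 N Z $$ (0, 0) = moebius_map N (Z $$ (0, 0))"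
    using moebius_1[of N Z] assms by simp
  moreover have "((12::int) div 2) = 6" by simp
  ultimately show ?thesis
    by (simp add: slash_def slash12_def siegel_lift_def power_int_minus divide_inverse)
qed

lemma slash12_mult:
  assumes A: "A \<in> carrier_mat 2 2" and B: "B \<in> carrier_mat 2 2" and "det B > 0" "Im z > 0"
  shows "slash12 (A * B) F z = of_int (det B) ^ 6 * slash12 A F (moebius_map B z) / moebius_den B z ^ 12"
  using assms by (simp add: slash12_def moebius_map_mult det_mult[OF A B] power_mult_distrib)

lemma slash12_left_invariant:
  assumes F: "elliptic_cusp_form 6 F" and P: "P \<in> Sp 1" and N: "N \<in> carrier_mat 2 2" "det N > 0" and z: "Im z > 0"
  shows "slash12 (P * N) F z = slash12 N F z"
proof -
  have P': "P \<in> carrier_mat 2 2" "det P = 1" using P unfolding Sp_1 by auto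
  have w: "Im (moebius_map N z) > 0" by (rule Im_moebius_map_pos[OF N z])
  then have "slash12 P F (moebius_map N z) = F (moebius_map N z)"
    using cusp_form_moebius[OF F P' w] moebius_den_nonzero[OF P'(1) _ w] P'(2) by (simp add: slash12_def)
  then show ?thesis by (simp add: slash12_mult[OF P'(1) N z]) (simp add: slash12_def)
qed

lemma slash12_right:
  assumes "G \<in> carrier_mat 2 2" "det G = 1" and N: "N \<in> carrier_mat 2 2" and z: "Im z > 0"
  shows "slash12 N F (moebius_map G z) = moebius_den G z ^ 12 * slash12 (N * G) F z"
  using moebius_den_nonzero[OF assms(1) _ z] assms by (simp add: slash12_mult)

text \<open>With the normalisation det^(k/2) the Petersson norm of F|N at z equals that of F at Nz,
  so the constant C passes over unchanged.\<close>

lemma slash12_bound: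
  assumes N: "N \<in> carrier_mat 2 2" "det N > 0" and z: "Im z > 0"
    and C: "\<And>z. Im z > 0 \<Longrightarrow> norm (F z) * Im z ^ 6 \<le> C"
  shows "norm (slash12 N F z) * Im z ^ 6 \<le> C"
proof -
  let ?j = "moebius_den N z"
  have "norm (slash12 N F z) * Im z ^ 6 = norm (F (moebius_map N z)) * (of_int (det N) * Im z / norm ?j ^ 2) ^ 6"
    using N by (simp add: slash12_def norm_mult norm_divide norm_power power_divide power_mult_distrib)
  also have "\<dots> \<le> C"
    using C[OF Im_moebius_map_pos[OF N z]] by (simp add: Im_moebius_map[OF N(1)])
  finally show ?thesis .
qed

lemma holomorphic_slash12:
  assumes F: "F holomorphic_on {z. Im z > 0}" and N: "N \<in> carrier_mat 2 2" "det N > 0"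
  shows "slash12 N F holomorphic_on {z. Im z > 0}"
proof -
  have j: "moebius_den N z \<noteq> 0" if "Im z > 0" for z using moebius_den_nonzero[OF N(1) _ that] N(2) by simp
  have hj: "moebius_den N holomorphic_on {z. Im z > 0}"
    unfolding moebius_den_def[abs_def] by (intro holomorphic_intros)
  have hm: "moebius_map N holomorphic_on {z. Im z > 0}"
    unfolding moebius_map_def[abs_def] using j by (intro holomorphic_intros hj) auto
  have "F \<circ> moebius_map N holomorphic_on {z. Im z > 0}"
    by (rule holomorphic_on_compose_gen[OF hm F]) (use Im_moebius_map_pos[OF N] in auto)
  then have "(\<lambda>z. F (moebius_map N z)) holomorphic_on {z. Im z > 0}" by (simp add: o_def)
  then show ?thesis
    unfolding slash12_def[abs_def] using j by (intro holomorphic_intros hj) auto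
qed

lemma siegel_holomorphic_lift:
  assumes "F holomorphic_on {z. Im z > 0}"
  shows "siegel_holomorphic 1 (siegel_lift F)"
  unfolding siegel_holomorphic_def
proof (intro ballI)
  fix Z assume Z: "Z \<in> siegel_space 1"
  define z where "z = Z $$ (0, 0)"
  have Z': "Z \<in> carrier_mat 1 1" "Im z > 0" using Z unfolding siegel_space_1 z_def by auto
  have "(F has_field_derivative deriv F z) (at z)"
    using assms Z' by (intro holomorphic_derivI[OF _ open_halfspace_Im_gt]) auto
  then have der: "(F has_derivative (\<lambda>h. deriv F z * h)) (at z)" by (simp add: has_field_derivative_def)
  let ?L = "mat 1 1 (\<lambda>_. deriv F z)"
  have "\<exists>\<delta>>0. \<forall>Z'\<in>siegel_space 1. entry_norm (Z' - Z) < \<delta> \<longrightarrow>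
      cmod (siegel_lift F Z' - siegel_lift F Z - mat_tr (?L * (Z' - Z))) \<le> \<epsilon> * entry_norm (Z' - Z)"
    if "\<epsilon> > 0" for \<epsilon>
  proof -
    have "\<exists>\<delta>>0. \<forall>w. norm (w - z) < \<delta> \<longrightarrow> norm (F w - F z - deriv F z * (w - z)) \<le> \<epsilon> * norm (w - z)"
      using der that unfolding has_derivative_at_alt by simp
    then obtain \<delta> where \<delta>: "\<delta> > 0" "\<And>w. norm (w - z) < \<delta> \<Longrightarrow>
        norm (F w - F z - deriv F z * (w - z)) \<le> \<epsilon> * norm (w - z)"
      by metis
    show ?thesis
    proof (intro exI[of _ \<delta>] conjI ballI impI)
      fix W assume W: "W \<in> siegel_space 1" and n: "entry_norm (W - Z) < \<delta>"
      have W': "W \<in> carrier_mat 1 1" using W unfolding siegel_space_1 by auto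
      have "entry_norm (W - Z) = norm (W $$ (0, 0) - z)"
        using W' Z' by (simp add: entry_norm_def z_def)
      moreover have "mat_tr (?L * (W - Z)) = deriv F z * (W $$ (0, 0) - z)"
        using W' Z' by (simp add: mat_tr_def z_def scalar_prod_def)
      ultimately show "cmod (siegel_lift F W - siegel_lift F Z - mat_tr (?L * (W - Z))) \<le> \<epsilon> * entry_norm (W - Z)"
        using \<delta>(2)[of "W $$ (0, 0)"] n by (simp add: siegel_lift_def z_def)
    qed (rule \<delta>)
  qed
  then show "\<exists>L\<in>carrier_mat 1 1. \<forall>\<epsilon>>0. \<exists>\<delta>>0. \<forall>Z'\<in>siegel_space 1. entry_norm (Z' - Z) < \<delta> \<longrightarrow>
      cmod (siegel_lift F Z' - siegel_lift F Z - mat_tr (L * (Z' - Z))) \<le> \<epsilon> * entry_norm (Z' - Z)"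
    by (intro bexI[of _ ?L]) auto
qed

lemma smult_one_mat: "(1 :: 'a::semiring_1) \<cdot>\<^sub>m A = A"
  by (intro eq_matI) auto

context
  notes One_nat_def [simp del]
begin

text \<open>A coset is an orbit under left multiplication by \<open>Sp 1\<close>, so it is recovered
  from any of its elements, in particular from the one that the choice operator picks. Both factors
  of a double coset have determinant 1, hence det N = det M > 0.\<close>

lemma right_cosets_props:
  assumes M: "M \<in> GSp_pos 1" and c: "c \<in> right_cosets 1 M"
  defines "N \<equiv> SOME N. N \<in> c"
  shows "N \<in> carrier_mat 2 2" "det N > 0" "c = {P * N | P. P \<in> Sp 1}"
    and "N' \<in> c \<Longrightarrow> \<exists>P\<in>Sp 1. N' = P * N"
proof -
  note M = GSp_pos_1[OF M]
  have one: "1\<^sub>m 2 \<in> Sp 1" by (simp add: Sp_1)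
  have mult: "A * B \<in> Sp 1" if "A \<in> Sp 1" "B \<in> Sp 1" for A B
    using that by (auto simp: Sp_1 det_mult)
  obtain N0 where N0: "N0 \<in> double_coset 1 M" "c = {P * N0 | P. P \<in> Sp 1}"
    using c by (auto simp: right_cosets_def)
  obtain P Q where PQ: "P \<in> Sp 1" "Q \<in> Sp 1" "N0 = P * M * Q" using N0(1) by (auto simp: double_coset_def)
  have N0c: "N0 \<in> carrier_mat 2 2" "det N0 = det M"
    using PQ M by (auto simp: Sp_1 det_mult)
  have "1\<^sub>m 2 * N0 \<in> c" using one by (auto simp: N0(2) simp del: left_mult_one_mat')
  then have "N \<in> c" unfolding N_def by (rule someI)
  then obtain R where R: "R \<in> Sp 1" "N = R * N0" by (auto simp: N0(2))
  show N: "N \<in> carrier_mat 2 2" "det N > 0"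
    using R N0c M by (auto simp: Sp_1 det_mult)
  \<comment> \<open>The adjugate is an integral inverse because the determinant is 1.\<close>
  obtain S where S: "S \<in> Sp 1" "S * R = 1\<^sub>m 2"
  proof -
    have R': "R \<in> carrier_mat 2 2" "det R = 1" using R(1) by (auto simp: Sp_1)
    then have "adj_mat R * R = 1\<^sub>m 2" using adj_mat(3)[OF R'(1)] by (simp add: smult_one_mat)
    moreover have "adj_mat R \<in> carrier_mat 2 2" using adj_mat(1)[OF R'(1)] .
    moreover from this have "det (adj_mat R) * det R = det (1\<^sub>m 2 :: int mat)"
      using calculation(1) det_mult[OF _ R'(1)] by metis
    ultimately show thesis using R'(2) by (intro that[of "adj_mat R"]) (auto simp: Sp_1)
  qed
  have "S * N = N0"
  proof -
    have "S * N = S * R * N0"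
      unfolding R(2) using R(1) S(1) N0c by (intro assoc_mult_mat[symmetric]) (auto simp: Sp_1)
    then show ?thesis using S N0c by simp
  qed
  have sub: "\<exists>P\<in>Sp 1. N' = P * N" if N': "N' \<in> c" for N'
  proof -
    obtain T where T: "T \<in> Sp 1" "N' = T * N0" using N' by (auto simp: N0(2))
    then have "N' = T * S * N" using \<open>S * N = N0\<close> S N
      by (auto simp: Sp_1 assoc_mult_mat[of _ 2 2 _ 2 _ 2])
    then show ?thesis using mult[OF T(1) S(1)] by blast
  qed
  then show "N' \<in> c \<Longrightarrow> \<exists>P\<in>Sp 1. N' = P * N" .
  have "P * N \<in> c" if "P \<in> Sp 1" for P
  proof -
    have "P * N = P * R * N0" using that R N0c by (auto simp: Sp_1 assoc_mult_mat[of _ 2 2 _ 2 _ 2])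
    then show ?thesis using mult[OF that R(1)] by (auto simp: N0(2))
  qed
  with sub show "c = {P * N | P. P \<in> Sp 1}" by blast
qed

text \<open>The factor \<open>G\<close> is absorbed into the right factor \<open>Q\<close> of the
  double coset representative.\<close>

lemma right_cosets_translate:
  assumes G: "G \<in> Sp 1" and M: "M \<in> GSp_pos 1" and c: "c \<in> right_cosets 1 M"
  shows "(\<lambda>N. N * G) ` c \<in> right_cosets 1 M"
proof -
  note M = GSp_pos_1[OF M]
  obtain P Q where PQ: "P \<in> Sp 1" "Q \<in> Sp 1" "c = {R * (P * M * Q) | R. R \<in> Sp 1}"
    using c by (auto simp: right_cosets_def double_coset_def)
  have carr: "P \<in> carrier_mat 2 2" "Q \<in> carrier_mat 2 2" "G \<in> carrier_mat 2 2" using PQ G by (auto simp: Sp_1)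
  have QG: "Q * G \<in> Sp 1" using PQ G by (auto simp: Sp_1 det_mult)
  have "R * (P * M * Q) * G = R * (P * M * (Q * G))" if "R \<in> Sp 1" for R
    using that carr M by (auto simp: Sp_1 assoc_mult_mat[of _ 2 2 _ 2 _ 2])
  then have "(\<lambda>N. N * G) ` c = {R * (P * M * (Q * G)) | R. R \<in> Sp 1}"
    unfolding PQ(3) by (auto simp: image_def)
  moreover have "P * M * (Q * G) \<in> double_coset 1 M"
    unfolding double_coset_def using PQ(1) QG by blast
  ultimately show ?thesis unfolding right_cosets_def by blast
qed

lemma right_cosets_carrier:
  assumes M: "M \<in> GSp_pos 1" and c: "c \<in> right_cosets 1 M" "N \<in> c"
  shows "N \<in> carrier_mat 2 2"
proof -
  obtain P where "P \<in> Sp 1" "N = P * (SOME N. N \<in> c)"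
    using right_cosets_props(4)[OF M c] by blast
  then show ?thesis using right_cosets_props(1)[OF M c(1)] by (auto simp: Sp_1 intro: mult_carrier_mat)
qed

definition hecke12 :: "int mat \<Rightarrow> (complex \<Rightarrow> complex) \<Rightarrow> complex \<Rightarrow> complex" where
  "hecke12 M F z = (\<Sum>c\<in>right_cosets 1 M. slash12 (SOME N. N \<in> c) F z)"

lemma hecke_op_siegel_lift:
  assumes "M \<in> GSp_pos 1" "Z \<in> siegel_space 1"
  shows "hecke_op 1 12 M (siegel_lift F) Z = hecke12 M F (Z $$ (0, 0))"
  unfolding hecke_op_def hecke12_def
  using right_cosets_props(1,2)[OF assms(1)] assms(2) by (intro sum.cong slash_siegel_lift) auto

text \<open>A sum over infinitely many cosets would be 0 by convention, hence a cusp form as well.\<close>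

lemma hecke12_cusp_form:
  assumes F: "elliptic_cusp_form 6 F" and M: "M \<in> GSp_pos 1"
  shows "elliptic_cusp_form 6 (hecke12 M F)"
  unfolding elliptic_cusp_form_def
proof (intro conjI allI impI)
  let ?rc = "right_cosets 1 M" and ?rep = "\<lambda>c. SOME N. N \<in> (c :: int mat set)"
  note rep = right_cosets_props[OF M]
  have holF: "F holomorphic_on {z. Im z > 0}" using F by (simp add: elliptic_cusp_form_def)
  obtain C where C: "\<And>z. Im z > 0 \<Longrightarrow> norm (F z) * Im z ^ 6 \<le> C"
    using F unfolding elliptic_cusp_form_def by blast
  show "hecke12 M F holomorphic_on {z. Im z > 0}"
    unfolding hecke12_def[abs_def]
  proof (intro holomorphic_on_sum)
    fix c assume "c \<in> ?rc"
    from holomorphic_slash12[OF holF rep(1,2)[OF this]]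
    show "(\<lambda>z. slash12 (?rep c) F z) holomorphic_on {z. Im z > 0}" .
  qed
  have "norm (hecke12 M F z) * Im z ^ 6 \<le> of_nat (card ?rc) * C" if z: "Im z > 0" for z
  proof -
    have "norm (hecke12 M F z) * Im z ^ 6 \<le> (\<Sum>c\<in>?rc. norm (slash12 (?rep c) F z)) * Im z ^ 6"
      unfolding hecke12_def using z by (intro mult_right_mono norm_sum) auto
    also have "\<dots> = (\<Sum>c\<in>?rc. norm (slash12 (?rep c) F z) * Im z ^ 6)" by (rule sum_distrib_right)
    also have "\<dots> \<le> of_nat (card ?rc) * C"
      by (rule sum_bounded_above) (rule slash12_bound[OF rep(1,2) z C])
    finally show ?thesis .
  qed
  then show "\<exists>C. \<forall>z. Im z > 0 \<longrightarrow> norm (hecke12 M F z) * Im z ^ 6 \<le> C" by blast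
  fix a b c d :: int and z :: complex
  assume det: "a * d - b * c = 1" and z: "Im z > 0"
  define G where "G = mat 2 2 (\<lambda>(i, j). if i = 0 then (if j = 0 then a else b) else (if j = 0 then c else d))"
  have Gc: "G \<in> carrier_mat 2 2" by (simp add: G_def)
  have Gij: "G $$ (0, 0) = a" "G $$ (0, 1) = b" "G $$ (1, 0) = c" "G $$ (1, 1) = d"
    by (simp_all add: G_def)
  have Gdet: "det G = 1" using det by (simp add: det_mat_2_2[OF Gc] Gij del: One_nat_def)
  have G: "G \<in> Sp 1" using Gc Gdet by (simp add: Sp_1)
  define H where "H = adj_mat G"
  have Hc: "H \<in> carrier_mat 2 2" and GH: "G * H = 1\<^sub>m 2" and HG: "H * G = 1\<^sub>m 2"
    using adj_mat[OF Gc] Gdet by (simp_all add: H_def smult_one_mat)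
  have "det G * det H = 1" using det_mult[OF Gc Hc] by (simp add: GH)
  then have H: "H \<in> Sp 1" using Hc Gdet by (simp add: Sp_1)
  \<comment> \<open>Translation by \<open>G\<close> permutes the cosets, with translation by
    \<open>H\<close> as its inverse; modularity of the sum is a reindexing along
    \<open>t\<close>.\<close>
  define t where "t = (\<lambda>c. (\<lambda>N. N * G) ` c)"
  have bij: "bij_betw t ?rc ?rc"
  proof (rule bij_betw_byWitness[where f' = "\<lambda>c. (\<lambda>N. N * H) ` c"])
    show "\<forall>c\<in>?rc. (\<lambda>N. N * H) ` t c = c"
    proof
      fix c assume c: "c \<in> ?rc"
      have "N * G * H = N" if "N \<in> c" for N
        using right_cosets_carrier[OF M c that] Gc Hc GH by (simp add: assoc_mult_mat[of _ 2 2 _ 2 _ 2])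
      then show "(\<lambda>N. N * H) ` t c = c" by (auto simp: t_def image_image)
    qed
    show "\<forall>c\<in>?rc. t ((\<lambda>N. N * H) ` c) = c"
    proof
      fix c assume c: "c \<in> ?rc"
      have "N * H * G = N" if "N \<in> c" for N
        using right_cosets_carrier[OF M c that] Gc Hc HG by (simp add: assoc_mult_mat[of _ 2 2 _ 2 _ 2])
      then show "t ((\<lambda>N. N * H) ` c) = c" by (auto simp: t_def image_image)
    qed
    show "t ` ?rc \<subseteq> ?rc" "(\<lambda>c. (\<lambda>N. N * H) ` c) ` ?rc \<subseteq> ?rc"
      using right_cosets_translate[OF G M] right_cosets_translate[OF H M] by (auto simp: t_def)
  qed
  have "slash12 (?rep c) F (moebius_map G z) = moebius_den G z ^ 12 * slash12 (?rep (t c)) F z" if c: "c \<in> ?rc" for c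
  proof -
    have tc: "t c \<in> ?rc" using bij c by (auto simp: bij_betw_def)
    have one: "1\<^sub>m 2 \<in> Sp 1" by (simp add: Sp_1)
    have "?rep c = 1\<^sub>m 2 * ?rep c" using rep(1)[OF c] by simp
    with one have "?rep c \<in> {P * ?rep c | P. P \<in> Sp 1}" by blast
    then have "?rep c \<in> c" using rep(3)[OF c] by simp
    then have "?rep c * G \<in> t c" by (auto simp: t_def)
    \<comment> \<open>The chosen representatives of \<open>c\<close> and \<open>t c\<close> need not
      correspond under \<open>G\<close>, but they differ by a left factor in \<open>Sp 1\<close>, to
      which \<open>slash12\<close> is insensitive.\<close>
    then obtain P where "P \<in> Sp 1" "?rep c * G = P * ?rep (t c)" using rep(4)[OF tc] by blast
    then have "slash12 (?rep c * G) F z = slash12 (?rep (t c)) F z"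
      using slash12_left_invariant[OF F _ rep(1,2)[OF tc] z] by simp
    then show ?thesis using slash12_right[OF Gc Gdet rep(1)[OF c] z] by simp
  qed
  then have "hecke12 M F (moebius_map G z) = moebius_den G z ^ 12 * (\<Sum>c\<in>?rc. slash12 (?rep (t c)) F z)"
    unfolding hecke12_def by (simp add: sum_distrib_left)
  also have "(\<Sum>c\<in>?rc. slash12 (?rep (t c)) F z) = hecke12 M F z"
    unfolding hecke12_def by (rule sum.reindex_bij_betw[OF bij])
  finally show "hecke12 M F ((of_int a * z + of_int b) / (of_int c * z + of_int d))
      = (of_int c * z + of_int d) ^ (2 * 6) * hecke12 M F z"
    by (simp add: moebius_map_def moebius_den_def Gij del: One_nat_def)
qed

end

section \<open>Fourier coefficients in genus 1\<close>

definition scalar_mat_1 :: "nat \<Rightarrow> real mat" where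
  "scalar_mat_1 n = mat 1 1 (\<lambda>_. real n)"

lemma scalar_mat_1 [simp]: "scalar_mat_1 n \<in> carrier_mat 1 1" "scalar_mat_1 n $$ (0, 0) = real n"
  by (simp_all add: scalar_mat_1_def)

lemma inj_scalar_mat_1: "inj scalar_mat_1"
  by (metis injI of_nat_eq_iff scalar_mat_1(2))

lemma half_integral_pos_1: "half_integral_pos 1 = scalar_mat_1 ` {1..}"
proof (intro equalityI subsetI)
  fix T assume "T \<in> half_integral_pos 1"
  then have T: "T \<in> carrier_mat 1 1" "T $$ (0, 0) > 0" "T $$ (0, 0) \<in> \<int>"
    unfolding half_integral_pos_def pos_def_mat_1 by auto
  then obtain n :: int where n: "T $$ (0, 0) = of_int n" by (auto elim: Ints_cases)
  then have "n > 0" using T by simp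
  then have "T = scalar_mat_1 (nat n)"
    using T n by (intro mat_1_1_eqI) (auto simp del: One_nat_def)
  with \<open>n > 0\<close> show "T \<in> scalar_mat_1 ` {1..}" by (intro image_eqI[of _ _ "nat n"]) auto
next
  fix T assume "T \<in> scalar_mat_1 ` {1..}"
  then show "T \<in> half_integral_pos 1"
    unfolding half_integral_pos_def pos_def_mat_1
    using Ints_of_nat[where 'a = real] Ints_mult[OF Ints_numeral Ints_of_nat] by (auto simp del: One_nat_def)
qed

definition taylor_coeff :: "(complex \<Rightarrow> complex) \<Rightarrow> nat \<Rightarrow> complex" where
  "taylor_coeff P n = (deriv ^^ n) P 0 / fact n"

text \<open>The expansion is the Taylor series of \<open>P\<close> at 0. Polynomial growth of the
  coefficients upgrades its convergence to the absolute one that \<open>has_sum\<close> demands, and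
  \<open>P 0 = 0\<close> removes the index 0.\<close>

lemma cusp_form_has_sum:
  assumes F: "elliptic_cusp_form l F"
    and P: "P holomorphic_on ball 0 1" "P 0 = 0" "\<And>z. Im z > 0 \<Longrightarrow> F z = P (qexp z)" and z: "Im z > 0"
  shows "((\<lambda>n. taylor_coeff P n * qexp z ^ n) has_sum F z) {1..}"
proof -
  obtain C where C: "C \<ge> 0" "\<And>n. n \<ge> 1 \<Longrightarrow> norm (taylor_coeff P n) \<le> C * real n ^ l"
    using hecke_bound[OF F P(1,3)] unfolding taylor_coeff_def by metis
  let ?q = "qexp z"
  have q: "norm ?q < 1" using z by (rule norm_qexp_less_1)
  have c0: "taylor_coeff P 0 = 0" by (simp add: taylor_coeff_def P)
  have "(\<lambda>n. taylor_coeff P n * ?q ^ n) sums P ?q"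
    using holomorphic_power_series[OF P(1), of ?q] q by (simp add: taylor_coeff_def)
  moreover have "summable (\<lambda>n. norm (taylor_coeff P n * ?q ^ n))"
  proof (rule summable_comparison_test')
    show "summable (\<lambda>n. C * (real n ^ l * norm ?q ^ n))"
      using summable_power_series_pow[of "norm ?q" l] q by (intro summable_mult) auto
    show "norm (norm (taylor_coeff P n * ?q ^ n)) \<le> C * (real n ^ l * norm ?q ^ n)" if "n \<ge> 1" for n
      using C(2)[OF that] by (simp add: norm_mult norm_power mult.assoc[symmetric] mult_right_mono)
  qed
  ultimately have "((\<lambda>n. taylor_coeff P n * ?q ^ n) has_sum P ?q) UNIV"
    by (intro norm_summable_imp_has_sum)
  then show ?thesis
    using P(3)[OF z] c0
    by (subst has_sum_cong_neutral[where T = UNIV and g = "\<lambda>n. taylor_coeff P n * ?q ^ n"]) (auto simp: not_le)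
qed

text \<open>The value 0 off the half-integral matrices is prescribed by
  \<open>has_fourier_coeffs\<close>; it makes the coefficient function unique as a function on all
  matrices.\<close>

definition fourier_coeff_1 :: "(complex \<Rightarrow> complex) \<Rightarrow> real mat \<Rightarrow> complex" where
  "fourier_coeff_1 P T = (if T \<in> half_integral_pos 1 then taylor_coeff P (nat \<lfloor>T $$ (0, 0)\<rfloor>) else 0)"

lemma fourier_coeff_1_scalar: "n \<ge> 1 \<Longrightarrow> fourier_coeff_1 P (scalar_mat_1 n) = taylor_coeff P n"
  by (simp add: fourier_coeff_1_def half_integral_pos_1 del: One_nat_def)

lemma fourier_term_1:
  assumes "Z \<in> carrier_mat 1 1"
  shows "exp (2 * of_real pi * \<i> * mat_tr (map_mat of_real (scalar_mat_1 n) * Z)) = qexp (Z $$ (0, 0)) ^ n"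
proof -
  have "mat_tr (map_mat of_real (scalar_mat_1 n) * Z) = of_nat n * Z $$ (0, 0)"
    using assms by (simp add: mat_tr_def scalar_mat_1_def scalar_prod_def)
  then show ?thesis by (simp only: qexp_of_nat_mult[symmetric]) (simp only: qexp_def)
qed

lemma has_sum_half_integral_pos_1:
  assumes "Z \<in> carrier_mat 1 1"
  shows "((\<lambda>T. a T * exp (2 * of_real pi * \<i> * mat_tr (map_mat of_real T * Z))) has_sum s) (half_integral_pos 1)
    \<longleftrightarrow> ((\<lambda>n. a (scalar_mat_1 n) * qexp (Z $$ (0, 0)) ^ n) has_sum s) {1..}"
  unfolding half_integral_pos_1
  by (subst has_sum_reindex[OF inj_on_subset[OF inj_scalar_mat_1]]) (simp_all add: o_def fourier_term_1[OF assms])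

lemma power_series_coeffs_unique:
  fixes a b :: "nat \<Rightarrow> complex"
  assumes "\<And>q. 0 < norm q \<Longrightarrow> norm q < 1 \<Longrightarrow> ((\<lambda>n. a n * q ^ n) has_sum f q) {1..}"
    and "\<And>q. 0 < norm q \<Longrightarrow> norm q < 1 \<Longrightarrow> ((\<lambda>n. b n * q ^ n) has_sum f q) {1..}"
    and "n \<ge> 1"
  shows "a n = b n"
proof (rule ccontr)
  assume ne: "a n \<noteq> b n"
  define c where "c n = (if n = 0 then 0 else a n - b n)" for n
  have "(\<lambda>n. c n * (q - 0) ^ n) sums 0" if "norm (q - 0) < 1" for q
  proof (cases "q = 0")
    case True
    then show ?thesis by (simp add: c_def)
  next
    case False
    have "((\<lambda>n. a n * q ^ n + - (b n * q ^ n)) has_sum (f q + - f q)) {1..}"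
      using False that by (intro has_sum_add has_sum_uminusI assms) auto
    then have "((\<lambda>n. c n * q ^ n) has_sum 0) UNIV"
      by (subst (asm) has_sum_cong_neutral[where T = UNIV and g = "\<lambda>n. c n * q ^ n"])
         (auto simp: c_def algebra_simps not_le)
    then show ?thesis using has_sum_imp_sums by fastforce
  qed
  \<comment> \<open>A nonzero coefficient would make the sum nonzero in a punctured disc about 0,
    but the sum is the zero function.\<close>
  then obtain s where "0 < s" "\<And>z :: complex. z \<in> cball 0 s - {0} \<Longrightarrow> (0 :: complex) \<noteq> 0"
    using powser_0_nonzero[of 1 0 c "\<lambda>_. 0" n] ne assms(3) by (auto simp: c_def)
  from this(2)[of "of_real s"] this(1) show False by simp
qed

lemma has_fourier_coeffs_lift:
  assumes F: "elliptic_cusp_form l F"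
    and P: "P holomorphic_on ball 0 1" "P 0 = 0" "\<And>z. Im z > 0 \<Longrightarrow> F z = P (qexp z)"
  shows "has_fourier_coeffs 1 (siegel_lift F) (fourier_coeff_1 P)"
  unfolding has_fourier_coeffs_def
proof (intro conjI allI impI ballI)
  fix Z assume "Z \<in> siegel_space 1"
  then have Z: "Z \<in> carrier_mat 1 1" "Im (Z $$ (0, 0)) > 0" unfolding siegel_space_1 by auto
  show "((\<lambda>T. fourier_coeff_1 P T * exp (2 * of_real pi * \<i> * mat_tr (map_mat of_real T * Z)))
      has_sum siegel_lift F Z) (half_integral_pos 1)"
    unfolding has_sum_half_integral_pos_1[OF Z(1)] siegel_lift_def
    using cusp_form_has_sum[OF F P Z(2)] by (subst has_sum_cong) (auto simp: fourier_coeff_1_scalar)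
qed (simp add: fourier_coeff_1_def)

text \<open>Every q with 0 < |q| < 1 is \<open>qexp z\<close> for some z in the upper half-plane, so
  a Fourier expansion is a power series on the whole punctured disc and its coefficients are
  determined.\<close>

lemma fourier_coeff_lift:
  assumes F: "elliptic_cusp_form l F"
    and P: "P holomorphic_on ball 0 1" "P 0 = 0" "\<And>z. Im z > 0 \<Longrightarrow> F z = P (qexp z)"
  shows "fourier_coeff 1 (siegel_lift F) = fourier_coeff_1 P"
  unfolding fourier_coeff_def
proof (rule the_equality)
  show has: "has_fourier_coeffs 1 (siegel_lift F) (fourier_coeff_1 P)"
    by (rule has_fourier_coeffs_lift[OF F P])
  fix b assume b: "has_fourier_coeffs 1 (siegel_lift F) b"
  have *: "((\<lambda>n. a (scalar_mat_1 n) * q ^ n) has_sum P q) {1..}"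
    if a: "has_fourier_coeffs 1 (siegel_lift F) a" and q: "0 < norm q" "norm q < 1" for a q
  proof -
    obtain z where z: "qexp z = q" "Im z = - ln (norm q) / (2 * pi)" using qexp_surj q by auto
    have im: "Im z > 0" using z q by (simp add: divide_neg_pos)
    let ?Z = "mat 1 1 (\<lambda>_. z)"
    have Z: "?Z \<in> siegel_space 1" "?Z \<in> carrier_mat 1 1" "?Z $$ (0, 0) = z"
      using im unfolding siegel_space_1 by auto
    have "((\<lambda>T. a T * exp (2 * of_real pi * \<i> * mat_tr (map_mat of_real T * ?Z))) has_sum siegel_lift F ?Z) (half_integral_pos 1)"
      using a Z(1) unfolding has_fourier_coeffs_def by blast
    then show ?thesis
      unfolding has_sum_half_integral_pos_1[OF Z(2)] siegel_lift_def Z(3) using P(3)[OF im] z(1) by simp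
  qed
  have "b (scalar_mat_1 n) = fourier_coeff_1 P (scalar_mat_1 n)" if "n \<ge> 1" for n
    by (rule power_series_coeffs_unique[OF *[OF b] *[OF has] that])
  moreover have "b T = 0" "fourier_coeff_1 P T = 0" if "T \<notin> half_integral_pos 1" for T
    using b that by (auto simp: has_fourier_coeffs_def fourier_coeff_1_def)
  ultimately have "b T = fourier_coeff_1 P T" for T
    unfolding half_integral_pos_1 by (cases "T \<in> scalar_mat_1 ` {1..}") auto
  then show "b = fourier_coeff_1 P" by blast
qed

lemma siegel_cusp_form_lift:
  assumes F: "elliptic_cusp_form l F" and "l > 0"
  shows "siegel_cusp_form 1 (2 * int l) (siegel_lift F)"
proof -
  obtain P where P: "P holomorphic_on ball 0 1" "P 0 = 0" "\<And>z. Im z > 0 \<Longrightarrow> F z = P (qexp z)"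
    using elliptic_cusp_form_qexp[OF F \<open>l > 0\<close>] by metis
  have "siegel_lift F (moebius 1 M Z) = det (moebius_denom 1 M Z) powi (2 * int l) * siegel_lift F Z"
    if M: "M \<in> Sp 1" and Z: "Z \<in> siegel_space 1" for M Z
  proof -
    have M': "M \<in> carrier_mat 2 2" "det M = 1" using M unfolding Sp_1 by auto
    have Z': "Z \<in> carrier_mat 1 1" "Im (Z $$ (0, 0)) > 0" using Z unfolding siegel_space_1 by auto
    have "det (moebius_denom 1 M Z) = moebius_den M (Z $$ (0, 0))"
      using moebius_denom_1[OF M'(1) Z'(1)] det_single by metis
    moreover have "2 * int l = int (2 * l)" by simp
    ultimately show ?thesis
      using moebius_1(2)[OF M'(1) _ Z] cusp_form_moebius[OF F M' Z'(2)] M'(2)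
      by (simp only: siegel_lift_def power_int_of_nat)
  qed
  moreover have "siegel_holomorphic 1 (siegel_lift F)"
    using F by (intro siegel_holomorphic_lift) (simp add: elliptic_cusp_form_def)
  ultimately show ?thesis
    unfolding siegel_cusp_form_def using has_fourier_coeffs_lift[OF F P] by blast
qed

lemma hecke_eigen_cusp_form_delta: "hecke_eigen_cusp_form 1 12 (siegel_lift delta)"
  unfolding hecke_eigen_cusp_form_def
proof (intro conjI ballI)
  show "siegel_cusp_form 1 12 (siegel_lift delta)"
    using siegel_cusp_form_lift[OF elliptic_cusp_form_delta] by simp
  obtain r where r: "r > 0" "delta (\<i> * of_real 1) = of_real r" using delta_pos[of 1] by auto
  then have nz: "delta \<i> \<noteq> 0" by simp
  have "mat 1 1 (\<lambda>_. \<i>) \<in> siegel_space 1" unfolding siegel_space_1 by simp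
  moreover have "siegel_lift delta (mat 1 1 (\<lambda>_. \<i>)) \<noteq> 0" using nz by (simp add: siegel_lift_def)
  ultimately show "\<exists>Z\<in>siegel_space 1. siegel_lift delta Z \<noteq> 0" by blast
  fix M assume M: "M \<in> GSp_pos 1"
  have "\<exists>c. \<forall>z. Im z > 0 \<longrightarrow> hecke12 M delta z = c * delta z"
    by (rule cusp_form_12_unique[OF hecke12_cusp_form[OF elliptic_cusp_form_delta M] elliptic_cusp_form_delta _ nz]) auto
  then obtain c where c: "\<And>z. Im z > 0 \<Longrightarrow> hecke12 M delta z = c * delta z" by metis
  show "\<exists>c. \<forall>Z\<in>siegel_space 1. hecke_op 1 12 M (siegel_lift delta) Z = c * siegel_lift delta Z"
  proof (intro exI[of _ c] ballI)
    fix Z assume Z: "Z \<in> siegel_space 1"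
    then have "Im (Z $$ (0, 0)) > 0" unfolding siegel_space_1 by blast
    from c[OF this] show "hecke_op 1 12 M (siegel_lift delta) Z = c * siegel_lift delta Z"
      by (simp only: hecke_op_siegel_lift[OF M Z]) (simp only: siegel_lift_def)
  qed
qed

section \<open>The Mellin transform of the discriminant\<close>

text \<open>Euler's integral for Gamma under the substitution x = c exp t, which moves it to the
  whole real line.\<close>

lemma mellin_exp:
  assumes "c > 0" "Re s > 0"
  shows "integrable lborel (\<lambda>t. exp (- of_real (c * exp t)) * exp (of_real t * s))"
    and "(LINT t|lborel. exp (- of_real (c * exp t)) * exp (of_real t * s)) = Gamma s * exp (- s * of_real (ln c))"
proof -
  let ?f = "\<lambda>x. complex_of_real x powr (s - 1) / of_real (exp x)"
  let ?g = "\<lambda>t. c * exp t"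
  let ?h = "\<lambda>t. exp (- of_real (c * exp t)) * exp (of_real t * s)"
  have img: "range ?g = {0<..}"
  proof safe
    fix x :: real assume "x > 0"
    then have "x = ?g (ln (x / c))" using assms by simp
    then show "x \<in> range ?g" by blast
  qed (use assms in auto)
  have subst: "\<bar>c * exp t\<bar> *\<^sub>R ?f (?g t) = exp (s * of_real (ln c)) * ?h t" for t
  proof -
    have pos: "c * exp t > 0" using assms by simp
    have ln: "Ln (of_real (c * exp t)) = of_real (ln c + t)"
      using pos assms by (simp add: Ln_of_real ln_mult del: of_real_mult of_real_add)
    have "complex_of_real (c * exp t) = exp (of_real (ln c + t))"
      unfolding exp_of_real[of "ln c + t"] using assms by (simp add: exp_add del: of_real_mult of_real_add)
    then have "\<bar>c * exp t\<bar> *\<^sub>R ?f (?g t) = exp (of_real (ln c + t)) * exp ((s - 1) * of_real (ln c + t)) / of_real (exp (c * exp t))"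
      using pos by (simp add: scaleR_conv_of_real powr_def ln del: of_real_mult of_real_add of_real_exp)
    also have "exp (of_real (ln c + t)) * exp ((s - 1) * of_real (ln c + t)) = exp (s * of_real (ln c)) * exp (of_real t * s)"
      by (simp add: exp_add[symmetric] algebra_simps)
    also have "exp (s * of_real (ln c)) * exp (of_real t * s) / of_real (exp (c * exp t)) = exp (s * of_real (ln c)) * ?h t"
      by (simp only: exp_of_real[of "c * exp t", symmetric] exp_minus divide_inverse mult_ac)
    finally show ?thesis .
  qed
  have "?f absolutely_integrable_on {0<..} \<and> integral {0<..} ?f = Gamma s"
    using absolutely_integrable_Gamma_integral'[OF assms(2)] Gamma_integral_complex'[OF assms(2)]
    by (simp add: integral_unique)
  moreover have "UNIV \<in> sets (lebesgue :: real measure)" by simp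
  moreover have "(?g has_field_derivative ?g t) (at t within UNIV)" for t
    by (auto intro!: derivative_eq_intros)
  moreover have "inj_on ?g UNIV" using assms by (auto simp: inj_on_def)
  ultimately have "(\<lambda>t. \<bar>?g t\<bar> *\<^sub>R ?f (?g t)) absolutely_integrable_on UNIV \<and>
      integral UNIV (\<lambda>t. \<bar>?g t\<bar> *\<^sub>R ?f (?g t)) = Gamma s"
    using has_absolute_integral_change_of_variables_real[of UNIV ?g ?g ?f "Gamma s", unfolded img] by blast
  then have abs: "(\<lambda>t. exp (s * of_real (ln c)) * ?h t) absolutely_integrable_on UNIV"
    and val: "integral UNIV (\<lambda>t. exp (s * of_real (ln c)) * ?h t) = Gamma s"
    unfolding subst by blast+
  \<comment> \<open>Borel measurability permits the passage from the completed Lebesgue measure,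
    where the substitution rule lives, to \<open>lborel\<close>.\<close>
  have "continuous_on UNIV ?h" by (intro continuous_intros)
  then have meas: "?h \<in> borel_measurable borel" by (rule borel_measurable_continuous_onI)
  then have meas': "(\<lambda>t. exp (s * of_real (ln c)) * ?h t) \<in> borel_measurable lborel" by measurable
  have "integrable lborel (\<lambda>t. exp (s * of_real (ln c)) * ?h t)"
    using abs integrable_completion[OF meas'] by (simp add: set_integrable_def)
  then have "integrable lborel (\<lambda>t. inverse (exp (s * of_real (ln c))) * (exp (s * of_real (ln c)) * ?h t))"
    by (rule integrable_mult_right)
  moreover have "inverse (exp (s * of_real (ln c))) * (exp (s * of_real (ln c)) * x) = x" for x by simp
  ultimately show int: "integrable lborel ?h" by (simp only:)
  have "(LINT t|lborel. exp (s * of_real (ln c)) * ?h t) = Gamma s"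
    using set_lebesgue_integral_eq_integral(2)[OF abs] val integral_completion[OF meas']
    by (simp add: set_lebesgue_integral_def)
  then have "exp (s * of_real (ln c)) * (LINT t|lborel. ?h t) = Gamma s" by simp
  then show "(LINT t|lborel. ?h t) = Gamma s * exp (- s * of_real (ln c))"
    by (simp add: exp_minus divide_simps mult.commute)
qed

section \<open>The even kernel and its two-sided Laplace transform\<close>

lemma integrable_reflect:
  fixes f :: "real \<Rightarrow> 'a::{banach, second_countable_topology}"
  assumes "integrable lborel f"
  shows "integrable lborel (\<lambda>t. f (- t))"
  using lborel_integrable_real_affine[OF assms, of "-1" 0] by simp

lemma integral_reflect:
  fixes f :: "real \<Rightarrow> 'a::{banach, second_countable_topology}"
  shows "(LINT t|lborel. f (- t)) = (LINT t|lborel. f t)"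
  using lborel_integral_real_affine[of "-1" f 0] by simp

text \<open>The Mellin integral at c = s = 1. Together with its reflection it dominates the kernel
  on the whole line.\<close>

lemma integrable_double_exp: "integrable lborel (\<lambda>t::real. exp (- exp t) * exp t)"
proof -
  have "integrable lborel (\<lambda>t. norm (exp (- complex_of_real (1 * exp t)) * exp (of_real t * 1)))"
    by (rule integrable_norm[OF mellin_exp(1)]) auto
  then show ?thesis by (simp add: norm_mult)
qed

text \<open>The factor \<open>exp (6 * t)\<close> turns the modular transformation under \<open>z \<mapsto> - 1 / z\<close> into evenness.\<close>

definition delta_kernel :: "real \<Rightarrow> complex" where
  "delta_kernel t = delta (\<i> * of_real (exp t)) * of_real (exp (6 * t))"

lemma delta_kernel_even: "delta_kernel (- t) = delta_kernel t"
proof -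
  have "of_int (-1) / (\<i> * of_real (exp t)) = \<i> * of_real (exp (- t))"
    by (simp add: divide_simps exp_minus)
  then have "delta (\<i> * of_real (exp (- t))) = (\<i> * of_real (exp t)) ^ 12 * delta (\<i> * of_real (exp t))"
    using delta_modular[of 0 0 "-1" 1 "\<i> * of_real (exp t)"] by simp
  also have "(\<i> * of_real (exp t)) ^ 12 = complex_of_real (exp (12 * t))"
    by (simp add: power_mult_distrib exp_of_nat_mult[symmetric] of_real_power[symmetric] del: of_real_power)
  finally have "delta_kernel (- t) = complex_of_real (exp (12 * t) * exp (- 6 * t)) * delta (\<i> * of_real (exp t))"
    by (simp add: delta_kernel_def)
  also have "exp (12 * t) * exp (- 6 * t) = exp (6 * t)" by (simp add: exp_add[symmetric])
  finally show ?thesis by (simp add: delta_kernel_def)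
qed

lemma delta_kernel_pos: "\<exists>r>0. delta_kernel t = of_real r"
proof -
  obtain r where "r > 0" "delta (\<i> * of_real (exp t)) = of_real r"
    using delta_pos[of "exp t"] by auto
  then show ?thesis by (intro exI[of _ "r * exp (6 * t)"]) (simp add: delta_kernel_def)
qed

lemma continuous_on_delta_kernel: "continuous_on UNIV delta_kernel"
proof -
  have "continuous_on {z. Im z > 0} delta"
    using elliptic_cusp_form_delta by (auto simp: elliptic_cusp_form_def intro: holomorphic_on_imp_continuous_on)
  then have "continuous_on UNIV (\<lambda>t. delta (\<i> * of_real (exp t)))"
    by (rule continuous_on_compose2) (auto intro!: continuous_intros)
  then show ?thesis unfolding delta_kernel_def[abs_def] by (intro continuous_intros)
qed

lemma measurable_delta_kernel [measurable]: "delta_kernel \<in> borel_measurable borel"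
  using continuous_on_delta_kernel by (rule borel_measurable_continuous_onI)

text \<open>For t \<ge> 0 the point i exp t has imaginary part at least 1, where the decay at the
  cusp applies; negative t are reached by evenness. A natural number \<open>R\<close> turns the
  exponential weight into a power of exp t.\<close>

lemma delta_kernel_decay:
  obtains C where "C \<ge> 0"
    "\<And>t. norm (delta_kernel t) * exp (real R * \<bar>t\<bar>) \<le> C * (exp (- exp t) * exp t + exp (- exp (- t)) * exp (- t))"
proof -
  obtain B where B: "B > 0" "\<And>z. Im z \<ge> 1 \<Longrightarrow> norm (delta_q (qexp z)) \<le> B * exp (- 2 * pi * Im z)"
    using qexp_decay[OF holomorphic_on_delta_q delta_q_0, of 1] by auto
  \<comment> \<open>Of the R + 6 factors exp t one is kept for the integrable majorant; the other R
    + 5 are absorbed by (R + 5)! exp(exp t).\<close>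
  define C where "C = B * fact (R + 5)"
  have *: "norm (delta_kernel t) * exp (real R * t) \<le> C * (exp (- exp t) * exp t)" if t: "t \<ge> 0" for t
  proof -
    let ?y = "exp t"
    have y: "?y \<ge> 1" using t by simp
    have "norm (delta_kernel t) \<le> B * exp (- 2 * pi * ?y) * ?y ^ 6"
      using B(2)[of "\<i> * of_real ?y"] y
      by (simp add: delta_kernel_def delta_def norm_mult exp_of_nat_mult[symmetric])
    moreover have "exp (real R * t) = ?y ^ R" by (rule exp_of_nat_mult)
    ultimately have "norm (delta_kernel t) * exp (real R * t) \<le> B * exp (- 2 * pi * ?y) * ?y ^ 6 * ?y ^ R"
      by (simp add: mult_right_mono)
    also have "\<dots> = B * exp (- 2 * pi * ?y) * ?y ^ (R + 5) * ?y"
      by (simp add: power_add eval_nat_numeral)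
    also have "\<dots> \<le> B * exp (- 2 * pi * ?y) * (fact (R + 5) * exp ?y) * ?y"
      using B(1) y by (intro mult_right_mono mult_left_mono power_le_fact_exp) auto
    also have "\<dots> = C * (exp (- 2 * pi * ?y + ?y) * ?y)" by (simp only: C_def exp_add mult_ac)
    also have "\<dots> \<le> C * (exp (- ?y) * ?y)"
    proof -
      have "2 * ?y \<le> 2 * pi * ?y" using pi_gt3 by simp
      then show ?thesis using B(1) by (simp add: C_def)
    qed
    finally show ?thesis .
  qed
  have C0: "C \<ge> 0" using B(1) by (simp add: C_def)
  have "norm (delta_kernel t) * exp (real R * \<bar>t\<bar>) \<le> C * (exp (- exp t) * exp t + exp (- exp (- t)) * exp (- t))" for t
  proof (cases "t \<ge> 0")
    case True
    then have "norm (delta_kernel t) * exp (real R * \<bar>t\<bar>) \<le> C * (exp (- exp t) * exp t)" using *[of t] by simp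
    also have "\<dots> \<le> C * (exp (- exp t) * exp t + exp (- exp (- t)) * exp (- t))"
      using C0 by (intro mult_left_mono) auto
    finally show ?thesis .
  next
    case False
    then have "norm (delta_kernel t) * exp (real R * \<bar>t\<bar>) \<le> C * (exp (- exp (- t)) * exp (- t))"
      using *[of "- t"] by (simp add: delta_kernel_even)
    also have "\<dots> \<le> C * (exp (- exp t) * exp t + exp (- exp (- t)) * exp (- t))"
      using C0 by (intro mult_left_mono) auto
    finally show ?thesis .
  qed
  with C0 show thesis by (rule that)
qed

lemma integrable_delta_kernel_abs: "integrable lborel (\<lambda>t. norm (delta_kernel t) * exp (r * \<bar>t\<bar>))"
proof -
  obtain R :: nat where R: "r \<le> real R" using real_arch_simple by blast
  obtain C where C: "\<And>t. norm (delta_kernel t) * exp (real R * \<bar>t\<bar>) \<le> C * (exp (- exp t) * exp t + exp (- exp (- t)) * exp (- t))"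
    using delta_kernel_decay by blast
  show ?thesis
  proof (rule Bochner_Integration.integrable_bound)
    show "integrable lborel (\<lambda>t. C * (exp (- exp t) * exp t + exp (- exp (- t)) * exp (- t)))"
      using integrable_double_exp integrable_reflect[OF integrable_double_exp] by simp
    show "AE t in lborel. norm (norm (delta_kernel t) * exp (r * \<bar>t\<bar>)) \<le> norm (C * (exp (- exp t) * exp t + exp (- exp (- t)) * exp (- t)))"
    proof (rule AE_I2)
      fix t
      have "norm (delta_kernel t) * exp (r * \<bar>t\<bar>) \<le> norm (delta_kernel t) * exp (real R * \<bar>t\<bar>)"
        using R by (intro mult_left_mono) (auto intro: mult_right_mono)
      with C[of t] show "norm (norm (delta_kernel t) * exp (r * \<bar>t\<bar>)) \<le> norm (C * (exp (- exp t) * exp t + exp (- exp (- t)) * exp (- t)))"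
        by simp
    qed
  qed measurable
qed

text \<open>Under y = exp t this is the integral of \<open>delta\<close> at iy against y^(u + 6)
  dy/y, so u = s - 6 is the distance from the centre of the functional equation.\<close>

definition delta_transform :: "complex \<Rightarrow> complex" where
  "delta_transform u = (LINT t|lborel. delta_kernel t * exp (of_real t * u))"

lemma delta_transform_even: "delta_transform (- u) = delta_transform u"
  unfolding delta_transform_def
  using integral_reflect[of "\<lambda>t. delta_kernel t * exp (of_real t * u)"] by (simp add: delta_kernel_even)

text \<open>At u = 0 the integrand is a positive function; a vanishing integral would force it to be
  0 almost everywhere.\<close>

lemma delta_transform_0: "delta_transform 0 \<noteq> 0"
proof
  assume 0: "delta_transform 0 = 0"
  have eq: "delta_kernel t = of_real (norm (delta_kernel t))" for t
    using delta_kernel_pos[of t] by auto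
  have int: "integrable lborel (\<lambda>t. norm (delta_kernel t))" using integrable_delta_kernel_abs[of 0] by simp
  have "delta_transform 0 = (LINT t|lborel. complex_of_real (norm (delta_kernel t)))"
    unfolding delta_transform_def by (simp add: eq[symmetric])
  also have "\<dots> = of_real (LINT t|lborel. norm (delta_kernel t))"
    by (rule integral_complex_of_real)
  finally have "(LINT t|lborel. norm (delta_kernel t)) = 0" using 0 by simp
  then have "AE t in lborel. norm (delta_kernel t) = 0"
    using integral_nonneg_eq_0_iff_AE[OF int] by simp
  moreover have "norm (delta_kernel t) \<noteq> 0" for t using delta_kernel_pos[of t] by auto
  ultimately have "AE t::real in lborel. False" by simp
  then have "ae_filter (lborel :: real measure) = bot" by (simp add: trivial_limit_def)
  then show False by (simp add: ae_filter_eq_bot_iff)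
qed

text \<open>The exponential is expanded and integrated term by term. The partial sums of the norms
  stay below the kernel times exp(|u| |t|), which is integrable for every u; this is what makes the
  transform entire.\<close>

lemma delta_transform_power_series:
  "(\<lambda>n. (LINT t|lborel. delta_kernel t * of_real t ^ n) / fact n * u ^ n) sums delta_transform u"
proof -
  define f where "f n t = delta_kernel t * ((of_real t * u) ^ n / fact n)" for n t
  have exp_sums: "(\<lambda>n. x ^ n / fact n) sums exp x" for x :: complex
    using exp_converges[of x] by (simp add: scaleR_conv_of_real field_simps)
  have exp_sums_real: "(\<lambda>n. x ^ n / fact n) sums exp x" for x :: real
    using exp_converges[of x] by (simp add: field_simps)
  have nf: "norm (f n t) = norm (delta_kernel t) * ((norm u * \<bar>t\<bar>) ^ n / fact n)" for n t
    by (simp add: f_def norm_mult norm_divide norm_power mult.commute)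
  have partial: "(\<Sum>i<n. norm (f i t)) \<le> norm (delta_kernel t) * exp (norm u * \<bar>t\<bar>)" for n t
  proof -
    have "(\<Sum>i<n. (norm u * \<bar>t\<bar>) ^ i / fact i) \<le> exp (norm u * \<bar>t\<bar>)"
      using sum_le_suminf[OF sums_summable[OF exp_sums_real[of "norm u * \<bar>t\<bar>"]], of "{..<n}"]
        sums_unique[OF exp_sums_real[of "norm u * \<bar>t\<bar>"]] by simp
    then show ?thesis unfolding nf sum_distrib_left[symmetric] by (intro mult_left_mono) auto
  qed
  have meas: "f n \<in> borel_measurable lborel" for n unfolding f_def by measurable
  have int: "integrable lborel (f n)" for n
  proof (rule Bochner_Integration.integrable_bound[OF integrable_delta_kernel_abs[of "norm u"] meas])
    have "norm (f n t) \<le> norm (delta_kernel t) * exp (norm u * \<bar>t\<bar>)" for t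
      using partial[of t "Suc n"] sum_nonneg[of "{..<n}" "\<lambda>i. norm (f i t)"] by simp
    then show "AE t in lborel. norm (f n t) \<le> norm (norm (delta_kernel t) * exp (norm u * \<bar>t\<bar>))"
      by (intro AE_I2) simp
  qed
  have sm: "summable (\<lambda>n. norm (f n t))" for t
    unfolding nf using sums_summable[OF exp_sums_real] by (intro summable_mult)
  have smi: "summable (\<lambda>n. LINT t|lborel. norm (f n t))"
  proof (rule bounded_imp_summable)
    show "(\<Sum>i\<le>n. LINT t|lborel. norm (f i t)) \<le> (LINT t|lborel. norm (delta_kernel t) * exp (norm u * \<bar>t\<bar>))" for n
    proof -
      have "(\<Sum>i\<le>n. LINT t|lborel. norm (f i t)) = (LINT t|lborel. (\<Sum>i\<le>n. norm (f i t)))"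
        using int by (intro Bochner_Integration.integral_sum[symmetric]) auto
      also have "\<dots> \<le> (LINT t|lborel. norm (delta_kernel t) * exp (norm u * \<bar>t\<bar>))"
        using int partial[of _ "Suc n"] unfolding lessThan_Suc_atMost
        by (intro integral_mono integrable_delta_kernel_abs Bochner_Integration.integrable_sum) auto
      finally show ?thesis .
    qed
  qed auto
  have "(\<lambda>n. integral\<^sup>L lborel (f n)) sums (LINT t|lborel. suminf (\<lambda>n. f n t))"
    by (rule sums_integral[OF int _ smi]) (use sm in auto)
  moreover have "suminf (\<lambda>n. f n t) = delta_kernel t * exp (of_real t * u)" for t
    unfolding f_def by (rule sums_unique[OF sums_mult[OF exp_sums], symmetric])
  moreover have "integral\<^sup>L lborel (f n) = (LINT t|lborel. delta_kernel t * of_real t ^ n) / fact n * u ^ n" for n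
  proof -
    have "f n = (\<lambda>t. delta_kernel t * of_real t ^ n * (u ^ n / fact n))"
      by (simp add: f_def fun_eq_iff power_mult_distrib)
    then show ?thesis by simp
  qed
  ultimately show ?thesis by (simp add: delta_transform_def)
qed

lemma holomorphic_delta_transform: "delta_transform holomorphic_on UNIV"
proof -
  have "delta_transform holomorphic_on ball 0 r" for r
    by (rule power_series_holomorphic[of 0 r "\<lambda>n. (LINT t|lborel. delta_kernel t * of_real t ^ n) / fact n"])
       (use delta_transform_power_series in simp)
  then have "delta_transform field_differentiable at u" for u
    by (rule holomorphic_on_imp_differentiable_at[of _ "ball 0 (norm u + 1)"]) auto
  then show ?thesis by (simp add: holomorphic_on_def field_differentiable_at_within)
qed

section \<open>The Dirichlet series of the discriminant\<close>

lemma has_sum_atLeast_1: "(g has_sum x) {1..} \<longleftrightarrow> ((\<lambda>n. g (Suc n)) has_sum x) UNIV"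
proof -
  have "{1..} = range Suc" by (auto simp: image_iff) presburger
  then show ?thesis by (simp add: has_sum_reindex o_def)
qed

text \<open>Comparison with n^(l - \<sigma>). For l = 6 this yields the abscissa 7 used
  below.\<close>

lemma summable_hecke_dirichlet:
  fixes a :: "nat \<Rightarrow> complex"
  assumes "\<And>n. n \<ge> 1 \<Longrightarrow> norm (a n) \<le> C * real n ^ l" "\<sigma> > real l + 1"
  shows "summable (\<lambda>n. norm (a (Suc n)) * exp (- \<sigma> * ln (real (Suc n))))"
proof (rule summable_comparison_test')
  have "summable (\<lambda>n. real n powr (real l - \<sigma>))"
    using assms(2) by (subst summable_real_powr_iff) simp
  then show "summable (\<lambda>n. C * real (Suc n) powr (real l - \<sigma>))"
    by (intro summable_mult) (subst summable_Suc_iff)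
  fix n :: nat
  have "norm (a (Suc n)) * exp (- \<sigma> * ln (real (Suc n))) \<le> C * real (Suc n) ^ l * exp (- \<sigma> * ln (real (Suc n)))"
    by (intro mult_right_mono assms(1)) auto
  also have "\<dots> = C * real (Suc n) powr (real l - \<sigma>)"
    by (simp add: powr_def left_diff_distrib exp_diff exp_of_nat_mult exp_minus divide_inverse del: of_nat_Suc)
  finally show "norm (norm (a (Suc n)) * exp (- \<sigma> * ln (real (Suc n)))) \<le> C * real (Suc n) powr (real l - \<sigma>)"
    by simp
qed

text \<open>Hecke's computation: the n-th term of the q-expansion along z = i exp t integrates to
  a(n) Gamma(s) (2 pi n)^(-s). The formula is solved for the Dirichlet series, with
  \<open>rGamma\<close> in place of a division, so that its right side is entire in s.\<close>

lemma delta_transform_dirichlet: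
  assumes "Re s > 7"
  shows "((\<lambda>n. taylor_coeff delta_q n * exp (- s * of_real (ln (real n)))) has_sum
    (exp (s * of_real (ln (2 * pi))) * rGamma s * delta_transform (s - 6))) {1..}"
proof -
  define a where "a = taylor_coeff delta_q"
  define c where "c n = 2 * pi * real (Suc n)" for n
  have c: "c n > 0" for n by (simp add: c_def del: of_nat_Suc)
  have ln_c: "ln (c n) = ln (2 * pi) + ln (real (Suc n))" for n
    unfolding c_def by (subst ln_mult) simp_all
  have delta_eq: "\<And>z. Im z > 0 \<Longrightarrow> delta z = delta_q (qexp z)" by (simp add: delta_def)
  define f where "f n t = a (Suc n) * (exp (- of_real (c n * exp t)) * exp (of_real t * s))" for n t
  obtain C where C: "\<And>n. n \<ge> 1 \<Longrightarrow> norm (a n) \<le> C * real n ^ 6"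
    using hecke_bound[OF elliptic_cusp_form_delta holomorphic_on_delta_q delta_eq] unfolding taylor_coeff_def a_def by metis
  note sm = summable_hecke_dirichlet[of a C 6 "Re s", OF C]
  have s0: "Re s > 0" using assms by simp
  have int: "integrable lborel (f n)" for n
    unfolding f_def by (intro integrable_mult_right mellin_exp c s0)
  have val: "integral\<^sup>L lborel (f n) = Gamma s * exp (- s * of_real (ln (2 * pi))) * (a (Suc n) * exp (- s * of_real (ln (real (Suc n)))))" for n
  proof -
    have "integral\<^sup>L lborel (f n) = a (Suc n) * (Gamma s * exp (- s * of_real (ln (c n))))"
      unfolding f_def by (subst integral_mult_right_zero) (simp only: mellin_exp(2)[OF c s0])
    also have "exp (- s * of_real (ln (c n))) = exp (- s * of_real (ln (2 * pi))) * exp (- s * of_real (ln (real (Suc n))))"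
      by (simp add: ln_c exp_add[symmetric] distrib_left del: of_nat_Suc)
    finally show ?thesis by (simp only: mult_ac)
  qed
  \<comment> \<open>The integral of the norm is the same Mellin integral at the real point Re s, so
    the coefficient bound controls the sum of these integrals.\<close>
  have nval: "(LINT t|lborel. norm (f n t)) = norm (Gamma (of_real (Re s)) :: complex) * exp (- Re s * ln (2 * pi)) * (norm (a (Suc n)) * exp (- Re s * ln (real (Suc n))))" for n
  proof -
    have s0': "Re (of_real (Re s)) > 0" using s0 by simp
    have "complex_of_real (norm (f n t)) = of_real (norm (a (Suc n))) * (exp (- of_real (c n * exp t)) * exp (of_real t * of_real (Re s)))" for t
    proof -
      have "norm (f n t) = norm (a (Suc n)) * (exp (- (c n * exp t)) * exp (t * Re s))"
        by (simp add: f_def norm_mult)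
      then show ?thesis by (simp only: of_real_mult exp_of_real[symmetric] of_real_minus)
    qed
    then have "complex_of_real (LINT t|lborel. norm (f n t))
        = (LINT t|lborel. of_real (norm (a (Suc n))) * (exp (- of_real (c n * exp t)) * exp (of_real t * of_real (Re s))))"
      by (simp only: integral_complex_of_real[symmetric])
    also have "\<dots> = of_real (norm (a (Suc n))) * (Gamma (of_real (Re s)) * exp (- of_real (Re s) * of_real (ln (c n))))"
      by (subst integral_mult_right_zero) (simp only: mellin_exp(2)[OF c s0'])
    finally have "norm (complex_of_real (LINT t|lborel. norm (f n t))) = norm \<dots>" by (rule arg_cong)
    moreover have "(LINT t|lborel. norm (f n t)) \<ge> 0" by simp
    ultimately have "(LINT t|lborel. norm (f n t)) = norm (a (Suc n)) * (norm (Gamma (of_real (Re s)) :: complex) * exp (- Re s * ln (c n)))"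
      by (simp add: norm_mult)
    also have "exp (- Re s * ln (c n)) = exp (- Re s * ln (2 * pi)) * exp (- Re s * ln (real (Suc n)))"
      by (simp add: ln_c exp_add[symmetric] distrib_left del: of_nat_Suc)
    finally show ?thesis by (simp only: mult_ac)
  qed
  have smi: "summable (\<lambda>n. LINT t|lborel. norm (f n t))"
    unfolding nval using assms by (intro summable_mult sm) auto
  have pw: "((\<lambda>n. f n t) has_sum (delta_kernel t * exp (of_real t * (s - 6)))) UNIV" for t
  proof -
    have "((\<lambda>n. a n * qexp (\<i> * of_real (exp t)) ^ n) has_sum delta (\<i> * of_real (exp t))) {1..}"
      unfolding a_def
      by (rule cusp_form_has_sum[OF elliptic_cusp_form_delta holomorphic_on_delta_q delta_q_0 delta_eq]) simp_all
    then have "((\<lambda>n. a (Suc n) * qexp (\<i> * of_real (exp t)) ^ Suc n) has_sum delta (\<i> * of_real (exp t))) UNIV"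
      unfolding has_sum_atLeast_1 .
    then have "((\<lambda>n. a (Suc n) * qexp (\<i> * of_real (exp t)) ^ Suc n * exp (of_real t * s)) has_sum
        delta (\<i> * of_real (exp t)) * exp (of_real t * s)) UNIV"
      by (rule has_sum_cmult_left)
    moreover have "qexp (\<i> * of_real (exp t)) ^ Suc n = exp (- of_real (c n * exp t))" for n
    proof -
      have "qexp (\<i> * of_real (exp t)) ^ Suc n = complex_of_real (exp (- 2 * pi * exp t) ^ Suc n)"
        by (simp only: qexp_imaginary of_real_power)
      also have "exp (- 2 * pi * exp t) ^ Suc n = exp (- (c n * exp t))"
        unfolding exp_of_nat_mult[symmetric] c_def by (simp only: mult_ac mult_minus_left mult_minus_right)
      finally show ?thesis by (simp only: exp_of_real[symmetric] of_real_minus)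
    qed
    moreover have "delta (\<i> * of_real (exp t)) * exp (of_real t * s) = delta_kernel t * exp (of_real t * (s - 6))"
    proof -
      have "complex_of_real (exp (6 * t)) = exp (of_real t * 6)"
        by (simp add: exp_of_real[symmetric] mult.commute)
      then show ?thesis by (simp add: delta_kernel_def mult.assoc exp_add[symmetric] right_diff_distrib)
    qed
    ultimately show ?thesis by (simp only: f_def mult.assoc)
  qed
  have pwabs: "summable (\<lambda>n. norm (f n t))" for t
  proof -
    have "(\<lambda>n. f n t) summable_on UNIV" using pw has_sum_imp_summable by blast
    then have "(\<lambda>n. norm (f n t)) summable_on UNIV"
      by (simp add: summable_on_iff_abs_summable_on_complex)
    then show ?thesis by (rule summable_on_imp_summable)
  qed
  have "(\<lambda>n. integral\<^sup>L lborel (f n)) sums (LINT t|lborel. suminf (\<lambda>n. f n t))"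
    by (rule sums_integral[OF int _ smi]) (use pwabs in auto)
  moreover have "suminf (\<lambda>n. f n t) = delta_kernel t * exp (of_real t * (s - 6))" for t
    using has_sum_imp_sums[OF pw] sums_unique by metis
  ultimately have "(\<lambda>n. Gamma s * exp (- s * of_real (ln (2 * pi))) * (a (Suc n) * exp (- s * of_real (ln (real (Suc n)))))) sums delta_transform (s - 6)"
    unfolding val delta_transform_def by simp
  then have "(\<lambda>n. exp (s * of_real (ln (2 * pi))) * rGamma s * (Gamma s * exp (- s * of_real (ln (2 * pi))) * (a (Suc n) * exp (- s * of_real (ln (real (Suc n))))))) sums
      (exp (s * of_real (ln (2 * pi))) * rGamma s * delta_transform (s - 6))"
    by (rule sums_mult)
  moreover have "exp (s * of_real (ln (2 * pi))) * rGamma s * (Gamma s * exp (- s * of_real (ln (2 * pi))) * x) = x" for x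
  proof -
    have "s \<notin> \<int>\<^sub>\<le>\<^sub>0" using s0 by (auto elim!: nonpos_Ints_cases)
    then have "Gamma s \<noteq> 0" by (simp add: Gamma_eq_zero_iff)
    then show ?thesis by (simp add: rGamma_inverse_Gamma exp_minus field_simps)
  qed
  ultimately have "(\<lambda>n. a (Suc n) * exp (- s * of_real (ln (real (Suc n))))) sums
      (exp (s * of_real (ln (2 * pi))) * rGamma s * delta_transform (s - 6))" by (simp only:)
  moreover have "summable (\<lambda>n. norm (a (Suc n) * exp (- s * of_real (ln (real (Suc n))))))"
    using sm assms by (simp add: norm_mult del: of_nat_Suc)
  ultimately show ?thesis
    unfolding has_sum_atLeast_1 a_def[symmetric] by (intro norm_summable_imp_has_sum)
qed

section \<open>The Koecher-Maass series in genus 1\<close>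

lemma GL_int_1: "GL_int 1 = {mat 1 1 (\<lambda>_. 1), mat 1 1 (\<lambda>_. - 1)}"
proof (intro equalityI subsetI)
  fix U assume "U \<in> GL_int 1"
  then obtain B where U: "U \<in> carrier_mat 1 1" and B: "U * B = 1\<^sub>m (dim_row U)" "B * U = 1\<^sub>m (dim_row B)"
    unfolding GL_int_def invertible_mat_def inverts_mat_def by auto
  have "dim_col B = 1" using arg_cong[OF B(1), of dim_col] U by simp
  moreover have "dim_row B = 1" using arg_cong[OF B(2), of dim_col] U by simp
  ultimately have "B \<in> carrier_mat 1 1" by (auto simp del: One_nat_def)
  then have "U $$ (0, 0) * B $$ (0, 0) = 1"
    using mult_mat_1_1[OF U, of B] B(1) U by simp
  then have "U $$ (0, 0) = 1 \<or> U $$ (0, 0) = - 1" by (auto simp: zmult_eq_1_iff)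
  then show "U \<in> {mat 1 1 (\<lambda>_. 1), mat 1 1 (\<lambda>_. - 1)}"
    using U by (auto intro!: mat_1_1_eqI)
next
  fix U :: "int mat" assume U: "U \<in> {mat 1 1 (\<lambda>_. 1), mat 1 1 (\<lambda>_. - 1)}"
  then have "U \<in> carrier_mat 1 1" "U * U = 1\<^sub>m 1"
    by (auto intro!: mat_1_1_eqI simp: scalar_prod_def)
  then show "U \<in> GL_int 1"
    unfolding GL_int_def invertible_mat_def inverts_mat_def by auto
qed

lemma gl_act_1:
  assumes "U \<in> GL_int 1" "T \<in> carrier_mat 1 1"
  shows "gl_act U T = T"
  using assms unfolding GL_int_1 gl_act_def
  by (auto intro!: mat_1_1_eqI simp: scalar_prod_def)

lemma aut_number_1:
  assumes "T \<in> carrier_mat 1 1"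
  shows "aut_number 1 T = 2"
proof -
  have "mat 1 1 (\<lambda>_. 1 :: int) \<noteq> mat 1 1 (\<lambda>_. - 1)"
  proof
    assume "mat 1 1 (\<lambda>_. 1 :: int) = mat 1 1 (\<lambda>_. - 1)"
    then have "mat 1 1 (\<lambda>_. 1 :: int) $$ (0, 0) = mat 1 1 (\<lambda>_. - 1) $$ (0, 0)" by simp
    then show False by simp
  qed
  moreover have "{U \<in> GL_int 1. gl_act U T = T} = GL_int 1" using gl_act_1[OF _ assms] by auto
  ultimately show ?thesis by (simp add: aut_number_def GL_int_1 del: One_nat_def)
qed

lemma gl_orbits_1: "gl_orbits 1 = (\<lambda>n. {scalar_mat_1 n}) ` {1..}"
proof -
  have "{(T, T'). T \<in> half_integral_pos 1 \<and> (\<exists>U\<in>GL_int 1. T' = gl_act U T)} = Id_on (half_integral_pos 1)"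
    using gl_act_1 by (auto simp: half_integral_pos_1 GL_int_1 simp del: One_nat_def)
  then show ?thesis
    unfolding gl_orbits_def by (auto simp: quotient_def half_integral_pos_1 simp del: One_nat_def)
qed

text \<open>The factor 1/2 is the reciprocal of the number of automorphisms, since both units 1 and
  -1 fix every T.\<close>

definition delta_koecher_maass :: "complex \<Rightarrow> complex" where
  "delta_koecher_maass s = 1 / 2 * (exp (s * of_real (ln (2 * pi))) * rGamma s * delta_transform (s - 6))"

lemma koecher_maass_has_sum_delta:
  assumes "Re s > 7"
  shows "((\<lambda>c. koecher_maass_term 1 (siegel_lift delta) s (SOME T. T \<in> c)) has_sum delta_koecher_maass s) (gl_orbits 1)"
proof -
  have fc: "fourier_coeff 1 (siegel_lift delta) = fourier_coeff_1 delta_q"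
    by (rule fourier_coeff_lift[OF elliptic_cusp_form_delta holomorphic_on_delta_q delta_q_0]) (simp add: delta_def)
  have "koecher_maass_term 1 (siegel_lift delta) s (SOME T. T \<in> {scalar_mat_1 n})
      = 1 / 2 * (taylor_coeff delta_q n * exp (- s * of_real (ln (real n))))" if "n \<ge> 1" for n
  proof -
    have "det (scalar_mat_1 n) = real n" using det_single[OF scalar_mat_1(1)] by simp
    moreover have "complex_of_real (real n) powr (- s) = exp (- s * of_real (ln (real n)))"
      using that by (simp add: powr_def Ln_of_nat)
    ultimately show ?thesis
      unfolding koecher_maass_term_def fc
      using that by (simp add: fourier_coeff_1_scalar aut_number_1 del: One_nat_def of_real_of_nat_eq)
  qed
  then have "((\<lambda>n. koecher_maass_term 1 (siegel_lift delta) s (SOME T. T \<in> {scalar_mat_1 n})) has_sum delta_koecher_maass s) {1..}"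
    unfolding delta_koecher_maass_def
    using has_sum_cmult_right[OF delta_transform_dirichlet[OF assms], of "1 / 2"]
    by (subst has_sum_cong) auto
  moreover have "inj_on (\<lambda>n. {scalar_mat_1 n}) {1..}"
    using inj_scalar_mat_1 by (auto simp: inj_on_def)
  ultimately show ?thesis
    unfolding gl_orbits_1 by (subst has_sum_reindex) (simp_all add: o_def del: One_nat_def)
qed

lemma holomorphic_delta_koecher_maass: "delta_koecher_maass holomorphic_on UNIV"
proof -
  have "delta_transform \<circ> (\<lambda>s. s - 6) holomorphic_on UNIV"
    by (rule holomorphic_on_compose_gen[OF _ holomorphic_delta_transform]) (auto intro!: holomorphic_intros)
  then have "(\<lambda>s. delta_transform (s - 6)) holomorphic_on UNIV" by (simp add: o_def)
  then show ?thesis unfolding delta_koecher_maass_def[abs_def] by (intro holomorphic_intros)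
qed

lemma koecher_maass_delta: "koecher_maass 1 (siegel_lift delta) = delta_koecher_maass"
  unfolding koecher_maass_def
proof (rule the_equality)
  show "delta_koecher_maass holomorphic_on UNIV \<and>
     (\<exists>\<sigma>. \<forall>s. Re s > \<sigma> \<longrightarrow> ((\<lambda>c. koecher_maass_term 1 (siegel_lift delta) s (SOME T. T \<in> c)) has_sum delta_koecher_maass s) (gl_orbits 1))"
    using holomorphic_delta_koecher_maass koecher_maass_has_sum_delta by blast
  fix D assume D: "D holomorphic_on UNIV \<and>
     (\<exists>\<sigma>. \<forall>s. Re s > \<sigma> \<longrightarrow> ((\<lambda>c. koecher_maass_term 1 (siegel_lift delta) s (SOME T. T \<in> c)) has_sum D s) (gl_orbits 1))"
  then obtain \<sigma> where \<sigma>: "\<And>s. Re s > \<sigma> \<Longrightarrow>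
      ((\<lambda>c. koecher_maass_term 1 (siegel_lift delta) s (SOME T. T \<in> c)) has_sum D s) (gl_orbits 1)" by blast
  have "D s = delta_koecher_maass s" for s
  \<comment> \<open>The abscissa \<sigma> of a competitor is arbitrary; both series are summed for
    Re s > max \<sigma> 7, and agreement on this half-plane extends to the plane.\<close>
  proof (rule analytic_continuation_open[of "{s. Re s > max \<sigma> 7}" UNIV D delta_koecher_maass])
    show "{s. Re s > max \<sigma> 7} \<noteq> {}"
      by (metis (mono_tags, lifting) Re_complex_of_real empty_iff gt_ex mem_Collect_eq)
    show "D s = delta_koecher_maass s" if "s \<in> {s. Re s > max \<sigma> 7}" for s
      using that has_sum_unique[OF \<sigma>[of s] koecher_maass_has_sum_delta[of s]] by simp
  qed (use D holomorphic_delta_koecher_maass in \<open>auto simp: open_halfspace_Re_gt simp del: max_less_iff_conj\<close>)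
  then show "D = delta_koecher_maass" by blast
qed

lemma delta_koecher_maass_center: "delta_koecher_maass 6 \<noteq> 0"
proof -
  have "(6 :: complex) \<notin> \<int>\<^sub>\<le>\<^sub>0" by (auto elim!: nonpos_Ints_cases simp: complex_eq_iff)
  then show ?thesis
    using delta_transform_0 by (simp add: delta_koecher_maass_def rGamma_eq_zero_iff)
qed

section \<open>Logarithmic derivatives and transcendence degree\<close>

lemma is_subfield_rat_adjoin: "is_subfield (rat_adjoin B)"
  unfolding rat_adjoin_def by (rule hull_in) (auto simp: is_subfield_def)

text \<open>The generated fields are nested, so the supremum for \<open>B\<close> runs over at least
  as many independent sets. The main inequality thus becomes a statement of membership in a
  field.\<close>

lemma trdeg_mono:
  assumes "A \<subseteq> rat_adjoin B"
  shows "trdeg A \<le> trdeg B"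
proof -
  have "rat_adjoin A \<subseteq> rat_adjoin B"
    using hull_minimal[of A "rat_adjoin B" is_subfield] assms is_subfield_rat_adjoin by (simp add: rat_adjoin_def)
  then show ?thesis unfolding trdeg_def by (intro SUP_subset_mono) auto
qed

context
  fixes K :: "complex set"
  assumes K: "is_subfield K"
begin

lemma subfield_diff: "x \<in> K \<Longrightarrow> y \<in> K \<Longrightarrow> x - y \<in> K"
  and subfield_mult: "x \<in> K \<Longrightarrow> y \<in> K \<Longrightarrow> x * y \<in> K"
  and subfield_0: "0 \<in> K" and subfield_1: "1 \<in> K"
  using K by (auto simp: is_subfield_def)

lemma subfield_uminus: "x \<in> K \<Longrightarrow> - x \<in> K"
  using subfield_diff[OF subfield_0, of x] by simp

lemma subfield_add: "x \<in> K \<Longrightarrow> y \<in> K \<Longrightarrow> x + y \<in> K"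
  using subfield_diff[OF _ subfield_uminus, of x y] by simp

lemma subfield_inverse: "x \<in> K \<Longrightarrow> inverse x \<in> K"
  using K subfield_0 by (cases "x = 0") (auto simp: is_subfield_def)

lemma subfield_divide: "x \<in> K \<Longrightarrow> y \<in> K \<Longrightarrow> x / y \<in> K"
  by (simp add: divide_inverse subfield_mult subfield_inverse)

lemma subfield_of_nat: "of_nat n \<in> K"
  by (induction n) (auto intro: subfield_0 subfield_1 subfield_add)

lemma subfield_power: "x \<in> K \<Longrightarrow> x ^ n \<in> K"
  by (induction n) (auto intro: subfield_1 subfield_mult)

lemma subfield_sum: "(\<And>i. i \<in> A \<Longrightarrow> f i \<in> K) \<Longrightarrow> sum f A \<in> K"
  by (induction A rule: infinite_finite_induct) (auto intro: subfield_0 subfield_add)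

text \<open>Leibniz's rule for D' = (D'/D) D, divided by D(a), expresses the n-th derivative of D'/D
  through D^(n+1)(a)/D(a) and lower derivatives, with integer coefficients. The order n + 1 is the
  reason for the strict bound n < N.\<close>

lemma subfield_higher_deriv_log_deriv:
  assumes D: "D holomorphic_on UNIV" "D a \<noteq> 0"
    and d: "\<And>m. 1 \<le> m \<Longrightarrow> m \<le> N \<Longrightarrow> (deriv ^^ m) D a / D a \<in> K"
    and "n < N"
  shows "(deriv ^^ n) (\<lambda>s. deriv D s / D s) a \<in> K"
  using \<open>n < N\<close>
proof (induction n rule: less_induct)
  case (less n)
  let ?l = "\<lambda>s. deriv D s / D s"
  define U where "U = {s. D s \<noteq> 0}"
  have "continuous_on UNIV D" using D by (simp add: holomorphic_on_imp_continuous_on)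
  then have U: "open U" "a \<in> U" using D(2)
    by (auto simp: U_def intro: open_Collect_neq continuous_on_const)
  have D': "deriv D holomorphic_on UNIV" by (rule holomorphic_deriv[OF D(1) open_UNIV])
  have DU: "D holomorphic_on U" "deriv D holomorphic_on U"
    using D(1) D' by (auto elim: holomorphic_on_subset)
  then have lU: "?l holomorphic_on U" by (intro holomorphic_on_divide) (auto simp: U_def)
  have "(deriv ^^ Suc n) D a = (deriv ^^ n) (deriv D) a" by (simp add: funpow_swap1)
  also have "\<dots> = (deriv ^^ n) (\<lambda>s. ?l s * D s) a"
    by (rule higher_deriv_transform_within_open[OF DU(2) holomorphic_on_mult[OF lU DU(1)] U]) (auto simp: U_def)
  also have "\<dots> = (\<Sum>i = 0..n. of_nat (n choose i) * (deriv ^^ i) ?l a * (deriv ^^ (n - i)) D a)"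
    by (rule higher_deriv_mult[OF lU DU(1) U])
  also have "\<dots> = (deriv ^^ n) ?l a * D a + (\<Sum>i<n. of_nat (n choose i) * (deriv ^^ i) ?l a * (deriv ^^ (n - i)) D a)"
    by (simp add: atLeast0AtMost lessThan_Suc_atMost[symmetric])
  finally have "(deriv ^^ n) ?l a = (deriv ^^ Suc n) D a / D a
      - (\<Sum>i<n. of_nat (n choose i) * (deriv ^^ i) ?l a * ((deriv ^^ (n - i)) D a / D a))"
    using D(2) by (simp add: field_simps sum_divide_distrib[symmetric] del: funpow.simps)
  moreover have "(deriv ^^ Suc n) D a / D a \<in> K" using less.prems by (intro d) auto
  moreover have "of_nat (n choose i) * (deriv ^^ i) ?l a * ((deriv ^^ (n - i)) D a / D a) \<in> K" if "i < n" for i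
    using that less.prems by (intro subfield_mult subfield_of_nat less.IH d) auto
  ultimately show ?case by (simp only:) (intro subfield_diff subfield_sum; simp)
qed

text \<open>The recurrence of the polygamma function gives a finite sum of rational numbers as the
  difference, and every subfield contains the rationals.\<close>

lemma subfield_Polygamma_shift:
  assumes "Polygamma n (of_nat (Suc m)) \<in> K"
  shows "Polygamma n (1 :: complex) \<in> K"
proof -
  have "(1 :: complex) \<noteq> - of_nat k" for k
  proof
    assume "(1 :: complex) = - of_nat k"
    then have "complex_of_nat (Suc k) = 0" by (simp add: eq_neg_iff_add_eq_0)
    then show False by (simp only: of_nat_eq_0_iff)
  qed
  then have "Polygamma n (1 + of_nat m) = Polygamma n 1 + (-1) ^ n * fact n * (\<Sum>k<m. 1 / (1 + of_nat k) ^ Suc n :: complex)"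
    by (intro Polygamma_plus_of_nat) blast
  then have "Polygamma n (1 :: complex) = Polygamma n (of_nat (Suc m)) - (-1) ^ n * of_nat (fact n) * (\<Sum>k<m. 1 / (1 + of_nat k) ^ Suc n)"
    by simp
  also have "\<dots> \<in> K"
    by (intro subfield_diff subfield_mult subfield_power subfield_uminus subfield_1 subfield_of_nat
        subfield_sum subfield_divide subfield_add assms)
  finally show ?thesis .
qed

end

section \<open>Logarithmic derivatives at the centre\<close>

lemma higher_deriv_even_log_deriv:
  assumes L: "L holomorphic_on UNIV" "\<And>u. L (- u) = L u" "L 0 \<noteq> 0" and "even n"
  shows "(deriv ^^ n) (\<lambda>u. deriv L u / L u) 0 = 0"
proof -
  let ?m = "\<lambda>u. deriv L u / L u"
  define U where "U = {u. L u \<noteq> 0}"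
  have "continuous_on UNIV L" using L by (simp add: holomorphic_on_imp_continuous_on)
  then have U: "open U" "0 \<in> U" using L(3)
    by (auto simp: U_def intro: open_Collect_neq continuous_on_const)
  have L': "deriv L holomorphic_on UNIV" by (rule holomorphic_deriv[OF L(1) open_UNIV])
  have mU: "?m holomorphic_on U"
    using L(1) L' by (intro holomorphic_on_divide) (auto simp: U_def elim: holomorphic_on_subset)
  have odd: "?m (- u) = - ?m u" for u
  proof -
    have der: "(L has_field_derivative deriv L v) (at v)" for v
      using L(1) by (intro holomorphic_derivI[of _ UNIV]) auto
    have "((\<lambda>u. L (- u)) has_field_derivative deriv L (- u) * (- 1)) (at u)"
      by (rule DERIV_chain2[OF der]) (auto intro!: derivative_eq_intros)
    then have "deriv L (- u) * (- 1) = deriv L u"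
      using DERIV_unique[OF der] by (simp add: L(2))
    then have "deriv L (- u) = - deriv L u" by (metis minus_minus mult_minus1_right)
    then show ?thesis by (simp add: L(2))
  qed
  \<comment> \<open>The n-th derivative at 0 of the reflected function is computed twice: the chain
    rule gives the factor (-1)^n = 1, oddness gives the factor -1.\<close>
  have "(deriv ^^ n) (\<lambda>u. ?m (- 1 * u)) 0 = (- 1) ^ n * (deriv ^^ n) ?m (- 1 * 0)"
    by (rule higher_deriv_compose_linear[OF mU U(1) U(1) U(2)]) (auto simp: U_def L(2))
  also have "\<dots> = (deriv ^^ n) ?m 0" using \<open>even n\<close> by simp
  also have "(\<lambda>u. ?m (- 1 * u)) = (\<lambda>u. - ?m u)" using odd by simp
  also have "(deriv ^^ n) (\<lambda>u. - ?m u) 0 = - (deriv ^^ n) ?m 0"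
    by (rule higher_deriv_uminus[OF mU U])
  finally show ?thesis by (simp add: equation_minus_iff)
qed

text \<open>Re s > 0 keeps s off the zeros of \<open>rGamma\<close>, whose logarithmic derivative is
  -psi. The constant factor 1/2 drops out.\<close>

lemma log_deriv_delta_koecher_maass:
  assumes "Re s > 0" "delta_transform (s - 6) \<noteq> 0"
  shows "deriv delta_koecher_maass s / delta_koecher_maass s
    = of_real (ln (2 * pi)) - Digamma s + deriv delta_transform (s - 6) / delta_transform (s - 6)"
proof -
  have s: "s \<notin> \<int>\<^sub>\<le>\<^sub>0" using assms(1) by (auto elim!: nonpos_Ints_cases)
  have rG: "rGamma s \<noteq> 0" using s by (simp add: rGamma_eq_zero_iff)
  have der: "(delta_transform has_field_derivative deriv delta_transform v) (at v)" for v
    using holomorphic_delta_transform by (intro holomorphic_derivI[of _ UNIV]) auto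
  have d1: "((\<lambda>s. delta_transform (s - 6)) has_field_derivative deriv delta_transform (s - 6) * 1) (at s)"
    by (rule DERIV_chain2[OF der]) (auto intro!: derivative_eq_intros)
  let ?L = "complex_of_real (ln (2 * pi))"
  let ?E = "exp (s * ?L)" and ?T = "delta_transform (s - 6)"
  have "((\<lambda>s. 1 / 2 * (exp (s * ?L) * rGamma s * delta_transform (s - 6))) has_field_derivative
      1 / 2 * ((?E * ?L * rGamma s + - rGamma s * Digamma s * ?E) * ?T + deriv delta_transform (s - 6) * 1 * (?E * rGamma s))) (at s)"
    by (intro DERIV_cmult DERIV_mult' [THEN DERIV_cong] DERIV_mult d1 has_field_derivative_rGamma_no_nonpos_int s)
       (auto intro!: derivative_eq_intros)
  then have "deriv delta_koecher_maass s =
      1 / 2 * ((?E * ?L * rGamma s + - rGamma s * Digamma s * ?E) * ?T + deriv delta_transform (s - 6) * 1 * (?E * rGamma s))"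
    unfolding delta_koecher_maass_def[abs_def] by (rule DERIV_imp_deriv)
  then show ?thesis
    using rG assms(2) by (simp add: delta_koecher_maass_def field_simps)
qed

lemma higher_log_deriv_delta:
  assumes "m \<ge> 1"
  shows "(deriv ^^ (2 * m)) (\<lambda>s. deriv delta_koecher_maass s / delta_koecher_maass s) 6 = - Polygamma (2 * m) 6"
proof -
  let ?m = "\<lambda>u. deriv delta_transform u / delta_transform u"
  define W where "W = {u. delta_transform u \<noteq> 0}"
  define U where "U = {s. Re s > 0} \<inter> {s. delta_transform (s - 6) \<noteq> 0}"
  have cont: "continuous_on UNIV delta_transform"
    using holomorphic_delta_transform by (simp add: holomorphic_on_imp_continuous_on)
  then have W: "open W" by (auto simp: W_def intro: open_Collect_neq continuous_on_const)
  have "continuous_on UNIV (\<lambda>s. delta_transform (s - 6))"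
    by (rule continuous_on_compose2[OF cont]) (auto intro!: continuous_intros)
  then have U: "open U" "6 \<in> U"
    using delta_transform_0 unfolding U_def
    by (auto intro!: open_Int open_halfspace_Re_gt open_Collect_neq continuous_on_const)
  have mW: "?m holomorphic_on W"
    using holomorphic_delta_transform holomorphic_deriv[OF holomorphic_delta_transform open_UNIV]
    by (intro holomorphic_on_divide) (auto simp: W_def elim: holomorphic_on_subset)
  have UW: "1 * s + (- 6) \<in> W" if "s \<in> U" for s using that by (simp add: U_def W_def)
  have shift: "(deriv ^^ (2 * m)) (\<lambda>s. ?m (1 * s + (- 6))) 6 = 1 ^ (2 * m) * (deriv ^^ (2 * m)) ?m (1 * 6 + (- 6))"
    by (rule higher_deriv_compose_linear'[OF mW U(1) W U(2) UW])
  have "?m \<circ> (\<lambda>s. s - 6) holomorphic_on U"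
    by (rule holomorphic_on_compose_gen[OF _ mW]) (use UW in \<open>auto intro!: holomorphic_intros\<close>)
  then have mU: "(\<lambda>s. ?m (s - 6)) holomorphic_on U" by (simp add: o_def)
  have psiU: "Digamma holomorphic_on U"
    by (intro holomorphic_intros) (auto simp: U_def elim!: nonpos_Ints_cases)
  have cU: "(\<lambda>s. complex_of_real (ln (2 * pi))) holomorphic_on U" by simp
  have D0: "delta_koecher_maass s \<noteq> 0" if "s \<in> U" for s
    using that by (auto simp: U_def delta_koecher_maass_def rGamma_eq_zero_iff elim!: nonpos_Ints_cases)
  have DU: "delta_koecher_maass holomorphic_on U" "deriv delta_koecher_maass holomorphic_on U"
    using holomorphic_delta_koecher_maass holomorphic_deriv[OF holomorphic_delta_koecher_maass open_UNIV]
    by (auto elim: holomorphic_on_subset)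
  have "(deriv ^^ (2 * m)) (\<lambda>s. deriv delta_koecher_maass s / delta_koecher_maass s) 6
      = (deriv ^^ (2 * m)) (\<lambda>s. of_real (ln (2 * pi)) - Digamma s + ?m (s - 6)) 6"
  proof (rule higher_deriv_transform_within_open[OF _ _ U])
    show "(\<lambda>s. deriv delta_koecher_maass s / delta_koecher_maass s) holomorphic_on U"
      using DU D0 by (intro holomorphic_on_divide) auto
    show "(\<lambda>s. of_real (ln (2 * pi)) - Digamma s + ?m (s - 6)) holomorphic_on U"
      by (intro holomorphic_on_add holomorphic_on_diff cU psiU mU)
  qed (auto simp: U_def log_deriv_delta_koecher_maass)
  also have "\<dots> = (deriv ^^ (2 * m)) (\<lambda>s. complex_of_real (ln (2 * pi))) 6 - (deriv ^^ (2 * m)) Digamma 6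
      + (deriv ^^ (2 * m)) (\<lambda>s. ?m (s - 6)) 6"
    by (subst higher_deriv_add[OF holomorphic_on_diff[OF cU psiU] mU U], subst higher_deriv_diff[OF cU psiU U]) simp
  \<comment> \<open>Since m \<ge> 1 the order is positive, which removes log(2 pi).\<close>
  also have "(deriv ^^ (2 * m)) (\<lambda>s. complex_of_real (ln (2 * pi))) 6 = 0" using assms by simp
  also have "(deriv ^^ (2 * m)) (\<lambda>s. ?m (s - 6)) 6 = 0"
    using shift higher_deriv_even_log_deriv[OF holomorphic_delta_transform delta_transform_even delta_transform_0, of "2 * m"]
    by simp
  also have "(deriv ^^ (2 * m)) Digamma 6 = (Polygamma (2 * m) 6 :: complex)"
    by (subst higher_deriv_Polygamma) (auto elim!: nonpos_Ints_cases simp: complex_eq_iff)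
  finally show ?thesis by simp
qed

lemma L_set_delta:
  assumes "1 \<le> m" "m \<le> M"
  shows "(deriv ^^ m) delta_koecher_maass 6 / delta_koecher_maass 6 \<in> L_set M"
proof -
  have "siegel_lift delta \<in> E_set 1 12 (of_int 12 / 2)"
    using hecke_eigen_cusp_form_delta delta_koecher_maass_center
    by (simp add: E_set_def koecher_maass_delta del: One_nat_def)
  \<comment> \<open>The witnesses are g = 1 and k = 12: indeed 12 > 2 (1 + 1), and the centre is 12
    / 2 = 6.\<close>
  then show ?thesis
    unfolding L_set_def using assms
    by (intro CollectI exI[of _ 1] exI[of _ "12::int"] exI[of _ "siegel_lift delta"] exI[of _ m])
       (simp add: koecher_maass_delta del: One_nat_def)
qed

theorem theorem20:
  fixes M :: nat
  assumes "M \<ge> 1"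
  shows "trdeg (L_set M) \<ge>
    trdeg {(deriv ^^ (2 * m)) Digamma (1 :: complex) | m. 1 \<le> m \<and> m \<le> (M - 1) div 2}"
proof (rule trdeg_mono, safe)
  fix m assume m: "1 \<le> m" "m \<le> (M - 1) div 2"
  let ?K = "rat_adjoin (L_set M)"
  note K = is_subfield_rat_adjoin[of "L_set M"]
  have "L_set M \<subseteq> ?K" unfolding rat_adjoin_def by (rule hull_subset)
  \<comment> \<open>From m \<le> (M - 1) div 2 and M \<ge> 1 follows 2m < M, as the recursion over
    derivatives requires.\<close>
  then have "(deriv ^^ (2 * m)) (\<lambda>s. deriv delta_koecher_maass s / delta_koecher_maass s) 6 \<in> ?K"
    using L_set_delta m assms
    by (intro subfield_higher_deriv_log_deriv[OF K holomorphic_delta_koecher_maass delta_koecher_maass_center, of M]) auto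
  then have "Polygamma (2 * m) (6 :: complex) \<in> ?K"
    using subfield_uminus[OF K] m by (fastforce simp: higher_log_deriv_delta)
  \<comment> \<open>The centre is 6 = Suc 5, five steps of the recurrence away from 1.\<close>
  then have "Polygamma (2 * m) (1 :: complex) \<in> ?K"
    by (intro subfield_Polygamma_shift[OF K, of _ 5]) simp
  moreover have "(deriv ^^ (2 * m)) Digamma (1 :: complex) = Polygamma (2 * m) 1"
    by (subst higher_deriv_Polygamma) (auto elim!: nonpos_Ints_cases simp: complex_eq_iff)
  ultimately show "(deriv ^^ (2 * m)) Digamma (1 :: complex) \<in> ?K" by simp
qed

end
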